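(* Let $(K,v)$ be a valued field. The sets $\mathbb{V}_{\rm vt}$ and $\mathbb{V}_{\rm rt}$ are each dense in $\mathbb{V}=\mathbb{V}(v)$ equipped with the valuation spectrum topology.
   Context: A valuation on a commutative unital ring $R$ is a map $\nu:R\to\Gamma\cup\{\infty\}$, $\Gamma$ a totally ordered abelian group, with $\nu(ab)=\nu(a)+\nu(b)$, $\nu(a+b)\geq\min\{\nu(a),\nu(b)\}$, $\nu(1)=0$, $\nu(0)=\infty$. Its value group $\Gamma_\nu$ is the subgroup generated by its finite values, and its support is the prime ideal $\nu^{-1}(\infty)$. Two valuations $\nu,\nu'$ on $R$ are equivalent if for all $a,b\in R$: $\nu(a)>\nu(b)\iff\nu'(a)>\nu'(b)$ (equivalently, $\nu=\Phi\circ\nu'$ for an order-preserving isomorphism $\Phi:\Gamma_{\nu'}\to\Gamma_\nu$). $\mathbb{V}=\mathbb{V}(v)$ is the set of equivalence classes $[\nu]$ of valuations $\nu$ on $K[x]$ whose restriction to $K$ is equivalent to $v$ (one identifies $\Gamma_v$ with its image in $\Gamma_\nu$). If $\nu$ has trivial support it extends to $K(x)$, with residue field $k_\nu$, an extension of the residue field $k_v$ of $v$. Such a $\nu$ is value-transcendental if $\Gamma_\nu/\Gamma_v$ is not a torsion group, and residue-transcendental if $k_\nu/k_v$ is transcendental. $\mathbb{V}_{\rm vt}$ (resp. $\mathbb{V}_{\rm rt}$) is the set of classes of value-transcendental (resp. residue-transcendental) valuations. The valuation spectrum topology on $\mathbb{V}$ has as subbasis the sets $U(f,g)=\{[\nu]\in\mathbb{V}\mid\nu(f)\geq\nu(g)\neq\infty\}$,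 $f,g\in K[x]$. *)

theory Defs
  imports "HOL-Analysis.Abstract_Topology" "HOL-Algebra.Algebra" "HOL-Algebra.Algebraic_Closure_Type"
begin

section \<open>Totally ordered abelian groups\<close>

text \<open>Value groups are carrier-based, so that valuations with different value groups
  live in one type. They are written multiplicatively, following HOL-Algebra: the product
  is the addition of the value group, and the unit is its zero.\<close>

record 'g ordered_group = "'g monoid" +
  order_rel :: "'g rel"

locale ordered_abelian_group = comm_group G
  for G :: "('g, 'm) ordered_group_scheme" (structure) +
  assumes linear_order: "linear_order_on (carrier G) (order_rel G)"
    and mult_mono: "\<lbrakk>a \<in> carrier G; b \<in> carrier G; c \<in> carrier G; (a, b) \<in> order_rel G\<rbrakk>
      \<Longrightarrow> (c \<otimes> a, c \<otimes> b) \<in> order_rel G"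

text \<open>\<open>\<Gamma> \<union> {\<infinity>}\<close> is rendered by the option type, with \<^term>\<open>None\<close> as \<open>\<infinity>\<close>.\<close>

definition val_plus :: "'g ordered_group \<Rightarrow> 'g option \<Rightarrow> 'g option \<Rightarrow> 'g option" where
  "val_plus G x y = (case (x, y) of (Some a, Some b) \<Rightarrow> Some (a \<otimes>\<^bsub>G\<^esub> b) | _ \<Rightarrow> None)"

definition val_minus :: "'g ordered_group \<Rightarrow> 'g option \<Rightarrow> 'g option \<Rightarrow> 'g option" where
  "val_minus G x y = (case (x, y) of (Some a, Some b) \<Rightarrow> Some (a \<otimes>\<^bsub>G\<^esub> inv\<^bsub>G\<^esub> b) | _ \<Rightarrow> None)"

definition val_le :: "'g ordered_group \<Rightarrow> 'g option \<Rightarrow> 'g option \<Rightarrow> bool" where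
  "val_le G x y = (case (x, y) of (_, None) \<Rightarrow> True | (None, Some b) \<Rightarrow> False
     | (Some a, Some b) \<Rightarrow> (a, b) \<in> order_rel G)"

definition val_less :: "'g ordered_group \<Rightarrow> 'g option \<Rightarrow> 'g option \<Rightarrow> bool" where
  "val_less G x y \<longleftrightarrow> val_le G x y \<and> x \<noteq> y"

definition val_min :: "'g ordered_group \<Rightarrow> 'g option \<Rightarrow> 'g option \<Rightarrow> 'g option" where
  "val_min G x y = (if val_le G x y then x else y)"


section \<open>Valuations\<close>

record ('r, 'g) pre_valuation =
  grp :: "'g ordered_group"
  val :: "'r \<Rightarrow> 'g option"

definition valuation :: "('r::comm_ring_1, 'g) pre_valuation \<Rightarrow> bool" where
  "valuation \<nu> \<longleftrightarrow> ordered_abelian_group (grp \<nu>) \<and>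
     (\<forall>a. val \<nu> a \<in> insert None (Some ` carrier (grp \<nu>))) \<and>
     (\<forall>a b. val \<nu> (a * b) = val_plus (grp \<nu>) (val \<nu> a) (val \<nu> b)) \<and>
     (\<forall>a b. val_le (grp \<nu>) (val_min (grp \<nu>) (val \<nu> a) (val \<nu> b)) (val \<nu> (a + b))) \<and>
     val \<nu> 1 = Some \<one>\<^bsub>grp \<nu>\<^esub> \<and> val \<nu> 0 = None"

definition val_support :: "('r, 'g) pre_valuation \<Rightarrow> 'r set" where
  "val_support \<nu> = {a. val \<nu> a = None}"

definition value_group :: "('r, 'g) pre_valuation \<Rightarrow> 'g set" where
  "value_group \<nu> = generate (grp \<nu>) {g. \<exists>a. val \<nu> a = Some g}"

definition val_equiv :: "('r, 'g) pre_valuation \<Rightarrow> ('r, 'h) pre_valuation \<Rightarrow> bool" where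
  "val_equiv \<nu> \<nu>' \<longleftrightarrow> (\<forall>a b. val_less (grp \<nu>) (val \<nu> b) (val \<nu> a) \<longleftrightarrow>
     val_less (grp \<nu>') (val \<nu>' b) (val \<nu>' a))"

text \<open>The extension \<open>\<nu>(a/b) = \<nu>(a) - \<nu>(b)\<close> to the fraction field; it is meaningful
  when \<open>\<nu>\<close> has trivial support.\<close>

definition fract_ext :: "('r::idom, 'g) pre_valuation \<Rightarrow> ('r fract, 'g) pre_valuation" where
  "fract_ext \<nu> = \<lparr>grp = grp \<nu>,
     val = (\<lambda>q. THE y. \<exists>a b. b \<noteq> 0 \<and> q = Fract a b \<and> y = val_minus (grp \<nu>) (val \<nu> a) (val \<nu> b))\<rparr>"

definition valuation_ring :: "('f::field, 'g) pre_valuation \<Rightarrow> 'f ring" where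
  "valuation_ring \<nu> = ring_of_type_algebra
     \<lparr>carrier := {a. val_le (grp \<nu>) (Some \<one>\<^bsub>grp \<nu>\<^esub>) (val \<nu> a)}\<rparr>"

definition valuation_ideal :: "('f::field, 'g) pre_valuation \<Rightarrow> 'f set" where
  "valuation_ideal \<nu> = {a. val_less (grp \<nu>) (Some \<one>\<^bsub>grp \<nu>\<^esub>) (val \<nu> a)}"

definition residue_field :: "('f::field, 'g) pre_valuation \<Rightarrow> 'f set ring" where
  "residue_field \<nu> = valuation_ring \<nu> Quot valuation_ideal \<nu>"

definition residue_class :: "('f::field, 'g) pre_valuation \<Rightarrow> 'f \<Rightarrow> 'f set" where
  "residue_class \<nu> a = valuation_ideal \<nu> +>\<^bsub>valuation_ring \<nu>\<^esub> a"


section \<open>Valuations on a polynomial ring over a valued field\<close>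

definition val_restrict :: "('k::field poly, 'g) pre_valuation \<Rightarrow> ('k, 'g) pre_valuation" where
  "val_restrict \<nu> = \<lparr>grp = grp \<nu>, val = (\<lambda>c. val \<nu> [:c:])\<rparr>"

definition torsion_group :: "('c, 'm) monoid_scheme \<Rightarrow> bool" where
  "torsion_group G \<longleftrightarrow> (\<forall>x\<in>carrier G. \<exists>n::nat. n > 0 \<and> x [^]\<^bsub>G\<^esub> n = \<one>\<^bsub>G\<^esub>)"

text \<open>In the two definitions below, \<open>v\<close> enters through the restriction of \<open>\<nu>\<close> to \<open>K\<close>, to
  which it is equivalent: \<open>\<Gamma>\<^sub>v\<close> is identified with the value group of the restriction,
  and \<open>k\<^sub>v\<close> with its image in \<open>k\<^sub>\<nu>\<close>, the set of residue classes of the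
  constants of nonnegative value.\<close>

definition value_transcendental :: "('k::field poly, 'g) pre_valuation \<Rightarrow> bool" where
  "value_transcendental \<nu> \<longleftrightarrow> val_support \<nu> = {0} \<and>
     \<not> torsion_group (grp \<nu>\<lparr>carrier := value_group \<nu>\<rparr> Mod value_group (val_restrict \<nu>))"

definition residue_subfield :: "('k::field poly, 'g) pre_valuation \<Rightarrow> 'k poly fract set set" where
  "residue_subfield \<nu> = (\<lambda>c. residue_class (fract_ext \<nu>) (to_fract [:c:])) `
     carrier (valuation_ring (val_restrict \<nu>))"

definition residue_transcendental :: "('k::field poly, 'g) pre_valuation \<Rightarrow> bool" where
  "residue_transcendental \<nu> \<longleftrightarrow> val_support \<nu> = {0} \<and>
     (\<exists>t\<in>carrier (residue_field (fract_ext \<nu>)).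
        (ring.transcendental (residue_field (fract_ext \<nu>)) over residue_subfield \<nu>) t)"


section \<open>The valuation spectrum\<close>

text \<open>The value groups of the valuations that make up the classes are taken with carriers
  in the following type. By \<open>valuation_in_universe\<close> below, every
  valuation on \<open>R\<close>, whatever its value group, is equivalent to one of this kind.\<close>

type_synonym 'r value_universe = "('r \<times> 'r) set"

type_synonym 'k poly_valuation = "('k poly, 'k poly value_universe) pre_valuation"

definition extensions :: "('k::field, 'g) pre_valuation \<Rightarrow> 'k poly_valuation set" where
  "extensions v = {\<nu>. valuation \<nu> \<and> val_equiv (val_restrict \<nu>) v}"

definition equiv_rel :: "('k::field, 'g) pre_valuation \<Rightarrow> 'k poly_valuation rel" where
  "equiv_rel v = {(\<nu>, \<nu>'). \<nu> \<in> extensions v \<and> \<nu>' \<in> extensions v \<and> val_equiv \<nu> \<nu>'}"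

definition val_class :: "('k::field, 'g) pre_valuation \<Rightarrow> 'k poly_valuation \<Rightarrow> 'k poly_valuation set" where
  "val_class v \<nu> = equiv_rel v `` {\<nu>}"

definition VV :: "('k::field, 'g) pre_valuation \<Rightarrow> 'k poly_valuation set set" where
  "VV v = extensions v // equiv_rel v"

definition VV_vt :: "('k::field, 'g) pre_valuation \<Rightarrow> 'k poly_valuation set set" where
  "VV_vt v = val_class v ` {\<nu> \<in> extensions v. value_transcendental \<nu>}"

definition VV_rt :: "('k::field, 'g) pre_valuation \<Rightarrow> 'k poly_valuation set set" where
  "VV_rt v = val_class v ` {\<nu> \<in> extensions v. residue_transcendental \<nu>}"

definition VV_subbasic :: "('k::field, 'g) pre_valuation \<Rightarrow> 'k poly \<Rightarrow> 'k poly \<Rightarrow> 'k poly_valuation set set" where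
  "VV_subbasic v f g = val_class v `
     {\<nu> \<in> extensions v. val_le (grp \<nu>) (val \<nu> g) (val \<nu> f) \<and> val \<nu> g \<noteq> None}"

definition valuation_spectrum :: "('k::field, 'g) pre_valuation \<Rightarrow> 'k poly_valuation set topology" where
  "valuation_spectrum v = topology_generated_by {VV_subbasic v f g | f g. True}"


section \<open>Well-definedness\<close>

lemma equiv_equiv_rel: "equiv (extensions v) (equiv_rel v)"
  unfolding equiv_rel_def val_equiv_def by (auto simp: equiv_def refl_on_def sym_def trans_def)

lemma VV_conv_class: "VV v = val_class v ` extensions v"
  by (auto simp: VV_def val_class_def quotient_def)

lemma topspace_valuation_spectrum: "topspace (valuation_spectrum v) = VV v"
proof -
  have "VV_subbasic v 0 1 = VV v"
    by (auto simp: VV_subbasic_def VV_conv_class extensions_def valuation_def val_le_def)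
  moreover have "VV_subbasic v f g \<subseteq> VV v" for f g
    by (auto simp: VV_subbasic_def VV_conv_class)
  ultimately show ?thesis
    unfolding valuation_spectrum_def topology_generated_by_topspace by blast
qed

lemma fract_ext_Fract:
  fixes \<nu> :: "('r::idom, 'g) pre_valuation"
  assumes \<nu>: "valuation \<nu>" and supp: "val_support \<nu> = {0}" and b: "b \<noteq> 0"
  shows "val (fract_ext \<nu>) (Fract a b) = val_minus (grp \<nu>) (val \<nu> a) (val \<nu> b)"
proof -
  define G where "G = grp \<nu>"
  interpret G: ordered_abelian_group G using \<nu> by (simp add: valuation_def G_def)
  have V: "s \<in> carrier G" if "val \<nu> x = Some s" for x s
    using \<nu> that unfolding valuation_def G_def
    by (metis image_iff insert_iff option.distinct(1) option.inject)
  have N: "val \<nu> x = None \<longleftrightarrow> x = 0" for x using supp by (auto simp: val_support_def)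
  have M: "val \<nu> (x * y) = val_plus G (val \<nu> x) (val \<nu> y)" for x y
    using \<nu> by (simp add: valuation_def G_def)
  have "val_minus G (val \<nu> c) (val \<nu> d) = val_minus G (val \<nu> a) (val \<nu> b)"
    if d: "d \<noteq> 0" and eq: "Fract a b = Fract c d" for c d
  proof (cases "a = 0")
    case True
    with eq b d have "c = 0" by (simp add: eq_fract(1)[OF b d])
    with True N[of 0] show ?thesis by (simp add: val_minus_def)
  next
    case False
    have eq': "a * d = c * b" using eq eq_fract(1)[OF b d] by blast
    then have "c \<noteq> 0" using False d by auto
    with False b d N[of a] N[of b] N[of c] N[of d] obtain s t s' t' where
      *: "val \<nu> a = Some s" "val \<nu> b = Some t" "val \<nu> c = Some s'" "val \<nu> d = Some t'"
      by blast
    note [simp] = V[OF *(1)] V[OF *(2)] V[OF *(3)] V[OF *(4)]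
    have cross: "s \<otimes>\<^bsub>G\<^esub> t' = s' \<otimes>\<^bsub>G\<^esub> t"
      using M[of a d] M[of c b] eq' * by (simp add: val_plus_def)
    have swap: "p \<otimes>\<^bsub>G\<^esub> q \<otimes>\<^bsub>G\<^esub> (x \<otimes>\<^bsub>G\<^esub> y) = p \<otimes>\<^bsub>G\<^esub> x \<otimes>\<^bsub>G\<^esub> (q \<otimes>\<^bsub>G\<^esub> y)"
      if "p \<in> carrier G" "q \<in> carrier G" "x \<in> carrier G" "y \<in> carrier G" for p q x y
      using that by (simp add: G.m_ac)
    have "s \<otimes>\<^bsub>G\<^esub> t' \<otimes>\<^bsub>G\<^esub> (inv\<^bsub>G\<^esub> t \<otimes>\<^bsub>G\<^esub> inv\<^bsub>G\<^esub> t') = s \<otimes>\<^bsub>G\<^esub> inv\<^bsub>G\<^esub> t"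
      "s' \<otimes>\<^bsub>G\<^esub> t \<otimes>\<^bsub>G\<^esub> (inv\<^bsub>G\<^esub> t' \<otimes>\<^bsub>G\<^esub> inv\<^bsub>G\<^esub> t) = s' \<otimes>\<^bsub>G\<^esub> inv\<^bsub>G\<^esub> t'"
      using swap[of s t' "inv\<^bsub>G\<^esub> t" "inv\<^bsub>G\<^esub> t'"] swap[of s' t "inv\<^bsub>G\<^esub> t'" "inv\<^bsub>G\<^esub> t"]
      by simp_all
    then have "s \<otimes>\<^bsub>G\<^esub> inv\<^bsub>G\<^esub> t = s' \<otimes>\<^bsub>G\<^esub> inv\<^bsub>G\<^esub> t'"
      using cross G.m_comm[of "inv\<^bsub>G\<^esub> t" "inv\<^bsub>G\<^esub> t'"] by simp
    with * show ?thesis by (simp add: val_minus_def)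
  qed
  then have "(THE y. \<exists>c d. d \<noteq> 0 \<and> Fract a b = Fract c d \<and> y = val_minus G (val \<nu> c) (val \<nu> d))
      = val_minus G (val \<nu> a) (val \<nu> b)"
    using b by (intro the_equality) blast+
  then show ?thesis by (simp add: fract_ext_def G_def)
qed

text \<open>Transport of a valuation along an injection that is defined on a subgroup of the value
  group containing all finite values.\<close>

lemma valuation_transport:
  fixes \<nu> :: "('r::comm_ring_1, 'g) pre_valuation" and \<phi> :: "'g \<Rightarrow> 'h"
  assumes \<nu>: "valuation \<nu>" and H: "subgroup H (grp \<nu>)" and inj: "inj_on \<phi> H"
    and fin: "\<And>a g. val \<nu> a = Some g \<Longrightarrow> g \<in> H"
  shows "\<exists>\<nu>' :: ('r, 'h) pre_valuation. valuation \<nu>' \<and> val_equiv \<nu> \<nu>'"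
proof -
  define G where "G = grp \<nu>"
  interpret G: ordered_abelian_group G using \<nu> by (simp add: valuation_def G_def)
  interpret H: subgroup H G using H by (simp add: G_def)
  define \<psi> where "\<psi> = inv_into H \<phi>"
  have \<psi>: "\<psi> (\<phi> h) = h" if "h \<in> H" for h using inj that by (simp add: \<psi>_def)
  define G' :: "'h ordered_group" where "G' = \<lparr>carrier = \<phi> ` H,
    monoid.mult = (\<lambda>A B. \<phi> (\<psi> A \<otimes>\<^bsub>G\<^esub> \<psi> B)), one = \<phi> \<one>\<^bsub>G\<^esub>,
    order_rel = {(\<phi> a, \<phi> b) | a b. a \<in> H \<and> b \<in> H \<and> (a, b) \<in> order_rel G}\<rparr>"
  have sel: "carrier G' = \<phi> ` H" "\<one>\<^bsub>G'\<^esub> = \<phi> \<one>\<^bsub>G\<^esub>"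
    "\<And>A B. A \<otimes>\<^bsub>G'\<^esub> B = \<phi> (\<psi> A \<otimes>\<^bsub>G\<^esub> \<psi> B)"
    "order_rel G' = {(\<phi> a, \<phi> b) | a b. a \<in> H \<and> b \<in> H \<and> (a, b) \<in> order_rel G}"
    by (simp_all add: G'_def)
  have ord: "(\<phi> a, \<phi> b) \<in> order_rel G' \<longleftrightarrow> (a, b) \<in> order_rel G" if "a \<in> H" "b \<in> H" for a b
    using that inj by (auto simp: sel inj_on_def)
  have lin: "refl_on (carrier G) (order_rel G)" "trans (order_rel G)"
    "antisym (order_rel G)" "total_on (carrier G) (order_rel G)"
    using G.linear_order by (simp_all add: order_on_defs)
  have "comm_group G'"
  proof (rule comm_groupI)
    fix x assume "x \<in> carrier G'"
    then obtain h where h: "h \<in> H" "x = \<phi> h" by (auto simp: sel)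
    then show "\<exists>y\<in>carrier G'. y \<otimes>\<^bsub>G'\<^esub> x = \<one>\<^bsub>G'\<^esub>"
      by (intro bexI[of _ "\<phi> (inv\<^bsub>G\<^esub> h)"]) (auto simp: sel \<psi>)
  qed (auto simp: sel \<psi> G.m_ac)
  moreover have "linear_order_on (carrier G') (order_rel G')"
    unfolding order_on_defs
  proof (intro conjI)
    show "order_rel G' \<subseteq> carrier G' \<times> carrier G'" by (auto simp: sel)
    show "refl_on (carrier G') (order_rel G')"
      using lin(1) ord by (auto simp: refl_on_def sel(1))
    show "trans (order_rel G')"
    proof (rule transI)
      fix x y z assume "(x, y) \<in> order_rel G'" "(y, z) \<in> order_rel G'"
      then obtain a b c where "x = \<phi> a" "y = \<phi> b" "z = \<phi> c" "a \<in> H" "b \<in> H" "c \<in> H"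
        "(a, b) \<in> order_rel G" "(b, c) \<in> order_rel G"
        using inj unfolding sel(4) inj_on_def by blast
      then show "(x, z) \<in> order_rel G'" using lin(2) ord by (metis transD)
    qed
    show "antisym (order_rel G')"
    proof (rule antisymI)
      fix x y assume "(x, y) \<in> order_rel G'" "(y, x) \<in> order_rel G'"
      then obtain a b where "x = \<phi> a" "y = \<phi> b" "a \<in> H" "b \<in> H"
        "(a, b) \<in> order_rel G" "(b, a) \<in> order_rel G"
        using inj unfolding sel(4) inj_on_def by blast
      then show "x = y" using lin(3) by (metis antisymD)
    qed
    show "total_on (carrier G') (order_rel G')"
    proof (rule total_onI)
      fix x y assume "x \<in> carrier G'" "y \<in> carrier G'" "x \<noteq> y"
      then obtain a b where "x = \<phi> a" "y = \<phi> b" "a \<in> H" "b \<in> H" "a \<noteq> b" by (auto simp: sel(1))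
      then show "(x, y) \<in> order_rel G' \<or> (y, x) \<in> order_rel G'"
        using lin(4) ord by (auto simp: total_on_def)
    qed
  qed
  moreover have "(z \<otimes>\<^bsub>G'\<^esub> x, z \<otimes>\<^bsub>G'\<^esub> y) \<in> order_rel G'"
    if "x \<in> carrier G'" "y \<in> carrier G'" "z \<in> carrier G'" "(x, y) \<in> order_rel G'" for x y z
  proof -
    obtain a b c where "x = \<phi> a" "y = \<phi> b" "z = \<phi> c" "a \<in> H" "b \<in> H" "c \<in> H"
      using \<open>x \<in> carrier G'\<close> \<open>y \<in> carrier G'\<close> \<open>z \<in> carrier G'\<close> by (auto simp: sel(1))
    with that(4) show ?thesis
      using G.mult_mono[of a b c] by (simp add: sel(3) \<psi> ord)
  qed
  ultimately have G': "ordered_abelian_group G'"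
    by (simp add: ordered_abelian_group_def ordered_abelian_group_axioms_def)
  define \<nu>' :: "('r, 'h) pre_valuation"
    where "\<nu>' = \<lparr>grp = G', val = (\<lambda>a. map_option \<phi> (val \<nu> a))\<rparr>"
  have V: "val \<nu> a \<in> insert None (Some ` H)" for a
    using fin[of a] by (cases "val \<nu> a") auto
  have le: "val_le G' (map_option \<phi> x) (map_option \<phi> y) \<longleftrightarrow> val_le G x y"
    if "x \<in> insert None (Some ` H)" "y \<in> insert None (Some ` H)" for x y
    using that by (auto simp: val_le_def ord)
  have inj': "map_option \<phi> x = map_option \<phi> y \<longleftrightarrow> x = y"
    if "x \<in> insert None (Some ` H)" "y \<in> insert None (Some ` H)" for x y
    using that inj by (auto simp: inj_on_def)
  have min: "val_min G' (map_option \<phi> x) (map_option \<phi> y) = map_option \<phi> (val_min G x y)"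
    "val_min G x y \<in> insert None (Some ` H)"
    if "x \<in> insert None (Some ` H)" "y \<in> insert None (Some ` H)" for x y
    using that le[OF that] by (simp_all add: val_min_def)
  have plus: "val_plus G' (map_option \<phi> x) (map_option \<phi> y) = map_option \<phi> (val_plus G x y)"
    if "x \<in> insert None (Some ` H)" "y \<in> insert None (Some ` H)" for x y
    using that by (auto simp: val_plus_def sel \<psi>)
  have "valuation \<nu>'"
    unfolding valuation_def
  proof (intro conjI allI)
    show "val \<nu>' a \<in> insert None (Some ` carrier (grp \<nu>'))" for a
      using V[of a] by (auto simp: \<nu>'_def sel)
    show "val \<nu>' (a * b) = val_plus (grp \<nu>') (val \<nu>' a) (val \<nu>' b)" for a b
      using \<nu> plus[OF V V, of a b] by (simp add: \<nu>'_def valuation_def G_def)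
    show "val_le (grp \<nu>') (val_min (grp \<nu>') (val \<nu>' a) (val \<nu>' b)) (val \<nu>' (a + b))" for a b
      using \<nu> by (simp add: \<nu>'_def min(1)[OF V V] le[OF min(2)[OF V V] V])
        (simp add: valuation_def G_def)
  qed (use \<nu> G' in \<open>simp_all add: \<nu>'_def valuation_def sel G_def\<close>)
  moreover have "val_equiv \<nu> \<nu>'"
    by (simp add: val_equiv_def val_less_def \<nu>'_def le[OF V V] inj'[OF V V] flip: G_def)
  ultimately show ?thesis by blast
qed

lemma valuation_in_universe:
  fixes \<nu> :: "('r::comm_ring_1, 'g) pre_valuation"
  assumes "valuation \<nu>"
  shows "\<exists>\<nu>' :: ('r, 'r value_universe) pre_valuation. valuation \<nu>' \<and> val_equiv \<nu> \<nu>'"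
proof -
  define G where "G = grp \<nu>"
  interpret G: ordered_abelian_group G using assms by (simp add: valuation_def G_def)
  define H where "H = {s \<otimes>\<^bsub>G\<^esub> inv\<^bsub>G\<^esub> t | s t a b. val \<nu> a = Some s \<and> val \<nu> b = Some t}"
  define \<phi> where "\<phi> h = {(a, b). \<exists>s t. val \<nu> a = Some s \<and> val \<nu> b = Some t \<and> h = s \<otimes>\<^bsub>G\<^esub> inv\<^bsub>G\<^esub> t}" for h
  have V: "s \<in> carrier G" if "val \<nu> a = Some s" for a s
    using assms that unfolding valuation_def G_def by (metis image_iff insert_iff option.distinct(1) option.inject)
  have mult: "val \<nu> (a * b) = Some (s \<otimes>\<^bsub>G\<^esub> t)" if "val \<nu> a = Some s" "val \<nu> b = Some t" for a b s t
    using assms that by (simp add: valuation_def val_plus_def G_def)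
  have one: "val \<nu> 1 = Some \<one>\<^bsub>G\<^esub>" using assms by (simp add: valuation_def G_def)
  have "subgroup H G"
  proof (rule G.subgroupI)
    show "H \<subseteq> carrier G" by (auto simp: H_def dest: V)
    show "H \<noteq> {}" using one unfolding H_def by blast
  next
    fix x assume "x \<in> H"
    then obtain s t a b where *: "val \<nu> a = Some s" "val \<nu> b = Some t" "x = s \<otimes>\<^bsub>G\<^esub> inv\<^bsub>G\<^esub> t"
      by (auto simp: H_def)
    then have "inv\<^bsub>G\<^esub> x = t \<otimes>\<^bsub>G\<^esub> inv\<^bsub>G\<^esub> s"
      using V by (simp add: G.inv_mult_group)
    with * show "inv\<^bsub>G\<^esub> x \<in> H" unfolding H_def by blast
  next
    fix x y assume "x \<in> H" "y \<in> H"
    then obtain s t a b s' t' a' b' where *: "val \<nu> a = Some s" "val \<nu> b = Some t"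
      "x = s \<otimes>\<^bsub>G\<^esub> inv\<^bsub>G\<^esub> t" "val \<nu> a' = Some s'" "val \<nu> b' = Some t'" "y = s' \<otimes>\<^bsub>G\<^esub> inv\<^bsub>G\<^esub> t'"
      by (auto simp: H_def)
    then have "x \<otimes>\<^bsub>G\<^esub> y = (s \<otimes>\<^bsub>G\<^esub> s') \<otimes>\<^bsub>G\<^esub> inv\<^bsub>G\<^esub> (t \<otimes>\<^bsub>G\<^esub> t')"
      using V by (simp add: G.inv_mult G.m_ac)
    with mult[OF *(1,4)] mult[OF *(2,5)] show "x \<otimes>\<^bsub>G\<^esub> y \<in> H"
      unfolding H_def by blast
  qed
  moreover have "inj_on \<phi> H"
  proof (rule inj_onI)
    fix x y assume "x \<in> H" "y \<in> H" and eq: "\<phi> x = \<phi> y"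
    then obtain s t a b where *: "val \<nu> a = Some s" "val \<nu> b = Some t" "x = s \<otimes>\<^bsub>G\<^esub> inv\<^bsub>G\<^esub> t"
      by (auto simp: H_def)
    then have "(a, b) \<in> \<phi> x" by (auto simp: \<phi>_def)
    then have "(a, b) \<in> \<phi> y" by (simp only: eq)
    with * show "x = y" by (auto simp: \<phi>_def)
  qed
  moreover have "g \<in> H" if "val \<nu> a = Some g" for a g
    using that one V[OF that] unfolding H_def by (force intro: exI[of _ g] exI[of _ "\<one>\<^bsub>G\<^esub>"])
  ultimately show ?thesis
    using valuation_transport[OF assms, of H \<phi>] unfolding G_def by blast
qed

end

theory Submission
  imports Defs
begin

text \<open>
  The conditions of a basic open set compare the values of finitely many polynomials. Write
  \<open>\<nu>\<close> as \<open>f \<mapsto> w(f(z))\<close> for a point \<open>z\<close> of a valued field \<open>(L, w)\<close> that contains the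
  algebraic closure \<open>M\<close> of \<open>K\<close>. If \<open>z\<close> lies in \<open>M\<close>, the conditions survive the perturbations
  \<open>x \<mapsto> z + s\<close> with \<open>s\<close> infinitely small, which is value-transcendental, and \<open>x \<mapsto> z + e y\<close> with
  \<open>e \<in> K\<close> small and \<open>y\<close> of transcendental residue, which is residue-transcendental.
  Otherwise \<open>z\<close> is replaced by a point \<open>z'\<close> of \<open>M\<close>. If all values \<open>w(z - r)\<close> with \<open>r \<in> M\<close> belong
  to \<open>w(M)\<close>, one finds \<open>z'\<close> at which the given polynomials keep their values. If
  \<open>w(z - r) \<notin> w(M)\<close> for some \<open>r\<close>, then \<open>\<nu>\<close> is itself value-transcendental; moreover each given
  polynomial is dominated by a single term in \<open>z - r\<close>, so that \<open>z' = r + e\<close> satisfies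
  the same conditions whenever \<open>w(e)\<close> is close to \<open>w(z - r)\<close>. Such an \<open>e\<close> exists unless \<open>v\<close> is trivial,
  and in that case the trivial valuation is residue-transcendental and lies in every nonempty open set.
\<close>

hide_const (open) UnivPoly.coeff UnivPoly.monom UnivPoly.deg

section \<open>Valuation preorders and valuation subrings\<close>

text \<open>Valuations are handled through the preorder \<open>\<nu> f \<le> \<nu> g\<close>. It
  lives on the ring itself, so valuations with unrelated value groups become comparable. On a field
  such a preorder amounts to a valuation subring, and Chevalley's theorem extends it to larger
  fields; this supplies \<open>w\<close> without enlarging a value group by hand. Throughout,
  \<open>a \<trianglelefteq> b\<close> means that \<open>b\<close> has the larger value, so 0 is a
  top element. The conditions are weak inequalities, hence ties must survive too. A perturbation of
  \<open>z\<close> achieves this by making all nonconstant terms of \<open>f\<close> and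
  \<open>g\<close> at \<open>z\<close> larger in value than the nonzero \<open>g(z)\<close>: then
  \<open>g\<close> keeps its value exactly, and the case \<open>f(z) = 0\<close> is covered as well.
  The points found lie in \<open>M\<close>, whereas both kinds of transcendence are relative to
  \<open>K\<close>, and a value of \<open>M\<close> need not be a value of \<open>K\<close>. It is
  torsion modulo the values of \<open>K\<close>, so one passes to a power and divides by a
  constant.\<close>

locale val_preorder =
  fixes le :: "'a::comm_ring_1 \<Rightarrow> 'a \<Rightarrow> bool" (infix "\<trianglelefteq>" 50)
  assumes le_trans: "a \<trianglelefteq> b \<Longrightarrow> b \<trianglelefteq> c \<Longrightarrow> a \<trianglelefteq> c"
    and le_linear: "a \<trianglelefteq> b \<or> b \<trianglelefteq> a"
    and le_mult_right: "a \<trianglelefteq> b \<Longrightarrow> a * c \<trianglelefteq> b * c"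
    and le_mult_cancel: "a * c \<trianglelefteq> b * c \<Longrightarrow> \<not> 0 \<trianglelefteq> c \<Longrightarrow> a \<trianglelefteq> b"
    and le_add: "a \<trianglelefteq> b \<Longrightarrow> a \<trianglelefteq> c \<Longrightarrow> a \<trianglelefteq> b + c"
    and le_zero: "a \<trianglelefteq> 0"
    and not_zero_le_one: "\<not> 0 \<trianglelefteq> 1"
begin

abbreviation lt (infix "\<triangleleft>" 50) where "a \<triangleleft> b \<equiv> \<not> b \<trianglelefteq> a"

abbreviation eqv (infix "\<bumpeq>" 50) where "a \<bumpeq> b \<equiv> a \<trianglelefteq> b \<and> b \<trianglelefteq> a"

lemma le_refl [simp]: "a \<trianglelefteq> a"
  using le_linear[of a a] by blast

lemma le_mult_left: "a \<trianglelefteq> b \<Longrightarrow> c * a \<trianglelefteq> c * b"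
  using le_mult_right[of a b c] by (simp add: mult.commute)

lemma le_mult: "a \<trianglelefteq> b \<Longrightarrow> c \<trianglelefteq> d \<Longrightarrow> a * c \<trianglelefteq> b * d"
  using le_trans[OF le_mult_right le_mult_left] .

lemma lt_imp_le: "a \<triangleleft> b \<Longrightarrow> a \<trianglelefteq> b"
  using le_linear[of a b] by blast

lemma lt_le_trans: "a \<triangleleft> b \<Longrightarrow> b \<trianglelefteq> c \<Longrightarrow> a \<triangleleft> c"
  using le_trans[of b c a] by blast

lemma le_lt_trans: "a \<trianglelefteq> b \<Longrightarrow> b \<triangleleft> c \<Longrightarrow> a \<triangleleft> c"
  using le_trans[of c a b] by blast

lemma lt_imp_nonzero: "a \<triangleleft> b \<Longrightarrow> a \<triangleleft> 0"
  using lt_le_trans[OF _ le_zero] .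

lemma lt_mult_le: "a \<triangleleft> b \<Longrightarrow> c \<trianglelefteq> d \<Longrightarrow> c \<triangleleft> 0 \<Longrightarrow> a * c \<triangleleft> b * d"
  using le_trans[OF le_mult_left[of c d b], of "a * c"] le_mult_cancel[of b c a] by blast

lemma le_mult_lt: "a \<trianglelefteq> b \<Longrightarrow> c \<triangleleft> d \<Longrightarrow> a \<triangleleft> 0 \<Longrightarrow> a * c \<triangleleft> b * d"
  using lt_mult_le[where a = c and b = d and c = a and d = b] by (simp add: mult.commute)

lemma zero_le_mult_iff: "0 \<trianglelefteq> a * b \<longleftrightarrow> 0 \<trianglelefteq> a \<or> 0 \<trianglelefteq> b"
  using le_mult_cancel[of 0 b a] le_mult_right[of 0 a b] le_mult_left[of 0 b a] by auto

lemma zero_le_power: "0 \<trianglelefteq> a ^ n \<Longrightarrow> 0 \<trianglelefteq> a"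
  by (induction n) (auto simp: zero_le_mult_iff not_zero_le_one)

lemma le_uminus: "a \<trianglelefteq> b \<Longrightarrow> a \<trianglelefteq> - b"
proof -
  \<comment> \<open>If \<open>- 1 \<trianglelefteq> 1\<close>, multiplication by \<open>- 1\<close>
    gives \<open>1 \<trianglelefteq> - 1\<close>; so both alternatives of linearity lead
    here.\<close>
  have "1 \<trianglelefteq> - 1"
    using le_linear[of 1 "- 1"] le_mult_right[of "- 1" 1 "- 1"] by auto
  then show "a \<trianglelefteq> b \<Longrightarrow> a \<trianglelefteq> - b"
    using le_trans[of a b "- b"] le_mult_right[of 1 "- 1" b] by simp
qed

lemma le_uminus_iff [simp]: "a \<trianglelefteq> - b \<longleftrightarrow> a \<trianglelefteq> b"
  using le_uminus[of a b] le_uminus[of a "- b"] by auto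

lemma uminus_le_iff [simp]: "- a \<trianglelefteq> b \<longleftrightarrow> a \<trianglelefteq> b"
  using le_trans[of a "- a" b] le_trans[of "- a" a b] le_uminus[OF le_refl, of a]
    le_uminus[OF le_refl, of "- a"] by auto

lemma le_diff: "a \<trianglelefteq> b \<Longrightarrow> a \<trianglelefteq> c \<Longrightarrow> a \<trianglelefteq> b - c"
  using le_add[of a b "- c"] by simp

lemma lt_add:
  assumes "a \<triangleleft> b" "a \<triangleleft> c"
  shows "a \<triangleleft> b + c"
  using le_linear[of b c]
proof
  assume "b \<trianglelefteq> c"
  then show ?thesis using lt_le_trans[OF assms(1) le_add[OF le_refl]] by blast
next
  assume "c \<trianglelefteq> b"
  then show ?thesis using lt_le_trans[OF assms(2) le_add[OF _ le_refl]] by blast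
qed

lemma lt_diff: "a \<triangleleft> b \<Longrightarrow> a \<triangleleft> c \<Longrightarrow> a \<triangleleft> b - c"
  unfolding diff_conv_add_uminus by (rule lt_add) simp_all

text \<open>If \<open>a + b\<close> had a larger value than \<open>a\<close>, then so would
  \<open>(a + b) - b\<close>, which is \<open>a\<close>.\<close>

lemma eqv_add_lt: "a \<triangleleft> b \<Longrightarrow> a + b \<bumpeq> a"
proof -
  assume ab: "a \<triangleleft> b"
  have "a + b \<trianglelefteq> a"
  proof (rule ccontr)
    assume "a \<triangleleft> a + b"
    from lt_diff[OF this ab] show False by simp
  qed
  then show "a + b \<bumpeq> a" using ab by (simp add: lt_imp_le le_add)
qed

lemma le_power: "a \<trianglelefteq> b \<Longrightarrow> a ^ n \<trianglelefteq> b ^ n"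
  by (induction n) (auto intro: le_mult)

lemma lt_power: "a \<triangleleft> b \<Longrightarrow> n > 0 \<Longrightarrow> a ^ n \<triangleleft> b ^ n"
proof (induction n)
  case (Suc n)
  have "a ^ n \<triangleleft> 0"
    using zero_le_power[of a n] lt_imp_nonzero[OF Suc.prems(1)] by blast
  then show ?case
    using lt_mult_le[OF Suc.prems(1) le_power[of a b n]] lt_imp_le[OF Suc.prems(1)] by simp
qed simp

lemma power_le_cancel: "a ^ n \<trianglelefteq> b ^ n \<Longrightarrow> n > 0 \<Longrightarrow> a \<trianglelefteq> b"
  using lt_power[where a = b and b = a] by blast

lemma le_sum: "(\<And>i. i \<in> S \<Longrightarrow> a \<trianglelefteq> f i) \<Longrightarrow> a \<trianglelefteq> sum f S"
  by (induction S rule: infinite_finite_induct) (auto intro: le_add le_zero)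

lemma lt_sum:
  assumes "a \<triangleleft> 0" "\<And>i. i \<in> S \<Longrightarrow> a \<triangleleft> f i"
  shows "a \<triangleleft> sum f S"
  using assms(2) by (induction S rule: infinite_finite_induct) (simp_all add: assms(1) lt_add)

lemma eqv_mult: "a \<bumpeq> b \<Longrightarrow> c \<bumpeq> d \<Longrightarrow> a * c \<bumpeq> b * d"
  by (auto intro: le_mult)

lemma eqv_power: "a \<bumpeq> b \<Longrightarrow> a ^ n \<bumpeq> b ^ n"
  by (auto intro: le_power)

lemma eqv_prod: "(\<And>i. i \<in> S \<Longrightarrow> f i \<bumpeq> g i) \<Longrightarrow> prod f S \<bumpeq> prod g S"
  by (induction S rule: infinite_finite_induct) (auto intro: le_mult)

lemma finite_min_exists:
  assumes "finite S" "S \<noteq> {}"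
  shows "\<exists>i\<in>S. \<forall>j\<in>S. f i \<trianglelefteq> f j"
  using assms
proof (induction rule: finite_ne_induct)
  case (insert x F)
  then obtain i where i: "i \<in> F" "\<forall>j\<in>F. f i \<trianglelefteq> f j" by blast
  show ?case
  proof (cases "f x \<trianglelefteq> f i")
    case True
    then show ?thesis using i(2) le_trans[OF True] by (intro bexI[of _ x]) simp_all
  next
    case False
    then show ?thesis using i lt_imp_le[OF False] by (intro bexI[of _ i]) simp_all
  qed
qed auto

lemma finite_max_exists:
  assumes "finite S" "S \<noteq> {}"
  shows "\<exists>i\<in>S. \<forall>j\<in>S. f j \<trianglelefteq> f i"
  using assms
proof (induction rule: finite_ne_induct)
  case (insert x F)
  then obtain i where i: "i \<in> F" "\<forall>j\<in>F. f j \<trianglelefteq> f i" by blast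
  show ?case
  proof (cases "f i \<trianglelefteq> f x")
    case True
    then show ?thesis using i(2) le_trans[OF _ True] by (intro bexI[of _ x]) simp_all
  next
    case False
    then show ?thesis using i lt_imp_le[OF False] by (intro bexI[of _ i]) simp_all
  qed
qed auto

lemma le_cong: "eqv a a' \<Longrightarrow> eqv b b' \<Longrightarrow> a \<trianglelefteq> b \<Longrightarrow> a' \<trianglelefteq> b'"
  using le_trans[of a' a b] le_trans[of a' b b'] by blast

lemma eqv_trans_left: "eqv a b \<Longrightarrow> eqv a c \<Longrightarrow> eqv b c"
  using le_trans[of b a c] le_trans[of c a b] by blast

lemma power_le_iff: "n > 0 \<Longrightarrow> a ^ n \<trianglelefteq> b ^ n \<longleftrightarrow> a \<trianglelefteq> b"
  using le_power[of a b n] power_le_cancel[of a n b] by blast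

lemma sum_dominated:
  assumes "finite S" "k \<in> S" "f k \<triangleleft> 0" "\<And>i. i \<in> S \<Longrightarrow> i \<noteq> k \<Longrightarrow> f k \<triangleleft> f i"
  shows "sum f S \<bumpeq> f k"
proof -
  have "f k \<triangleleft> sum f (S - {k})"
    using assms by (intro lt_sum) auto
  from eqv_add_lt[OF this] show ?thesis
    using assms(1,2) by (simp add: sum.remove)
qed

end

text \<open>The comparison v(a) \<le> v(b) for the valuation with ring \<open>B\<close>: the
  quotient is integral. Zero is treated apart because \<open>b / 0 = 0\<close> lies in
  \<open>B\<close>, which would put 0 below everything.\<close>

definition vle :: "'a::field set \<Rightarrow> 'a \<Rightarrow> 'a \<Rightarrow> bool" where
  "vle B a b \<longleftrightarrow> b = 0 \<or> a \<noteq> 0 \<and> b / a \<in> B"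

locale valuation_subring =
  fixes B :: "'a::field set"
  assumes one_mem: "1 \<in> B"
    and add_mem: "a \<in> B \<Longrightarrow> b \<in> B \<Longrightarrow> a + b \<in> B"
    and mult_mem: "a \<in> B \<Longrightarrow> b \<in> B \<Longrightarrow> a * b \<in> B"
    and uminus_mem: "a \<in> B \<Longrightarrow> - a \<in> B"
    and total: "a \<in> B \<or> inverse a \<in> B"
begin

sublocale val_preorder "vle B"
proof
  have zero: "0 \<in> B" using add_mem[OF one_mem uminus_mem[OF one_mem]] by simp
  show "vle B a c" if "vle B a b" "vle B b c" for a b c
    using that mult_mem[of "b / a" "c / b"] by (auto simp: vle_def)
  show "vle B a b \<or> vle B b a" for a b
    using total[of "a / b"] by (auto simp: vle_def field_simps)
  show "vle B (a * c) (b * c)" if "vle B a b" for a b c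
    using that by (auto simp: vle_def)
  show "vle B a b" if "vle B (a * c) (b * c)" "\<not> vle B 0 c" for a b c
    using that by (auto simp: vle_def)
  show "vle B a (b + c)" if "vle B a b" "vle B a c" for a b c
    using that add_mem[of "b / a" "c / a"] by (auto simp: vle_def add_divide_distrib)
qed (auto simp: vle_def)

lemma vle_one [simp]: "vle B 1 a \<longleftrightarrow> a \<in> B"
  using add_mem[OF one_mem uminus_mem[OF one_mem]] by (auto simp: vle_def)

lemma vle_zero_iff [simp]: "vle B 0 a \<longleftrightarrow> a = 0"
  by (auto simp: vle_def)

lemma vle_divide_iff: "c \<noteq> 0 \<Longrightarrow> vle B (a / c) b \<longleftrightarrow> vle B a (b * c)"
  using le_mult_right[of "a / c" b c] le_mult_cancel[of "a / c" c b] by auto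

lemma vle_divide_iff2: "c \<noteq> 0 \<Longrightarrow> vle B a (b / c) \<longleftrightarrow> vle B (a * c) b"
  using le_mult_right[of a "b / c" c] le_mult_cancel[of a c "b / c"] by auto

lemma eqv_nonzero: "vle B a b \<and> vle B b a \<Longrightarrow> a \<noteq> 0 \<Longrightarrow> b \<noteq> 0"
  by (auto simp: vle_def)

lemma vle_mult_iff: "c \<noteq> 0 \<Longrightarrow> vle B (a * c) (b * c) \<longleftrightarrow> vle B a b"
  using le_mult_right[of a b c] le_mult_cancel[of a c b] by auto

lemma eqv_divideI:
  assumes "vle B (a * c) b \<and> vle B b (a * c)" "c \<noteq> 0"
  shows "vle B a (b / c) \<and> vle B (b / c) a"
  using assms vle_divide_iff vle_divide_iff2 by simp

end

section \<open>Chevalley's extension theorem\<close>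

definition subring_ideal :: "'a::field set \<Rightarrow> 'a set \<Rightarrow> bool" where
  "subring_ideal A I \<longleftrightarrow> 1 \<in> A \<and> (\<forall>a\<in>A. \<forall>b\<in>A. a + b \<in> A \<and> a * b \<in> A) \<and> (\<forall>a\<in>A. - a \<in> A) \<and>
     I \<subseteq> A \<and> 0 \<in> I \<and> (\<forall>a\<in>I. \<forall>b\<in>I. a + b \<in> I) \<and> (\<forall>a\<in>A. \<forall>b\<in>I. a * b \<in> I)"

lemma subring_idealD:
  assumes "subring_ideal A I"
  shows "1 \<in> A" "0 \<in> I" "0 \<in> A" "\<And>a b. a \<in> A \<Longrightarrow> b \<in> A \<Longrightarrow> a + b \<in> A"
    "\<And>a b. a \<in> A \<Longrightarrow> b \<in> A \<Longrightarrow> a * b \<in> A" "\<And>a. a \<in> A \<Longrightarrow> - a \<in> A" "\<And>a. a \<in> I \<Longrightarrow> a \<in> A"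
    "\<And>a b. a \<in> I \<Longrightarrow> b \<in> I \<Longrightarrow> a + b \<in> I" "\<And>a b. a \<in> A \<Longrightarrow> b \<in> I \<Longrightarrow> a * b \<in> I"
    "\<And>a b. a \<in> I \<Longrightarrow> b \<in> A \<Longrightarrow> a * b \<in> I" "\<And>a. a \<in> I \<Longrightarrow> - a \<in> I"
    "\<And>a n. a \<in> A \<Longrightarrow> a ^ n \<in> A"
proof -
  show neg: "- a \<in> I" if "a \<in> I" for a
  proof -
    have "- 1 \<in> A" "\<forall>a\<in>A. \<forall>b\<in>I. a * b \<in> I"
      using assms by (simp_all add: subring_ideal_def)
    with that have "- 1 * a \<in> I" by blast
    then show ?thesis by simp
  qed
  show "a ^ n \<in> A" if "a \<in> A" for a n
    using that assms by (induction n) (auto simp: subring_ideal_def)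
  show "a * b \<in> I" if "a \<in> I" "b \<in> A" for a b
  proof -
    have "\<forall>a\<in>A. \<forall>b\<in>I. a * b \<in> I" using assms by (simp add: subring_ideal_def)
    with that have "b * a \<in> I" by blast
    then show ?thesis by (simp add: mult.commute)
  qed
qed (use assms in \<open>auto simp: subring_ideal_def\<close>)

lemma subring_ideal_sum:
  assumes "subring_ideal A I"
  shows "(\<And>i. i \<in> S \<Longrightarrow> f i \<in> I) \<Longrightarrow> sum f S \<in> I" "(\<And>i. i \<in> S \<Longrightarrow> f i \<in> A) \<Longrightarrow> sum f S \<in> A"
  by (induction S rule: infinite_finite_induct) (auto intro: subring_idealD[OF assms])

text \<open>For a subring \<open>A\<close> this is A[a]; for an ideal \<open>I\<close> of
  \<open>A\<close> it is the ideal that \<open>I\<close> generates in A[a].\<close>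

definition adjoin :: "'a::field set \<Rightarrow> 'a \<Rightarrow> 'a set" where
  "adjoin A a = {poly p a | p. \<forall>i. poly.coeff p i \<in> A}"

lemma subring_ideal_adjoin:
  assumes "subring_ideal A I"
  shows "subring_ideal (adjoin A a) (adjoin I a)" "A \<subseteq> adjoin A a" "I \<subseteq> adjoin I a" "a \<in> adjoin A a"
proof -
  note D = subring_idealD[OF assms]
  have const: "\<forall>i. poly.coeff [:b:] i \<in> C" if "b \<in> C" "0 \<in> C" for b :: 'a and C
    using that by (auto simp: coeff_pCons split: nat.splits)
  have const': "b \<in> adjoin C a" if "b \<in> C" "0 \<in> C" for b :: 'a and C
    unfolding adjoin_def using const[OF that] by (auto intro!: exI[of _ "[:b:]"])
  show sub: "A \<subseteq> adjoin A a" "I \<subseteq> adjoin I a"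
    using const' D(2,3) by auto
  have "\<forall>i. poly.coeff [:0, 1:] i \<in> A"
    using D(1,3) by (auto simp: coeff_pCons split: nat.splits)
  then show "a \<in> adjoin A a"
    unfolding adjoin_def by (auto intro!: exI[of _ "[:0, 1:]"])
  have add: "x + y \<in> adjoin C a" if "x \<in> adjoin C a" "y \<in> adjoin C a"
    and C: "\<And>u w. u \<in> C \<Longrightarrow> w \<in> C \<Longrightarrow> u + w \<in> C" for x y C
    using that(1,2) C unfolding adjoin_def by (force simp flip: poly_add)
  have mult: "x * y \<in> adjoin C a" if "x \<in> adjoin A a" "y \<in> adjoin C a" and C: "C = A \<or> C = I" for x y C
  proof -
    obtain p q where pq: "\<forall>i. poly.coeff p i \<in> A" "\<forall>i. poly.coeff q i \<in> C" "x = poly p a" "y = poly q a"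
      using \<open>x \<in> _\<close> \<open>y \<in> _\<close> by (auto simp: adjoin_def)
    have "poly.coeff (p * q) i \<in> C" for i
      using C
    proof
      assume "C = A"
      with pq show ?thesis unfolding coeff_mult by (auto intro!: subring_ideal_sum(2)[OF assms] D(5))
    next
      assume "C = I"
      with pq show ?thesis unfolding coeff_mult by (auto intro!: subring_ideal_sum(1)[OF assms] D(9))
    qed
    with pq show ?thesis unfolding adjoin_def by (auto intro!: exI[of _ "p * q"])
  qed
  have neg: "- x \<in> adjoin A a" if "x \<in> adjoin A a" for x
    using mult[of "- 1" x A] const'[of "- 1" A] D that by auto
  have "adjoin I a \<subseteq> adjoin A a"
    using D(7) unfolding adjoin_def by blast
  moreover have "1 \<in> adjoin A a" "0 \<in> adjoin I a"
    using sub D(1,2) by blast+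
  ultimately show "subring_ideal (adjoin A a) (adjoin I a)"
    unfolding subring_ideal_def by (auto intro: add mult neg D(4,8))
qed

text \<open>The relation in \<open>a\<inverse>\<close>, multiplied by \<open>a\<^sup>n\<close>, expresses \<open>a\<^sup>n\<close> by lower powers, since \<open>1 - d\<^sub>0\<close> is a unit.\<close>

lemma adjoin_reduce_degree:
  assumes AI: "subring_ideal A I" and inv: "\<And>d. d \<in> I \<Longrightarrow> inverse (1 - d) \<in> A" and one: "1 \<notin> I"
    and c: "\<And>i. c i \<in> I" "(\<Sum>i\<le>n. c i * a ^ i) = 1"
    and d: "\<And>i. d i \<in> I" "(\<Sum>i\<le>n. d i * inverse a ^ i) = 1" and a: "a \<noteq> 0"
  shows "n > 0 \<and> (\<exists>c'. (\<forall>i. c' i \<in> I) \<and> (\<Sum>i\<le>n - 1. c' i * a ^ i) = 1)"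
proof -
  note D = subring_idealD[OF AI]
  have n: "n > 0" using c(1)[of 0] c(2) one by (cases n) auto
  then obtain m where m: "n = Suc m" by (cases n) auto
  define u where "u = inverse (1 - d 0)"
  have d0: "1 - d 0 \<noteq> 0" using d(1)[of 0] one by auto
  have u: "u \<in> A" "(1 - d 0) * u = 1" using inv d(1) d0 by (auto simp: u_def)
  have "(\<Sum>i\<le>n. d i * inverse a ^ i) * a ^ n = (\<Sum>i\<le>n. d i * a ^ (n - i))"
    unfolding sum_distrib_right using a
    by (intro sum.cong) (auto simp: power_diff field_simps)
  also have "\<dots> = (\<Sum>i\<le>n. d (n - i) * a ^ i)"
    by (rule sum.reindex_bij_witness[of _ "\<lambda>i. n - i" "\<lambda>i. n - i"]) auto
  also have "\<dots> = (\<Sum>i\<le>m. d (n - i) * a ^ i) + d 0 * a ^ n"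
    by (simp add: m)
  finally have "a ^ n = (\<Sum>i\<le>m. d (n - i) * a ^ i) + d 0 * a ^ n" using d(2) by simp
  then have eq1: "(1 - d 0) * a ^ n = (\<Sum>i\<le>m. d (n - i) * a ^ i)" by (simp add: algebra_simps)
  then have an: "a ^ n = (\<Sum>i\<le>m. u * d (n - i) * a ^ i)"
  proof -
    have "a ^ n = u * ((1 - d 0) * a ^ n)" using u(2) by (metis mult.assoc mult.commute mult_1)
    also have "\<dots> = (\<Sum>i\<le>m. u * d (n - i) * a ^ i)"
      unfolding eq1 sum_distrib_left by (simp add: mult.assoc)
    finally show ?thesis .
  qed
  have "1 = (\<Sum>i\<le>m. c i * a ^ i) + c n * a ^ n" using c(2) by (simp add: m)
  also have "\<dots> = (\<Sum>i\<le>m. (c i + c n * (u * d (n - i))) * a ^ i)"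
    unfolding an by (simp add: sum.distrib sum_distrib_left algebra_simps)
  finally have "(\<Sum>i\<le>n - 1. (c i + c n * (u * d (n - i))) * a ^ i) = 1" by (simp add: m)
  moreover have "c i + c n * (u * d (n - i)) \<in> I" for i
    by (rule D(8)[OF c(1) D(9)[OF D(7)[OF c(1)] D(9)[OF u(1) d(1)]]])
  ultimately show ?thesis
    using n by (intro conjI exI[of _ "\<lambda>i. c i + c n * (u * d (n - i))"] allI)
qed

text \<open>Pairs (ring, ideal) are encoded as disjoint sums, so that Zorn's lemma for inclusion applies.\<close>

theorem exists_dominating_valuation_subring:
  assumes AI: "subring_ideal A I" and one: "1 \<notin> I"
  shows "\<exists>B. valuation_subring B \<and> A \<subseteq> B \<and> (\<forall>a\<in>I. \<not> vle B a 1)"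
proof -
  define fam where "fam = {Sum_Type.Plus A' I' | A' I'. subring_ideal A' I' \<and> 1 \<notin> I' \<and> A \<subseteq> A' \<and> I \<subseteq> I'}"
  have "\<exists>M\<in>fam. \<forall>S\<in>fam. M \<subseteq> S \<longrightarrow> S = M"
  proof (rule subset_Zorn_nonempty)
    have "Sum_Type.Plus A I \<in> fam"
      unfolding fam_def mem_Collect_eq using assms by (intro exI[of _ A] exI[of _ I]) simp
    then show "fam \<noteq> {}" by blast
  next
    fix C assume C: "C \<noteq> {}" "subset.chain fam C"
    define A' I' where "A' = Inl -` \<Union>C" and "I' = Inr -` \<Union>C"
    have mem: "S \<in> fam" if "S \<in> C" for S using C(2) that unfolding subset_chain_def by blast
    have fam: "subring_ideal (Inl -` S) (Inr -` S)" "1 \<notin> Inr -` S" "A \<subseteq> Inl -` S" "I \<subseteq> Inr -` S"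
      if "S \<in> C" for S
    proof -
      from mem[OF that] obtain A1 I1 where S: "S = Sum_Type.Plus A1 I1" "subring_ideal A1 I1" "1 \<notin> I1" "A \<subseteq> A1" "I \<subseteq> I1"
        by (auto simp: fam_def)
      then have "Inl -` S = A1" "Inr -` S = I1" by auto
      with S show "subring_ideal (Inl -` S) (Inr -` S)" "1 \<notin> Inr -` S" "A \<subseteq> Inl -` S" "I \<subseteq> Inr -` S"
        by simp_all
    qed
    have pair: "\<exists>Z\<in>C. S \<subseteq> Z \<and> T \<subseteq> Z" if "S \<in> C" "T \<in> C" for S T
    proof -
      have "S \<subseteq> T \<or> T \<subseteq> S" using C(2) that unfolding subset_chain_def by blast
      then show ?thesis using that by blast
    qed
    have "subring_ideal A' I'"
      unfolding subring_ideal_def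
    proof (intro conjI ballI)
      obtain S where S: "S \<in> C" using C(1) by blast
      show "1 \<in> A'" "0 \<in> I'"
        using S subring_idealD(1,2)[OF fam(1)[OF S]] by (auto simp: A'_def I'_def)
      show "I' \<subseteq> A'"
      proof
        fix a assume "a \<in> I'"
        then obtain T where T: "T \<in> C" "a \<in> Inr -` T" by (auto simp: I'_def)
        then show "a \<in> A'" using subring_idealD(7)[OF fam(1)[OF T(1)]] by (auto simp: A'_def)
      qed
      show "- a \<in> A'" if "a \<in> A'" for a
      proof -
        from that obtain T where T: "T \<in> C" "a \<in> Inl -` T" by (auto simp: A'_def)
        then show "- a \<in> A'" using subring_idealD(6)[OF fam(1)[OF T(1)]] by (auto simp: A'_def)
      qed
      show "a + b \<in> A'" "a * b \<in> A'" if "a \<in> A'" "b \<in> A'" for a b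
      proof -
        obtain S T where "S \<in> C" "T \<in> C" "Inl a \<in> S" "Inl b \<in> T" using \<open>a \<in> A'\<close> \<open>b \<in> A'\<close> by (auto simp: A'_def)
        then obtain Z where Z: "Z \<in> C" "a \<in> Inl -` Z" "b \<in> Inl -` Z" using pair by blast
        show "a + b \<in> A'" "a * b \<in> A'"
          using subring_idealD(4,5)[OF fam(1)[OF Z(1)] Z(2,3)] Z(1) unfolding A'_def by blast+
      qed
      show "a + b \<in> I'" if "a \<in> I'" "b \<in> I'" for a b
      proof -
        obtain S T where "S \<in> C" "T \<in> C" "Inr a \<in> S" "Inr b \<in> T" using \<open>a \<in> I'\<close> \<open>b \<in> I'\<close> by (auto simp: I'_def)
        then obtain Z where Z: "Z \<in> C" "a \<in> Inr -` Z" "b \<in> Inr -` Z" using pair by blast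
        show "a + b \<in> I'"
          using subring_idealD(8)[OF fam(1)[OF Z(1)] Z(2,3)] Z(1) unfolding I'_def by blast+
      qed
      show "a * b \<in> I'" if "a \<in> A'" "b \<in> I'" for a b
      proof -
        obtain S T where "S \<in> C" "T \<in> C" "Inl a \<in> S" "Inr b \<in> T" using \<open>a \<in> A'\<close> \<open>b \<in> I'\<close> by (auto simp: A'_def I'_def)
        then obtain Z where Z: "Z \<in> C" "a \<in> Inl -` Z" "b \<in> Inr -` Z" using pair by blast
        show "a * b \<in> I'"
          using subring_idealD(9)[OF fam(1)[OF Z(1)] Z(2,3)] Z(1) unfolding I'_def by blast+
      qed
    qed
    moreover have "1 \<notin> I'" "A \<subseteq> A'" "I \<subseteq> I'"
    proof -
      show "1 \<notin> I'" using fam(2) by (auto simp: I'_def)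
      obtain S where S: "S \<in> C" using C(1) by blast
      show "A \<subseteq> A'" "I \<subseteq> I'" using fam(3,4)[OF S] S by (auto simp: A'_def I'_def)
    qed
    moreover have "\<Union>C = Sum_Type.Plus A' I'"
    proof -
      have "x \<in> Sum_Type.Plus A' I'" if "x \<in> \<Union>C" for x using that by (cases x) (auto simp: A'_def I'_def)
      then show ?thesis by (auto simp: A'_def I'_def)
    qed
    ultimately show "\<Union>C \<in> fam"
      unfolding fam_def mem_Collect_eq by (intro exI[of _ A'] exI[of _ I']) simp
  qed
  then obtain A' I' where M: "subring_ideal A' I'" "1 \<notin> I'" "A \<subseteq> A'" "I \<subseteq> I'"
    and max: "\<And>S. S \<in> fam \<Longrightarrow> Sum_Type.Plus A' I' \<subseteq> S \<Longrightarrow> S = Sum_Type.Plus A' I'"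
    by (auto simp: fam_def)
  note D = subring_idealD[OF M(1)]
  \<comment> \<open>Maximality: unless 1 lies in the extended ideal, the pair
    \<open>adjoin A' a\<close>, \<open>adjoin I' a\<close> belongs to \<open>fam\<close> and cannot
    be strictly larger.\<close>
  have ext: "a \<in> A'" if "1 \<notin> adjoin I' a" for a
  proof -
    have "Sum_Type.Plus (adjoin A' a) (adjoin I' a) \<in> fam"
      unfolding fam_def mem_Collect_eq using subring_ideal_adjoin[OF M(1), of a] M(3,4) that
      by (intro exI[of _ "adjoin A' a"] exI[of _ "adjoin I' a"] conjI refl) auto
    then have "Sum_Type.Plus (adjoin A' a) (adjoin I' a) = Sum_Type.Plus A' I'"
      using subring_ideal_adjoin[OF M(1), of a] by (intro max) auto
    moreover have "Inl a \<in> Sum_Type.Plus (adjoin A' a) (adjoin I' a)"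
      using subring_ideal_adjoin(4)[OF M(1), of a] by (rule InlI)
    ultimately have "Inl a \<in> Sum_Type.Plus A' I'" by simp
    then show ?thesis by blast
  qed
  have rel: "\<exists>n c. (\<forall>i. c i \<in> I') \<and> (\<Sum>i\<le>n. c i * a ^ i) = 1" if "a \<notin> A'" for a
  proof -
    have "1 \<in> adjoin I' a" using ext that by blast
    then obtain p where "1 = poly p a" "\<forall>i. poly.coeff p i \<in> I'"
      unfolding adjoin_def by blast
    then show ?thesis
      by (intro exI[of _ "Polynomial.degree p"] exI[of _ "poly.coeff p"]) (simp add: poly_altdef)
  qed
  \<comment> \<open>Otherwise the relation for \<open>inverse s\<close>, multiplied by
    \<open>s ^ n\<close>, puts \<open>s ^ n\<close> into \<open>I'\<close>. But
    \<open>s = 1 - d\<close> is congruent to 1 modulo \<open>I'\<close>, hence so is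
    \<open>s ^ n\<close>, and 1 would lie in \<open>I'\<close>.\<close>
  have inv: "inverse (1 - d) \<in> A'" if d: "d \<in> I'" for d
  proof (rule ccontr)
    define s where "s = 1 - d"
    have s: "s \<noteq> 0" using d M(2) by (auto simp: s_def)
    have sA: "s \<in> A'" unfolding s_def diff_conv_add_uminus by (rule D(4)[OF D(1) D(6)[OF D(7)[OF d]]])
    assume "inverse (1 - d) \<notin> A'"
    then obtain n c where c: "\<forall>i. c i \<in> I'" "(\<Sum>i\<le>n. c i * inverse s ^ i) = 1"
      using rel unfolding s_def by blast
    have "s ^ n = (\<Sum>i\<le>n. c i * inverse s ^ i) * s ^ n" using c by simp
    also have "\<dots> = (\<Sum>i\<le>n. c i * s ^ (n - i))"
      unfolding sum_distrib_right using s by (intro sum.cong) (auto simp: power_diff field_simps)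
    also have "\<dots> \<in> I'"
      using c(1) sA by (intro subring_ideal_sum[OF M(1)] D(10) D(12)) auto
    finally have "s ^ n \<in> I'" .
    moreover have "1 - s ^ k \<in> I'" for k
    proof (induction k)
      case (Suc k)
      have "1 - s ^ Suc k = d + s * (1 - s ^ k)" by (simp add: s_def algebra_simps)
      then show ?case using D(8)[OF d D(9)[OF sA Suc]] by simp
    qed (use D in simp)
    ultimately have "(1 - s ^ n) + s ^ n \<in> I'" using D(8) by blast
    then show False using M(2) by simp
  qed
  have tot: "a \<in> A' \<or> inverse a \<in> A'" for a
  proof (rule ccontr)
    define R where "R a n \<longleftrightarrow> (\<exists>c. (\<forall>i. c i \<in> I') \<and> (\<Sum>i\<le>n. c i * a ^ i) = 1)" for a and n :: nat
    assume "\<not> (a \<in> A' \<or> inverse a \<in> A')"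
    then have n: "a \<noteq> 0" "\<exists>n. R a n" "\<exists>n. R (inverse a) n"
      using rel D(3) by (auto simp: R_def)
    have mono: "R b m" if "R b n" "n \<le> m" for b n m
    proof -
      obtain c where c: "\<forall>i. c i \<in> I'" "(\<Sum>i\<le>n. c i * b ^ i) = 1" using \<open>R b n\<close> by (auto simp: R_def)
      have "(\<Sum>i\<le>m. (if i \<le> n then c i else 0) * b ^ i) = (\<Sum>i\<le>n. c i * b ^ i)"
        using that by (intro sum.mono_neutral_cong_right) auto
      then show ?thesis unfolding R_def using c D(2) by (intro exI[of _ "\<lambda>i. if i \<le> n then c i else 0"]) auto
    qed
    have red: "m > 0 \<and> R b (m - 1)" if "R b m" "R (inverse b) m" "b \<noteq> 0" for b m
      using adjoin_reduce_degree[OF M(1) inv M(2)] that unfolding R_def by blast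
    \<comment> \<open>Least lengths of a relation for \<open>a\<close> and for its inverse.
      \<open>mono\<close> pads the shorter relation to the length of the longer one, and
      \<open>red\<close> then shortens the longer one, against minimality.\<close>
    define n1 n2 where "n1 = (LEAST n. R a n)" and "n2 = (LEAST n. R (inverse a) n)"
    have L: "R a n1" "R (inverse a) n2" "\<And>k. R a k \<Longrightarrow> n1 \<le> k" "\<And>k. R (inverse a) k \<Longrightarrow> n2 \<le> k"
      using n unfolding n1_def n2_def by (auto intro: LeastI_ex Least_le)
    show False
    proof (cases "n2 \<le> n1")
      case True
      then have "n1 > 0 \<and> R a (n1 - 1)" using red[of a n1] mono L n(1) by blast
      then show False using L(3)[of "n1 - 1"] by linarith
    next
      case False
      then have "R a n2" using mono L(1) by simp
      then have "n2 > 0 \<and> R (inverse a) (n2 - 1)" using red[of "inverse a" n2] L n(1) by simp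
      then show False using L(4)[of "n2 - 1"] by linarith
    qed
  qed
  have "\<not> vle A' a 1" if "a \<in> I" for a
  proof
    assume "vle A' a 1"
    then have "a \<noteq> 0" "1 / a \<in> A'" by (auto simp: vle_def)
    then have "1 / a * a \<in> I'" using D(9) M(4) that by blast
    then show False using M(2) \<open>a \<noteq> 0\<close> by simp
  qed
  moreover have "valuation_subring A'"
    using D(1,4,5,6) tot by (simp add: valuation_subring_def)
  ultimately show ?thesis using M(3) by blast
qed

section \<open>Realizing valuation preorders\<close>

locale unital_ring_hom =
  fixes \<phi> :: "'a::comm_ring_1 \<Rightarrow> 'b::comm_ring_1"
  assumes hom_add: "\<phi> (a + b) = \<phi> a + \<phi> b"
    and hom_mult: "\<phi> (a * b) = \<phi> a * \<phi> b"
    and hom_one: "\<phi> 1 = 1"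
begin

lemma hom_zero: "\<phi> 0 = 0"
  using hom_add[of 0 0] by simp

lemma hom_uminus: "\<phi> (- a) = - \<phi> a"
  using hom_add[of a "- a"] hom_zero by (simp add: eq_neg_iff_add_eq_0 add.commute)

lemma hom_diff: "\<phi> (a - b) = \<phi> a - \<phi> b"
  using hom_add[of a "- b"] hom_uminus by simp

lemma hom_power: "\<phi> (a ^ n) = \<phi> a ^ n"
  by (induction n) (auto simp: hom_one hom_mult)

lemma hom_sum: "\<phi> (sum f S) = (\<Sum>i\<in>S. \<phi> (f i))"
  by (induction S rule: infinite_finite_induct) (auto simp: hom_zero hom_add)

end

text \<open>The preorder \<open>\<nu> f \<le> \<nu> g\<close> of a valuation determines its class.\<close>

definition nle :: "('r, 'g) pre_valuation \<Rightarrow> 'r \<Rightarrow> 'r \<Rightarrow> bool" where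
  "nle \<nu> f g \<longleftrightarrow> val_le (grp \<nu>) (val \<nu> f) (val \<nu> g)"

section \<open>The preorder of a valuation\<close>

context ordered_abelian_group
begin

lemma rel_trans: "(a, b) \<in> order_rel G \<Longrightarrow> (b, c) \<in> order_rel G \<Longrightarrow> (a, c) \<in> order_rel G"
  using linear_order unfolding order_on_defs trans_def by blast

lemma rel_total: "a \<in> carrier G \<Longrightarrow> b \<in> carrier G \<Longrightarrow> (a, b) \<in> order_rel G \<or> (b, a) \<in> order_rel G"
  using linear_order unfolding order_on_defs refl_on_def total_on_def by metis

lemma rel_antisym: "(a, b) \<in> order_rel G \<Longrightarrow> (b, a) \<in> order_rel G \<Longrightarrow> a = b"
  using linear_order unfolding order_on_defs antisym_def by blast

lemma mult_mono': "\<lbrakk>a \<in> carrier G; b \<in> carrier G; c \<in> carrier G; (a, b) \<in> order_rel G\<rbrakk>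
    \<Longrightarrow> (a \<otimes> c, b \<otimes> c) \<in> order_rel G"
  using mult_mono[of a b c] m_comm[of c a] m_comm[of c b] by simp

lemma rel_mult_cancel:
  assumes "a \<in> carrier G" "b \<in> carrier G" "c \<in> carrier G" "(a \<otimes> c, b \<otimes> c) \<in> order_rel G"
  shows "(a, b) \<in> order_rel G"
proof -
  have "(inv c \<otimes> (a \<otimes> c), inv c \<otimes> (b \<otimes> c)) \<in> order_rel G"
    using assms by (intro mult_mono) auto
  moreover have "inv c \<otimes> (x \<otimes> c) = x" if "x \<in> carrier G" for x
    using that assms(3) by (simp add: m_lcomm[of "inv c" x c])
  ultimately show ?thesis using assms by simp
qed

end

lemma val_preorder_nle:
  assumes "valuation \<nu>"
  shows "val_preorder (nle \<nu>)"
proof -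
  define G where "G = grp \<nu>"
  interpret ordered_abelian_group G
    using assms by (simp add: valuation_def G_def)
  have V: "s \<in> carrier G" if "val \<nu> x = Some s" for x s
    using assms that unfolding valuation_def G_def
    by (metis image_iff insert_iff option.distinct(1) option.inject)
  have M: "val \<nu> (x * y) = val_plus G (val \<nu> x) (val \<nu> y)" for x y
    using assms by (simp add: valuation_def G_def)
  have P: "val_le G (val_min G (val \<nu> x) (val \<nu> y)) (val \<nu> (x + y))" for x y
    using assms by (simp add: valuation_def G_def)
  have Z: "val \<nu> 0 = None" "val \<nu> 1 = Some \<one>\<^bsub>G\<^esub>"
    using assms by (simp_all add: valuation_def G_def)
  have tr: "val_le G x z" if "val_le G x y" "val_le G y z" for x y z
    using that rel_trans by (auto simp: val_le_def split: option.splits)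
  show ?thesis
    unfolding nle_def G_def[symmetric]
  proof
    fix a b c
    show "val_le G (val \<nu> a) (val \<nu> c)"
      if "val_le G (val \<nu> a) (val \<nu> b)" "val_le G (val \<nu> b) (val \<nu> c)"
      using that by (rule tr)
    show "val_le G (val \<nu> a) (val \<nu> b) \<or> val_le G (val \<nu> b) (val \<nu> a)"
      using rel_total V[of a] V[of b] by (auto simp: val_le_def split: option.splits)
    show "val_le G (val \<nu> (a * c)) (val \<nu> (b * c))" if "val_le G (val \<nu> a) (val \<nu> b)"
      using that V[of a] V[of b] V[of c] mult_mono'[of "the (val \<nu> a)" "the (val \<nu> b)" "the (val \<nu> c)"]
      by (cases "val \<nu> a"; cases "val \<nu> b"; cases "val \<nu> c") (simp_all add: val_le_def M val_plus_def)
    show "val_le G (val \<nu> a) (val \<nu> b)"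
      if "val_le G (val \<nu> (a * c)) (val \<nu> (b * c))" "\<not> val_le G (val \<nu> 0) (val \<nu> c)"
      using that V[of a] V[of b] V[of c] rel_mult_cancel[of "the (val \<nu> a)" "the (val \<nu> b)" "the (val \<nu> c)"]
      by (cases "val \<nu> a"; cases "val \<nu> b"; cases "val \<nu> c") (simp_all add: val_le_def M val_plus_def Z)
    show "val_le G (val \<nu> a) (val \<nu> (b + c))"
      if "val_le G (val \<nu> a) (val \<nu> b)" "val_le G (val \<nu> a) (val \<nu> c)"
    proof (rule tr[OF _ P])
      show "val_le G (val \<nu> a) (val_min G (val \<nu> b) (val \<nu> c))"
        using that by (simp add: val_min_def)
    qed
  qed (auto simp: Z val_le_def split: option.splits)
qed

lemma val_eq_None_iff: "val \<nu> f = None \<longleftrightarrow> nle \<nu> 0 f" if "valuation \<nu>"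
  using that by (auto simp: nle_def val_le_def valuation_def split: option.splits)

lemma val_less_iff:
  assumes "valuation \<nu>"
  shows "val_less (grp \<nu>) (val \<nu> a) (val \<nu> b) \<longleftrightarrow> \<not> nle \<nu> b a"
proof -
  define G where "G = grp \<nu>"
  interpret ordered_abelian_group G
    using assms by (simp add: valuation_def G_def)
  interpret val_preorder "nle \<nu>" by (rule val_preorder_nle[OF assms])
  have "val \<nu> a = val \<nu> b" if "nle \<nu> a b" "nle \<nu> b a"
    using that rel_antisym
    by (auto simp: nle_def val_le_def simp flip: G_def split: option.splits)
  then show ?thesis
    using le_linear[of a b] le_refl by (auto simp: val_less_def nle_def)
qed

lemma val_equiv_iff_nle:
  assumes "valuation \<nu>" "valuation \<nu>'"
  shows "val_equiv \<nu> \<nu>' \<longleftrightarrow> nle \<nu> = nle \<nu>'"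
  unfolding val_equiv_def val_less_iff[OF assms(1)] val_less_iff[OF assms(2)]
  by (auto simp: fun_eq_iff)

lemma valuation_of_subring:
  fixes \<phi> :: "'r::comm_ring_1 \<Rightarrow> 'a::field"
  assumes "valuation_subring B" and "unital_ring_hom \<phi>"
  shows "\<exists>\<nu> :: ('r, 'a set) pre_valuation. valuation \<nu> \<and> (\<forall>f g. nle \<nu> f g \<longleftrightarrow> vle B (\<phi> f) (\<phi> g))"
proof -
  interpret valuation_subring B by fact
  interpret unital_ring_hom \<phi> by fact
  \<comment> \<open>For nonzero \<open>a\<close> this is the coset of \<open>a\<close> modulo the
    units of \<open>B\<close>; the group below is the multiplicative group of the field modulo these
    units.\<close>
  define cl where "cl a = {b. vle B a b \<and> vle B b a}" for a
  have cl: "cl a = cl b \<longleftrightarrow> vle B a b \<and> vle B b a" for a b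
  proof
    assume "cl a = cl b"
    moreover have "a \<in> cl a" by (simp add: cl_def)
    ultimately show "vle B a b \<and> vle B b a" by (simp add: cl_def)
  next
    assume ab: "vle B a b \<and> vle B b a"
    then have "vle B a c \<longleftrightarrow> vle B b c" "vle B c a \<longleftrightarrow> vle B c b" for c
      using le_trans[of a b c] le_trans[of b a c] le_trans[of c a b] le_trans[of c b a] by auto
    then show "cl a = cl b" by (simp add: cl_def)
  qed
  \<comment> \<open>Cosets are multiplied through chosen representatives; \<open>mult\<close> shows
    that the choice does not matter.\<close>
  define rep where "rep A = (SOME a. a \<noteq> 0 \<and> cl a = A)" for A
  have rep: "rep (cl a) \<noteq> 0 \<and> cl (rep (cl a)) = cl a" if "a \<noteq> 0" for a
    unfolding rep_def using that by (intro someI[of "\<lambda>x. x \<noteq> 0 \<and> cl x = cl a" a]) simp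
  define G :: "'a set ordered_group" where "G = \<lparr>carrier = cl ` {a. a \<noteq> 0},
    monoid.mult = (\<lambda>P Q. cl (rep P * rep Q)), one = cl 1,
    order_rel = {(cl a, cl b) | a b. a \<noteq> 0 \<and> b \<noteq> 0 \<and> vle B a b}\<rparr>"
  have sel: "carrier G = cl ` {a. a \<noteq> 0}" "\<one>\<^bsub>G\<^esub> = cl 1"
    "order_rel G = {(cl a, cl b) | a b. a \<noteq> 0 \<and> b \<noteq> 0 \<and> vle B a b}"
    by (simp_all add: G_def)
  have mult: "cl a \<otimes>\<^bsub>G\<^esub> cl b = cl (a * b)" if "a \<noteq> 0" "b \<noteq> 0" for a b
  proof -
    have "cl (rep (cl a) * rep (cl b)) = cl (a * b)"
      using rep[OF that(1)] rep[OF that(2)] unfolding cl by (auto intro: le_mult)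
    then show ?thesis by (simp add: G_def)
  qed
  have ord: "(cl a, cl b) \<in> order_rel G \<longleftrightarrow> vle B a b" if ab: "a \<noteq> 0" "b \<noteq> 0" for a b
  proof
    assume "(cl a, cl b) \<in> order_rel G"
    then obtain a' b' where "cl a = cl a'" "cl b = cl b'" "vle B a' b'" by (auto simp: sel)
    then show "vle B a b" unfolding cl using le_trans[of a a' b'] le_trans[of a b' b] by blast
  qed (use ab in \<open>auto simp: sel\<close>)
  have "comm_group G"
  proof (rule comm_groupI)
    fix x assume "x \<in> carrier G"
    then obtain a where "a \<noteq> 0" "x = cl a" by (auto simp: sel)
    then show "\<exists>y\<in>carrier G. y \<otimes>\<^bsub>G\<^esub> x = \<one>\<^bsub>G\<^esub>"
      by (intro bexI[of _ "cl (inverse a)"]) (auto simp: sel mult)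
  qed (auto simp: sel mult mult_ac)
  moreover have "linear_order_on (carrier G) (order_rel G)"
    unfolding order_on_defs
  proof (intro conjI)
    show "order_rel G \<subseteq> carrier G \<times> carrier G"
      by (auto simp: sel)
    show "refl_on (carrier G) (order_rel G)"
      by (auto simp: sel(1) refl_on_def ord)
    show "total_on (carrier G) (order_rel G)"
      using le_linear by (fastforce simp: total_on_def sel)
    show "trans (order_rel G)"
    proof (rule transI)
      fix x y z assume xy: "(x, y) \<in> order_rel G" "(y, z) \<in> order_rel G"
      then obtain a b c where "x = cl a" "y = cl b" "z = cl c" "a \<noteq> 0" "b \<noteq> 0" "c \<noteq> 0"
        by (auto simp: sel)
      with xy show "(x, z) \<in> order_rel G" using ord le_trans[of a b c] by simp
    qed
    show "antisym (order_rel G)"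
    proof (rule antisymI)
      fix x y assume xy: "(x, y) \<in> order_rel G" "(y, x) \<in> order_rel G"
      then obtain a b where "x = cl a" "y = cl b" "a \<noteq> 0" "b \<noteq> 0" by (auto simp: sel)
      with xy show "x = y" using ord cl by simp
    qed
  qed
  moreover have "(z \<otimes>\<^bsub>G\<^esub> x, z \<otimes>\<^bsub>G\<^esub> y) \<in> order_rel G"
    if "x \<in> carrier G" "y \<in> carrier G" "z \<in> carrier G" and xy: "(x, y) \<in> order_rel G" for x y z
  proof -
    from that(1-3) obtain a b c where "x = cl a" "y = cl b" "z = cl c" "a \<noteq> 0" "b \<noteq> 0" "c \<noteq> 0"
      by (auto simp: sel)
    with xy show ?thesis using ord by (simp add: mult le_mult_left)
  qed
  ultimately have G: "ordered_abelian_group G"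
    by (simp add: ordered_abelian_group_def ordered_abelian_group_axioms_def)
  define \<nu> :: "('r, 'a set) pre_valuation" where
    "\<nu> = \<lparr>grp = G, val = (\<lambda>f. if \<phi> f = 0 then None else Some (cl (\<phi> f)))\<rparr>"
  have nle: "nle \<nu> f g \<longleftrightarrow> vle B (\<phi> f) (\<phi> g)" for f g
    by (auto simp: nle_def \<nu>_def val_le_def ord le_zero)
  have "valuation \<nu>"
    unfolding valuation_def
  proof (intro conjI allI)
    show "val_le (grp \<nu>) (val_min (grp \<nu>) (val \<nu> f) (val \<nu> g)) (val \<nu> (f + g))" for f g
      using nle[of f g] nle[of f "f + g"] nle[of g "f + g"] le_add[of "\<phi> f" "\<phi> f" "\<phi> g"]
        le_add[of "\<phi> g" "\<phi> f" "\<phi> g"] le_linear[of "\<phi> f" "\<phi> g"]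
      by (auto simp: val_min_def nle_def hom_add)
  qed (use G in \<open>auto simp: \<nu>_def sel val_plus_def mult hom_mult hom_one hom_zero\<close>)
  with nle show ?thesis by blast
qed

text \<open>The value group built from \<open>B\<close> consists of subsets of the field.
  \<open>valuation_in_universe\<close> moves it into the type over which \<open>VV\<close> is
  formed, and equivalent valuations have the same preorder.\<close>

lemma valuation_realize:
  fixes \<phi> :: "'r::comm_ring_1 \<Rightarrow> 'a::field"
  assumes "valuation_subring B" and "unital_ring_hom \<phi>"
  shows "\<exists>\<nu> :: ('r, 'r value_universe) pre_valuation.
    valuation \<nu> \<and> (\<forall>f g. nle \<nu> f g \<longleftrightarrow> vle B (\<phi> f) (\<phi> g))"
proof -
  obtain \<nu>0 :: "('r, 'a set) pre_valuation" where \<nu>0: "valuation \<nu>0" "\<forall>f g. nle \<nu>0 f g \<longleftrightarrow> vle B (\<phi> f) (\<phi> g)"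
    using valuation_of_subring[OF assms] by blast
  obtain \<nu> :: "('r, 'r value_universe) pre_valuation" where "valuation \<nu>" "val_equiv \<nu>0 \<nu>"
    using valuation_in_universe[OF \<nu>0(1)] by blast
  with \<nu>0 show ?thesis using val_equiv_iff_nle by metis
qed

text \<open>By Chevalley's theorem, applied to the subring \<open>{\<phi> f / \<phi> g | \<nu> f \<ge> \<nu> g \<noteq> \<infinity>}\<close>.\<close>

lemma val_preorder_extend:
  fixes \<phi> :: "'r::comm_ring_1 \<Rightarrow> 'a::field" and r :: "'r \<Rightarrow> 'r \<Rightarrow> bool"
  assumes "val_preorder r" and "unital_ring_hom \<phi>" and ker: "\<And>f. \<phi> f = 0 \<longleftrightarrow> r 0 f"
  shows "\<exists>B. valuation_subring B \<and> (\<forall>f g. r f g \<longleftrightarrow> vle B (\<phi> f) (\<phi> g))"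
proof -
  interpret R: val_preorder r by fact
  interpret unital_ring_hom \<phi> by fact
  define A where "A = {\<phi> f / \<phi> g | f g. r g f \<and> \<not> r 0 g}"
  define I where "I = {\<phi> f / \<phi> g | f g. \<not> r f g}"
  have A: "\<phi> f / \<phi> g \<in> A" if "r g f" "\<not> r 0 g" for f g using that unfolding A_def by blast
  have I: "\<phi> f / \<phi> g \<in> I" if "\<not> r f g" for f g using that unfolding I_def by blast
  have nz: "\<not> r 0 (g * g')" if "\<not> r 0 g" "\<not> r 0 g'" for g g'
    using that R.zero_le_mult_iff by blast
  have plus: "\<phi> f / \<phi> g + \<phi> f' / \<phi> g' = \<phi> (f * g' + f' * g) / \<phi> (g * g')"
    if "\<not> r 0 g" "\<not> r 0 g'" for f g f' g'
    using that ker by (simp add: hom_add hom_mult add_frac_eq)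
  have AI: "subring_ideal A I"
    unfolding subring_ideal_def
  proof (intro conjI ballI)
    show "1 \<in> A" using A[of 1 1] R.not_zero_le_one by (simp add: hom_one)
    show "0 \<in> I" using I[of 0 1] R.not_zero_le_one by (simp add: hom_zero)
    show "I \<subseteq> A" using A R.lt_imp_le R.lt_imp_nonzero unfolding I_def by blast
    fix x y assume "x \<in> A" "y \<in> A"
    then obtain f g f' g' where *: "x = \<phi> f / \<phi> g" "y = \<phi> f' / \<phi> g'" "r g f" "\<not> r 0 g" "r g' f'" "\<not> r 0 g'"
      unfolding A_def by blast
    have "r (g * g') (f * g')" "r (g * g') (f' * g)"
      using R.le_mult_right[OF *(3)] R.le_mult_left[OF *(5), of g] by (simp_all add: mult.commute[of f' g])
    then show "x + y \<in> A"
      using A[OF R.le_add nz] * plus by simp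
    show "x * y \<in> A"
      using A[OF R.le_mult[OF *(3,5)] nz[OF *(4,6)]] * by (simp add: hom_mult)
  next
    fix x assume "x \<in> A"
    then obtain f g where *: "x = \<phi> f / \<phi> g" "r g f" "\<not> r 0 g"
      unfolding A_def by blast
    then show "- x \<in> A" using A[of g "- f"] by (simp add: hom_uminus)
  next
    fix x y assume "x \<in> I" "y \<in> I"
    then obtain f g f' g' where *: "x = \<phi> f / \<phi> g" "y = \<phi> f' / \<phi> g'" "\<not> r f g" "\<not> r f' g'"
      unfolding I_def by blast
    have z: "\<not> r 0 g" "\<not> r 0 g'" using * R.lt_imp_nonzero by blast+
    have "\<not> r (f * g') (g * g')" "\<not> r (f' * g) (g * g')"
      using R.lt_mult_le[OF *(3) R.le_refl z(2)] R.lt_mult_le[OF *(4) R.le_refl z(1)]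
      by (simp_all add: mult.commute[of g g'])
    then show "x + y \<in> I"
      using I[OF R.lt_add] * plus[OF z] by simp
  next
    fix x y assume "x \<in> A" "y \<in> I"
    then obtain f g f' g' where *: "x = \<phi> f / \<phi> g" "y = \<phi> f' / \<phi> g'" "r g f" "\<not> r 0 g" "\<not> r f' g'"
      unfolding A_def I_def by blast
    then show "x * y \<in> I"
      using I[OF R.le_mult_lt[OF *(3,5,4)]] by (simp add: hom_mult)
  qed
  have "1 \<notin> I"
  proof
    assume "1 \<in> I"
    then obtain f g where fg: "\<phi> f / \<phi> g = 1" "\<not> r f g" unfolding I_def by force
    \<comment> \<open>A quotient equal to 1 puts \<open>f - g\<close> into the kernel, at value
      \<infinity>, and \<open>g = f - (f - g)\<close> then has at least the value of
      \<open>f\<close>.\<close>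
    then have "\<phi> (f - g) = 0" by (auto simp: hom_diff)
    then have "r 0 (f - g)" using ker by blast
    then have "r f (f - g)" using R.le_trans[OF R.le_zero] by blast
    from R.le_diff[OF R.le_refl this] fg(2) show False by simp
  qed
  then obtain B where B: "valuation_subring B" "A \<subseteq> B" "\<forall>a\<in>I. \<not> vle B a 1"
    using exists_dominating_valuation_subring[OF AI] by blast
  interpret valuation_subring B by fact
  \<comment> \<open>\<open>A \<subseteq> B\<close> preserves weak inequalities. That
    \<open>B\<close> dominates \<open>I\<close> preserves strict ones, which gives the converse by
    linearity.\<close>
  have "r f g \<longleftrightarrow> vle B (\<phi> f) (\<phi> g)" for f g
  proof
    assume fg: "r f g"
    show "vle B (\<phi> f) (\<phi> g)"
    proof (cases "r 0 f")
      case True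
      then have "\<phi> g = 0" using fg R.le_trans ker by blast
      then show ?thesis by (simp add: le_zero)
    next
      case False
      then show ?thesis using A[OF fg False] B(2) ker by (auto simp: vle_def)
    qed
  next
    assume fg: "vle B (\<phi> f) (\<phi> g)"
    show "r f g"
    proof (rule ccontr)
      assume nfg: "\<not> r f g"
      then have z: "\<phi> g \<noteq> 0" using ker R.lt_imp_nonzero by blast
      have "\<not> vle B (\<phi> f / \<phi> g) 1" using I[OF nfg] B(3) by blast
      then show False using fg z vle_divide_iff by simp
    qed
  qed
  with B(1) show ?thesis by blast
qed

section \<open>Value-transcendental and residue-transcendental valuations\<close>

text \<open>Since \<open>K\<close> is a field, the inverse of the value of a constant is the value
  of the inverse constant, so generating a subgroup adds nothing to the set of finite
  values.\<close>

lemma value_group_restrict: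
  fixes \<nu> :: "('k::field poly, 'g) pre_valuation"
  assumes "valuation \<nu>" and "g \<in> value_group (val_restrict \<nu>)"
  shows "\<exists>c. val \<nu> [:c:] = Some g"
proof -
  define G where "G = grp \<nu>"
  interpret ordered_abelian_group G using assms(1) by (simp add: valuation_def G_def)
  have M: "val \<nu> (x * y) = val_plus G (val \<nu> x) (val \<nu> y)" for x y
    using assms(1) by (simp add: valuation_def G_def)
  have V: "s \<in> carrier G" if "val \<nu> x = Some s" for x s
    using assms(1) that unfolding valuation_def G_def
    by (metis image_iff insert_iff option.distinct(1) option.inject)
  have Z: "val \<nu> 0 = None" "val \<nu> 1 = Some \<one>\<^bsub>G\<^esub>"
    using assms(1) by (simp_all add: valuation_def G_def)
  have "g \<in> generate G {g. \<exists>c. val \<nu> [:c:] = Some g}"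
    using assms(2) by (simp add: value_group_def val_restrict_def G_def)
  then show ?thesis
  proof (induction rule: generate.induct)
    case one
    then show ?case using Z(2) by (intro exI[of _ 1]) (simp add: one_pCons)
  next
    case (inv h)
    then obtain c where c: "val \<nu> [:c:] = Some h" by blast
    then have "c \<noteq> 0" using Z by auto
    then have "val_plus G (Some h) (val \<nu> [:inverse c:]) = Some \<one>\<^bsub>G\<^esub>"
      using M[of "[:c:]" "[:inverse c:]"] c Z(2) by (simp add: one_pCons)
    then obtain k where "val \<nu> [:inverse c:] = Some k" "h \<otimes>\<^bsub>G\<^esub> k = \<one>\<^bsub>G\<^esub>"
      by (auto simp: val_plus_def split: option.splits)
    then show ?case using V[OF c] V comm_inv_char by metis
  next
    case (eng h1 h2)
    then obtain c d where "val \<nu> [:c:] = Some h1" "val \<nu> [:d:] = Some h2" by blast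
    then have "val \<nu> ([:c:] * [:d:]) = Some (h1 \<otimes>\<^bsub>G\<^esub> h2)" unfolding M by (simp add: val_plus_def)
    then show ?case by (intro exI[of _ "c * d"]) (simp add: mult.commute)
  qed blast
qed

text \<open>Replaces the quotient of value groups by the preorder: the coset of
  \<open>\<nu> f\<close> has infinite order, because by \<open>value_group_restrict\<close> an
  element of the smaller group is the value of a single constant.\<close>

lemma value_transcendentalI:
  fixes \<nu> :: "('k::field poly, 'g) pre_valuation"
  assumes \<nu>: "valuation \<nu>" and supp: "\<And>f. nle \<nu> 0 f \<Longrightarrow> f = 0" and f: "f \<noteq> 0"
    and nontorsion: "\<And>n c. n > 0 \<Longrightarrow> nle \<nu> (f ^ n) [:c:] \<Longrightarrow> nle \<nu> [:c:] (f ^ n) \<Longrightarrow> False"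
  shows "value_transcendental \<nu>"
proof -
  define G where "G = grp \<nu>"
  interpret G: ordered_abelian_group G using \<nu> by (simp add: valuation_def G_def)
  interpret val_preorder "nle \<nu>" by (rule val_preorder_nle[OF \<nu>])
  have M: "val \<nu> (x * y) = val_plus G (val \<nu> x) (val \<nu> y)" for x y
    using \<nu> by (simp add: valuation_def G_def)
  have V: "s \<in> carrier G" if "val \<nu> x = Some s" for x s
    using \<nu> that unfolding valuation_def G_def
    by (metis image_iff insert_iff option.distinct(1) option.inject)
  have one: "val \<nu> 1 = Some \<one>\<^bsub>G\<^esub>" using \<nu> by (simp add: valuation_def G_def)
  have supp': "val_support \<nu> = {0}"
    using supp val_eq_None_iff[OF \<nu>] le_zero by (auto simp: val_support_def)
  obtain g where g: "val \<nu> f = Some g" using f supp val_eq_None_iff[OF \<nu>] by (cases "val \<nu> f") auto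
  have pow: "val \<nu> (f ^ n) = Some (g [^]\<^bsub>G\<^esub> n)" for n :: nat
    by (induction n) (use one V[OF g] in \<open>simp_all add: M g val_plus_def G.m_comm\<close>)
  define H N where "H = value_group \<nu>" and "N = value_group (val_restrict \<nu>)"
  have H: "subgroup H G"
    unfolding H_def value_group_def G_def[symmetric] using V by (intro G.generate_is_subgroup) auto
  have N: "subgroup N G"
    unfolding N_def value_group_def using V
    by (simp add: val_restrict_def G_def[symmetric]) (intro G.generate_is_subgroup, auto)
  have NH: "N \<subseteq> H"
    unfolding N_def H_def value_group_def
    by (simp add: val_restrict_def G_def[symmetric]) (intro G.mono_generate, auto)
  define G' where "G' = G\<lparr>carrier := H\<rparr>"
  have "group G'" unfolding G'_def by (rule G.subgroup_imp_group[OF H])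
  then have "comm_group G'"
    using subgroup.subset[OF H] G.m_comm by (intro group.group_comm_groupI) (auto simp: G'_def subset_iff)
  then interpret G': comm_group G' .
  have "subgroup N G'"
    unfolding G'_def using G.subgroup_incl[OF N H NH] .
  then interpret N: normal N G' by (rule G'.subgroup_imp_normal)
  have gH: "g \<in> carrier G'"
    unfolding G'_def H_def value_group_def using g by (auto intro: generate.incl)
  have powH: "g [^]\<^bsub>G'\<^esub> n = g [^]\<^bsub>G\<^esub> n" for n :: nat
    by (induction n) (auto simp: G'_def)
  have "\<not> torsion_group (G' Mod N)"
  proof
    assume "torsion_group (G' Mod N)"
    moreover have "N #>\<^bsub>G'\<^esub> g \<in> carrier (G' Mod N)" using gH by (simp add: carrier_FactGroup)
    ultimately obtain n :: nat where n: "n > 0" "(N #>\<^bsub>G'\<^esub> g) [^]\<^bsub>G' Mod N\<^esub> n = \<one>\<^bsub>G' Mod N\<^esub>"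
      unfolding torsion_group_def by blast
    then have "N #>\<^bsub>G'\<^esub> (g [^]\<^bsub>G\<^esub> n) = N"
      using N.FactGroup_pow[OF gH, of n] powH by simp
    moreover have "g [^]\<^bsub>G\<^esub> n \<in> carrier G'" using gH powH G'.nat_pow_closed by metis
    ultimately have "g [^]\<^bsub>G\<^esub> n \<in> N"
      using G'.rcos_self[OF _ N.subgroup_axioms] by metis
    then obtain c where "val \<nu> [:c:] = val \<nu> (f ^ n)"
      using value_group_restrict[OF \<nu>] pow unfolding N_def by metis
    then have "nle \<nu> (f ^ n) [:c:]" "nle \<nu> [:c:] (f ^ n)"
      using le_refl[of "f ^ n"] by (simp_all add: nle_def)
    with nontorsion[OF n(1)] show False by blast
  qed
  with supp' show ?thesis
    unfolding value_transcendental_def G'_def G_def H_def N_def by blast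
qed

section \<open>The residue ring of a valuation subring\<close>

context valuation_subring
begin

abbreviation "type_ring \<equiv> (ring_of_type_algebra :: 'a ring)\<lparr>carrier := B\<rparr>"
abbreviation "in_max a \<equiv> \<not> vle B a 1"
abbreviation "max_ideal \<equiv> {a. in_max a}"

lemma ring_of_type_algebra_simps [simp]:
  "\<zero>\<^bsub>(ring_of_type_algebra :: 'a ring)\<^esub> = 0" "\<one>\<^bsub>(ring_of_type_algebra :: 'a ring)\<^esub> = 1"
  "(a :: 'a) \<oplus>\<^bsub>ring_of_type_algebra\<^esub> b = a + b" "(a :: 'a) \<otimes>\<^bsub>ring_of_type_algebra\<^esub> b = a * b"
  by (simp_all add: ring_of_type_algebra_def)

lemma type_ring_simps [simp]:
  "carrier type_ring = B" "\<zero>\<^bsub>type_ring\<^esub> = 0" "\<one>\<^bsub>type_ring\<^esub> = 1"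
  "a \<oplus>\<^bsub>type_ring\<^esub> b = a + b" "a \<otimes>\<^bsub>type_ring\<^esub> b = a * b"
  by (simp_all add: ring_of_type_algebra_def)

lemma zero_mem: "0 \<in> B"
  using le_zero[of 1] by simp

lemma type_ring_cring: "cring type_ring"
proof (rule cringI)
  show "abelian_group type_ring"
  proof (rule abelian_groupI)
    fix x assume "x \<in> carrier type_ring"
    then show "\<exists>y\<in>carrier type_ring. y \<oplus>\<^bsub>type_ring\<^esub> x = \<zero>\<^bsub>type_ring\<^esub>"
      using uminus_mem by (intro bexI[of _ "- x"]) auto
  qed (auto simp: add_mem zero_mem)
  show "comm_monoid type_ring"
    by (rule comm_monoidI) (auto simp: mult_mem one_mem)
qed (auto simp: algebra_simps)

lemma type_ring_pow [simp]: "a [^]\<^bsub>type_ring\<^esub> (n::nat) = a ^ n"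
  by (induction n) (simp_all add: mult.commute)

lemma max_ideal_subset: "max_ideal \<subseteq> B"
  using lt_imp_le[of 1] by auto

lemma max_ideal_prime: "primeideal max_ideal type_ring"
proof (rule primeidealI)
  interpret R: cring type_ring by (rule type_ring_cring)
  show "ideal max_ideal type_ring"
  proof (rule idealI)
    show "subgroup max_ideal (add_monoid type_ring)"
    proof (rule R.add.subgroupI)
      fix a assume a: "a \<in> max_ideal"
      then have "a \<in> B" using max_ideal_subset by blast
      then have "\<ominus>\<^bsub>type_ring\<^esub> a = - a"
        using R.minus_equality[of "- a" a] uminus_mem by simp
      then show "\<ominus>\<^bsub>type_ring\<^esub> a \<in> max_ideal" using a by simp
    next
      fix a b assume "a \<in> max_ideal" "b \<in> max_ideal"
      then show "a \<oplus>\<^bsub>type_ring\<^esub> b \<in> max_ideal" using lt_add by simp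
    qed (use max_ideal_subset in \<open>auto intro: exI[of _ 0]\<close>)
    fix a x assume ax: "a \<in> max_ideal" "x \<in> carrier type_ring"
    then have "\<not> vle B (a * x) (1 * 1)" by (intro lt_mult_le) auto
    then show "x \<otimes>\<^bsub>type_ring\<^esub> a \<in> max_ideal" "a \<otimes>\<^bsub>type_ring\<^esub> x \<in> max_ideal"
      by (simp_all add: mult.commute)
  qed (rule R.ring_axioms)
  show "carrier type_ring \<noteq> max_ideal"
    using one_mem le_refl[of 1] by force
  show "a \<in> max_ideal \<or> b \<in> max_ideal"
    if "a \<otimes>\<^bsub>type_ring\<^esub> b \<in> max_ideal" for a b
    using that le_mult[of a 1 b 1] by auto
qed (rule type_ring_cring)

lemma residue_ring_domain: "domain (type_ring Quot max_ideal)"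
  using max_ideal_prime by (rule primeideal.quotient_is_domain)

lemma residue_hom: "ring_hom_ring type_ring (type_ring Quot max_ideal) ((+>\<^bsub>type_ring\<^esub>) max_ideal)"
  using max_ideal_prime unfolding primeideal_def by (intro ideal.rcos_ring_hom_ring) simp

lemma residue_eq_zero_iff:
  assumes "a \<in> B"
  shows "max_ideal +>\<^bsub>type_ring\<^esub> a = \<zero>\<^bsub>type_ring Quot max_ideal\<^esub> \<longleftrightarrow> in_max a"
proof -
  interpret primeideal max_ideal type_ring by (rule max_ideal_prime)
  have "max_ideal +>\<^bsub>type_ring\<^esub> a = max_ideal \<longleftrightarrow> in_max a"
    using a_rcos_self[of a] a_rcos_const[of a] assms by auto
  then show ?thesis by (simp add: FactRing_def)
qed

lemma type_ring_eval_Cons [simp]: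
  "ring.eval type_ring (a # as) u = a * u ^ length as + ring.eval type_ring as u"
  "ring.eval type_ring [] u = 0"
proof -
  interpret R: cring type_ring by (rule type_ring_cring)
  show "R.eval (a # as) u = a * u ^ length as + R.eval as u" "R.eval [] u = 0"
    by simp_all
qed

text \<open>The coefficients of an algebraic relation for the residue of \<open>u\<close> lift to a
  list in \<open>S\<close>. The relation says that the lifted expression lies in the maximal ideal,
  so by the hypothesis all lifted coefficients do, among them the lift of the leading one, which is
  nonzero.\<close>

lemma residue_transcendental_overI:
  assumes S: "subring S type_ring" and u: "u \<in> B"
    and *: "\<And>cs. set cs \<subseteq> S \<Longrightarrow> in_max (ring.eval type_ring cs u) \<Longrightarrow> \<forall>c\<in>set cs. in_max c"
  shows "(ring.transcendental (type_ring Quot max_ideal) over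
    ((+>\<^bsub>type_ring\<^esub>) max_ideal ` S)) (max_ideal +>\<^bsub>type_ring\<^esub> u)"
proof -
  define r where "r = (+>\<^bsub>type_ring\<^esub>) max_ideal"
  define Q where "Q = type_ring Quot max_ideal"
  interpret R: cring type_ring by (rule type_ring_cring)
  interpret Q: domain Q unfolding Q_def by (rule residue_ring_domain)
  interpret h: ring_hom_ring type_ring Q r unfolding Q_def r_def by (rule residue_hom)
  have SB: "S \<subseteq> B" using subringE(1)[OF S] by simp
  have sub: "subring (r ` S) Q"
  proof (rule Q.subringI)
    show "r ` S \<subseteq> carrier Q" using SB h.hom_closed by auto
    show "\<one>\<^bsub>Q\<^esub> \<in> r ` S" using subringE(3)[OF S] h.hom_one by (metis image_eqI)
    fix x y assume "x \<in> r ` S" "y \<in> r ` S"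
    then obtain a b where ab: "x = r a" "y = r b" "a \<in> S" "b \<in> S" by blast
    have B: "a \<in> carrier type_ring" "b \<in> carrier type_ring" using ab SB by auto
    show "\<ominus>\<^bsub>Q\<^esub> x \<in> r ` S"
      using subringE(5)[OF S ab(3)] h.hom_a_inv[OF B(1)] ab(1) by (metis image_eqI)
    show "x \<otimes>\<^bsub>Q\<^esub> y \<in> r ` S"
      using subringE(6)[OF S ab(3,4)] h.hom_mult[OF B] ab(1,2) by (metis image_eqI)
    show "x \<oplus>\<^bsub>Q\<^esub> y \<in> r ` S"
      using subringE(7)[OF S ab(3,4)] h.hom_add[OF B] ab(1,2) by (metis image_eqI)
  qed
  have "(Q.transcendental over (r ` S)) (r u)"
  proof (rule ccontr)
    assume "\<not> (Q.transcendental over (r ` S)) (r u)"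
    then have "(Q.algebraic over (r ` S)) (r u)" by (simp add: over_def)
    moreover have "r u \<in> carrier Q" using u h.hom_closed by simp
    ultimately obtain p where p: "p \<in> carrier ((r ` S)[X]\<^bsub>Q\<^esub>)" "p \<noteq> []" "Q.eval p (r u) = \<zero>\<^bsub>Q\<^esub>"
      using Q.algebraicE[OF sub] by blast
    from p(1,2) have p': "set p \<subseteq> r ` S" "hd p \<noteq> \<zero>\<^bsub>Q\<^esub>"
      unfolding univ_poly_carrier[symmetric] polynomial_def by auto
    from p'(1) have "p \<in> lists (r ` S)" by blast
    then have "p \<in> map r ` lists S" by (simp only: lists_image)
    then obtain cs where cs: "set cs \<subseteq> S" "p = map r cs" by auto
    have "r (R.eval cs u) = Q.eval p (r u)"
      using h.eval_hom'[of u cs] u cs SB by auto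
    moreover have "R.eval cs u \<in> B"
      using R.eval_in_carrier[of cs u] u cs SB by auto
    ultimately have "in_max (R.eval cs u)"
      using p(3) residue_eq_zero_iff unfolding Q_def r_def by simp
    then have "\<forall>c\<in>set cs. in_max c" using *[OF cs(1)] by blast
    then have "in_max (hd cs)" "hd cs \<in> B" "hd p = r (hd cs)"
      using cs p(2) SB by (cases cs; auto)+
    then show False
      using p'(2) residue_eq_zero_iff unfolding Q_def r_def by simp
  qed
  then show ?thesis by (simp add: r_def Q_def)
qed

end

text \<open>Coefficient lists for \<open>ring.eval\<close> begin with the leading coefficient, those
  for \<open>Poly\<close> with the constant one; hence \<open>rev\<close>.\<close>

lemma to_fract_pcompose_eval:
  fixes u :: "'k::field poly" and B :: "'k poly fract set"
  assumes "valuation_subring B"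
  shows "ring.eval ((ring_of_type_algebra :: 'k poly fract ring)\<lparr>carrier := B\<rparr>)
    (map (\<lambda>c. to_fract [:c:]) cs) (to_fract u) = to_fract (pcompose (Poly (rev cs)) u)"
proof -
  interpret valuation_subring B by fact
  have monom: "pcompose (Polynomial.monom c n) u = smult c (u ^ n)" for c n
  proof (induction n)
    case (Suc n)
    then show ?case by (simp add: monom_Suc pcompose_pCons)
  qed (simp add: monom_0)
  have pow: "to_fract u ^ n = to_fract (u ^ n)" for n
    by (induction n) simp_all
  show ?thesis
  proof (induction cs)
    case (Cons c cs)
    have "Poly (rev (c # cs)) = Poly (rev cs) + Polynomial.monom c (length cs)"
      by (simp add: Poly_append mult_monom monom_0[symmetric])
    then show ?case
      using Cons by (simp add: pcompose_add monom pow flip: to_fract_mult to_fract_add)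
  qed simp
qed

text \<open>Eliminates residue fields: transcendence of the residue of \<open>u\<close> is expressed
  by the preorder on K[x] alone. A polynomial over the integral constants may vanish at
  \<open>u\<close> modulo the maximal ideal only if all its coefficients do.\<close>

lemma residue_transcendentalI:
  fixes \<nu> :: "('k::field poly, 'g) pre_valuation"
  assumes \<nu>: "valuation \<nu>" and supp: "\<And>f. nle \<nu> 0 f \<Longrightarrow> f = 0" and u: "nle \<nu> 1 u"
    and trans: "\<And>P. (\<And>i. nle \<nu> 1 [:poly.coeff P i:]) \<Longrightarrow> \<not> nle \<nu> (pcompose P u) 1 \<Longrightarrow>
      \<forall>i. \<not> nle \<nu> [:poly.coeff P i:] 1"
  shows "residue_transcendental \<nu>"
proof -
  define G where "G = grp \<nu>"
  interpret G: ordered_abelian_group G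
    using \<nu> by (simp add: valuation_def G_def)
  interpret V: val_preorder "nle \<nu>" by (rule val_preorder_nle[OF \<nu>])
  have V: "s \<in> carrier G" if "val \<nu> x = Some s" for x s
    using \<nu> that unfolding valuation_def G_def
    by (metis image_iff insert_iff option.distinct(1) option.inject)
  have supp': "val_support \<nu> = {0}"
    using supp val_eq_None_iff[OF \<nu>] V.le_zero by (auto simp: val_support_def)
  have hom: "unital_ring_hom (to_fract :: 'k poly \<Rightarrow> _)" by unfold_locales simp_all
  have ker: "to_fract f = 0 \<longleftrightarrow> nle \<nu> 0 f" for f
    using supp[of f] V.le_zero by auto
  \<comment> \<open>\<open>B\<close> comes from Chevalley's theorem and not from
    \<open>fract_ext\<close>; \<open>val_w\<close> then identifies its ring and maximal ideal with
    those of \<open>fract_ext \<nu>\<close>, which makes the results on valuation subrings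
    applicable.\<close>
  obtain B where B: "valuation_subring B" and nle: "\<And>f g. nle \<nu> f g \<longleftrightarrow> vle B (to_fract f) (to_fract g)"
    using val_preorder_extend[OF val_preorder_nle[OF \<nu>] hom ker] by blast
  interpret valuation_subring B by fact
  define w where "w = fract_ext \<nu>"
  have grp_w: "grp w = G" by (simp add: w_def fract_ext_def G_def)
  have val_w: "val_le G (Some \<one>\<^bsub>G\<^esub>) (val w q) \<longleftrightarrow> q \<in> B"
    "val_less G (Some \<one>\<^bsub>G\<^esub>) (val w q) \<longleftrightarrow> in_max q" for q
  proof -
    obtain a b where q: "q = Fract a b" "b \<noteq> 0" by (cases q)
    have q': "q = to_fract a / to_fract b" using q by (simp add: Fract_conv_to_fract)
    have b: "to_fract b \<noteq> 0" using q by simp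
    have w: "val w q = val_minus G (val \<nu> a) (val \<nu> b)"
      unfolding w_def q(1) G_def by (rule fract_ext_Fract[OF \<nu> supp' q(2)])
    obtain t where t: "val \<nu> b = Some t"
      using q(2) supp val_eq_None_iff[OF \<nu>] by (cases "val \<nu> b") auto
    have B1: "q \<in> B \<longleftrightarrow> nle \<nu> b a"
      using vle_divide_iff2[OF b, of 1 "to_fract a"] by (simp add: nle q')
    have B2: "vle B q 1 \<longleftrightarrow> nle \<nu> a b"
      using vle_divide_iff[OF b, of "to_fract a" 1] by (simp add: nle q')
    have "(val_le G (Some \<one>\<^bsub>G\<^esub>) (val w q) \<longleftrightarrow> q \<in> B) \<and> (val_less G (Some \<one>\<^bsub>G\<^esub>) (val w q) \<longleftrightarrow> in_max q)"
    proof (cases "val \<nu> a")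
      case None
      then show ?thesis
        unfolding B1 B2 w by (simp add: t val_minus_def val_less_def nle_def val_le_def G_def)
    next
      case (Some s)
      note [simp] = V[OF Some] V[OF t]
      have r1: "(\<one>\<^bsub>G\<^esub>, s \<otimes>\<^bsub>G\<^esub> inv\<^bsub>G\<^esub> t) \<in> order_rel G \<longleftrightarrow> (t, s) \<in> order_rel G"
        using G.mult_mono'[of "\<one>\<^bsub>G\<^esub>" "s \<otimes>\<^bsub>G\<^esub> inv\<^bsub>G\<^esub> t" t] G.mult_mono'[of t s "inv\<^bsub>G\<^esub> t"]
        by (auto simp: G.m_assoc)
      have r2: "\<one>\<^bsub>G\<^esub> = s \<otimes>\<^bsub>G\<^esub> inv\<^bsub>G\<^esub> t \<longleftrightarrow> s = t"
        using G.r_cancel[of t "inv\<^bsub>G\<^esub> t" s] by auto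
      have r3: "(t, s) \<in> order_rel G \<and> s \<noteq> t \<longleftrightarrow> (s, t) \<notin> order_rel G"
        using G.rel_total[of s t] G.rel_antisym[of s t] G.rel_total[of s s] by auto
      show ?thesis
        unfolding B1 B2 w using r1 r2 r3
        by (simp add: Some t val_minus_def val_less_def nle_def val_le_def flip: G_def)
    qed
    then show "val_le G (Some \<one>\<^bsub>G\<^esub>) (val w q) \<longleftrightarrow> q \<in> B"
      "val_less G (Some \<one>\<^bsub>G\<^esub>) (val w q) \<longleftrightarrow> in_max q" by blast+
  qed
  have ring: "valuation_ring w = type_ring" "valuation_ideal w = max_ideal"
    by (simp_all add: valuation_ring_def valuation_ideal_def grp_w val_w)
  define S where "S = (\<lambda>c. to_fract [:c:]) ` {c. nle \<nu> 1 [:c:]}"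
  have S: "(\<lambda>c. residue_class w (to_fract [:c:])) ` carrier (valuation_ring (val_restrict \<nu>)) =
      (+>\<^bsub>type_ring\<^esub>) max_ideal ` S"
  proof -
    have "carrier (valuation_ring (val_restrict \<nu>)) = {c. nle \<nu> 1 [:c:]}"
      using \<nu> by (simp add: valuation_ring_def val_restrict_def nle_def valuation_def)
    then show ?thesis by (auto simp: residue_class_def ring S_def)
  qed
  have const: "to_fract [:c:] \<in> B \<longleftrightarrow> nle \<nu> 1 [:c:]" for c
    by (simp add: nle)
  interpret R: cring type_ring by (rule type_ring_cring)
  have subS: "subring S type_ring"
  proof (rule R.subringI)
    show "S \<subseteq> carrier type_ring" using const by (auto simp: S_def)
    have "1 = to_fract [:1::'k:]" "nle \<nu> 1 [:1:]" by (simp_all flip: one_pCons)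
    then have "1 \<in> S" unfolding S_def by blast
    then show "\<one>\<^bsub>type_ring\<^esub> \<in> S" by simp
    fix x y assume "x \<in> S" "y \<in> S"
    then obtain c d where cd: "x = to_fract [:c:]" "y = to_fract [:d:]" "nle \<nu> 1 [:c:]" "nle \<nu> 1 [:d:]"
      by (auto simp: S_def)
    have "nle \<nu> 1 ([:c:] + [:d:])" "nle \<nu> (1 * 1) ([:c:] * [:d:])" "nle \<nu> 1 (- [:c:])"
      by (rule V.le_add[OF cd(3,4)], rule V.le_mult[OF cd(3,4)], simp only: V.le_uminus_iff cd(3))
    then have n: "nle \<nu> 1 [:c + d:]" "nle \<nu> 1 [:c * d:]" "nle \<nu> 1 [:- c:]"
      by (simp_all add: mult.commute)
    have "x + y = to_fract [:c + d:]" "x * y = to_fract [:c * d:]" "- x = to_fract [:- c:]"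
      unfolding cd by (simp_all flip: to_fract_add to_fract_mult to_fract_uminus)
    then have mem: "x + y \<in> S" "x * y \<in> S" "- x \<in> S"
      using n by (auto simp: S_def)
    then show "x \<otimes>\<^bsub>type_ring\<^esub> y \<in> S" "x \<oplus>\<^bsub>type_ring\<^esub> y \<in> S" by simp_all
    have "x \<in> B" using cd const by simp
    then have "\<ominus>\<^bsub>type_ring\<^esub> x = - x"
      using R.minus_equality[of "- x" x] uminus_mem by simp
    with mem(3) show "\<ominus>\<^bsub>type_ring\<^esub> x \<in> S" by simp
  qed
  have uB: "to_fract u \<in> B" using u nle[of 1 u] by simp
  have tr: "(ring.transcendental (type_ring Quot max_ideal) over
    ((+>\<^bsub>type_ring\<^esub>) max_ideal ` S)) (max_ideal +>\<^bsub>type_ring\<^esub> to_fract u)"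
  proof (rule residue_transcendental_overI[OF subS uB])
    fix xs assume xs: "set xs \<subseteq> S" and ev: "in_max (R.eval xs (to_fract u))"
    from xs have "xs \<in> lists S" by blast
    then have "xs \<in> map (\<lambda>c. to_fract [:c:]) ` lists {c. nle \<nu> 1 [:c:]}"
      by (simp only: S_def lists_image)
    then obtain cs where cs: "xs = map (\<lambda>c. to_fract [:c:]) cs" "set cs \<subseteq> {c. nle \<nu> 1 [:c:]}"
      by auto
    define P where "P = Poly (rev cs)"
    have "\<not> nle \<nu> (pcompose P u) 1"
      using ev unfolding cs(1) to_fract_pcompose_eval[OF B] nle P_def by simp
    moreover have "nle \<nu> 1 [:poly.coeff P i:]" for i
      using cs(2) nth_mem[of i "rev cs"] V.le_zero[of 1]
      by (auto simp: P_def nth_default_def simp del: nth_mem)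
    ultimately have P: "\<not> nle \<nu> [:poly.coeff P i:] 1" for i using trans[of P] by simp
    have "in_max (to_fract [:c:])" if "c \<in> set cs" for c
    proof -
      from that obtain i where "i < length (rev cs)" "rev cs ! i = c"
        by (metis in_set_conv_nth set_rev)
      then have "poly.coeff P i = c" by (simp add: P_def nth_default_def)
      then show ?thesis using P[of i] by (simp add: nle)
    qed
    then show "\<forall>c\<in>set xs. in_max c" by (simp add: cs(1))
  qed
  have cl: "max_ideal +>\<^bsub>type_ring\<^esub> to_fract u \<in> carrier (type_ring Quot max_ideal)"
    using ring_hom_closed[OF ring_hom_ring.homh[OF residue_hom], of "to_fract u"] uB by simp
  have field: "residue_field (fract_ext \<nu>) = type_ring Quot max_ideal"
    by (simp add: residue_field_def ring flip: w_def)
  have subfield: "residue_subfield \<nu> = (+>\<^bsub>type_ring\<^esub>) max_ideal ` S"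
    unfolding residue_subfield_def w_def[symmetric] by (rule S)
  show ?thesis
    unfolding residue_transcendental_def field subfield by (intro conjI bexI) (rule supp', rule tr, rule cl)
qed

section \<open>Density\<close>

lemma generate_topology_on_finite_Inter:
  assumes "generate_topology_on \<S> U" "x \<in> U"
  shows "\<exists>F. finite F \<and> F \<noteq> {} \<and> F \<subseteq> \<S> \<and> x \<in> \<Inter>F \<and> \<Inter>F \<subseteq> U"
  using assms
proof (induction rule: generate_topology_on.induct)
  case (Int a b)
  then have "x \<in> a" "x \<in> b" by simp_all
  with Int.IH obtain F1 F2 where F1: "finite F1" "F1 \<noteq> {}" "F1 \<subseteq> \<S>" "x \<in> \<Inter>F1" "\<Inter>F1 \<subseteq> a"
    and F2: "finite F2" "F2 \<noteq> {}" "F2 \<subseteq> \<S>" "x \<in> \<Inter>F2" "\<Inter>F2 \<subseteq> b"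
    by metis
  have "\<Inter>(F1 \<union> F2) = \<Inter>F1 \<inter> \<Inter>F2" by (rule Inter_Un_distrib)
  with F1 F2 show ?case by (intro exI[of _ "F1 \<union> F2"]) (simp add: le_infI1 le_infI2)
next
  case (UN K)
  then obtain k where k: "k \<in> K" "x \<in> k" by blast
  from UN.IH[OF this] obtain F where "finite F \<and> F \<noteq> {} \<and> F \<subseteq> \<S> \<and> x \<in> \<Inter>F \<and> \<Inter>F \<subseteq> k" ..
  moreover have "k \<subseteq> \<Union>K" using k by blast
  ultimately show ?case by (intro exI[of _ F]) (simp add: subset_trans[of _ k])
next
  case (Basis s)
  then show ?case by (intro exI[of _ "{s}"]) simp
qed simp

lemma extensionsD:
  assumes "\<nu> \<in> extensions v"
  shows "valuation \<nu>" "val_preorder (nle \<nu>)"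
  using assms val_preorder_nle by (auto simp: extensions_def)

text \<open>A pair \<open>(f, g)\<close> stands for the subbasic set U(f,g). The relation
  \<open>r\<close> is left arbitrary so that the same conditions can be tested at a point
  \<open>z\<close>, where \<open>r\<close> compares \<open>f(z)\<close> with
  \<open>g(z)\<close>.\<close>

definition satisfies :: "('r::zero \<times> 'r) set \<Rightarrow> ('r \<Rightarrow> 'r \<Rightarrow> bool) \<Rightarrow> bool" where
  "satisfies T r \<longleftrightarrow> (\<forall>(f, g)\<in>T. r g f \<and> \<not> r 0 g)"

text \<open>\<open>VV_subbasic\<close> is an image of representatives; equivalent valuations have
  the same \<open>nle\<close>, so the condition may be read off from any of them.\<close>

lemma val_class_mem_subbasic_iff:
  assumes \<nu>: "\<nu> \<in> extensions v"
  shows "val_class v \<nu> \<in> VV_subbasic v f g \<longleftrightarrow> satisfies {(f, g)} (nle \<nu>)"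
proof
  assume "val_class v \<nu> \<in> VV_subbasic v f g"
  then obtain \<nu>' where \<nu>': "\<nu>' \<in> extensions v" "val_class v \<nu> = val_class v \<nu>'"
    and *: "nle \<nu>' g f" "val \<nu>' g \<noteq> None"
    by (auto simp: VV_subbasic_def nle_def)
  have "(\<nu>, \<nu>') \<in> equiv_rel v"
    using eq_equiv_class[OF _ equiv_equiv_rel \<nu>'(1)] \<nu>'(2) unfolding val_class_def by blast
  then have "nle \<nu> = nle \<nu>'"
    using val_equiv_iff_nle extensionsD(1) by (auto simp: equiv_rel_def)
  with * show "satisfies {(f, g)} (nle \<nu>)"
    using val_eq_None_iff[OF extensionsD(1)[OF \<nu>'(1)]] by (simp add: satisfies_def)
next
  assume "satisfies {(f, g)} (nle \<nu>)"
  then have "val_le (grp \<nu>) (val \<nu> g) (val \<nu> f) \<and> val \<nu> g \<noteq> None"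
    unfolding val_eq_None_iff[OF extensionsD(1)[OF \<nu>]] by (simp add: satisfies_def nle_def)
  then show "val_class v \<nu> \<in> VV_subbasic v f g"
    unfolding VV_subbasic_def using \<nu> by (intro imageI) simp
qed

text \<open>A neighbourhood of a class contains a finite intersection of subbasic sets around it.
  This turns density into a question about finitely many comparisons, and no topology is left
  afterwards.\<close>

lemma valuation_spectrum_dense:
  assumes "\<And>\<nu> T. \<nu> \<in> extensions v \<Longrightarrow> finite T \<Longrightarrow> satisfies T (nle \<nu>) \<Longrightarrow>
    \<exists>\<nu>'\<in>extensions v. P \<nu>' \<and> satisfies T (nle \<nu>')"
  shows "valuation_spectrum v closure_of (val_class v ` {\<nu> \<in> extensions v. P \<nu>}) = VV v"
proof (intro equalityI subsetI)
  fix x assume "x \<in> valuation_spectrum v closure_of (val_class v ` {\<nu> \<in> extensions v. P \<nu>})"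
  then show "x \<in> VV v" by (simp add: in_closure_of topspace_valuation_spectrum)
next
  fix x assume x: "x \<in> VV v"
  then obtain \<nu> where \<nu>: "\<nu> \<in> extensions v" "x = val_class v \<nu>" by (auto simp: VV_conv_class)
  have *: "\<exists>y. y \<in> val_class v ` {\<nu> \<in> extensions v. P \<nu>} \<and> y \<in> U"
    if U: "x \<in> U" "openin (valuation_spectrum v) U" for U
  proof -
    define q where "q = (\<lambda>(f, g). VV_subbasic v f g)"
    have "{VV_subbasic v f g | f g. True} = range q"
      by (auto simp: q_def)
    then have "generate_topology_on (range q) U"
      using U(2) unfolding valuation_spectrum_def openin_topology_generated_by_iff by simp
    then obtain F where F: "finite F" "F \<subseteq> range q" "x \<in> \<Inter>F" "\<Inter>F \<subseteq> U"
      using generate_topology_on_finite_Inter[OF _ U(1)] by metis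
    obtain T where T: "finite T" "F = q ` T"
      using finite_subset_image[OF F(1,2)] by metis
    have iff: "val_class v \<mu> \<in> \<Inter>F \<longleftrightarrow> satisfies T (nle \<mu>)" if "\<mu> \<in> extensions v" for \<mu>
    proof -
      have "val_class v \<mu> \<in> \<Inter>F \<longleftrightarrow> (\<forall>(f, g)\<in>T. val_class v \<mu> \<in> VV_subbasic v f g)"
        unfolding T(2) by (auto simp: q_def)
      then show ?thesis
        unfolding val_class_mem_subbasic_iff[OF that] by (simp add: satisfies_def)
    qed
    have "satisfies T (nle \<nu>)" using iff[OF \<nu>(1)] F(3) \<nu>(2) by simp
    then obtain \<nu>' where "\<nu>' \<in> extensions v" "P \<nu>'" "satisfies T (nle \<nu>')"
      using assms[OF \<nu>(1) T(1)] by blast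
    then have "val_class v \<nu>' \<in> U" "val_class v \<nu>' \<in> val_class v ` {\<nu> \<in> extensions v. P \<nu>}"
      using iff[of \<nu>'] F(4) by auto
    then show ?thesis by blast
  qed
  then show "x \<in> valuation_spectrum v closure_of (val_class v ` {\<nu> \<in> extensions v. P \<nu>})"
    unfolding in_closure_of topspace_valuation_spectrum
  proof (intro conjI allI impI)
    fix U assume "x \<in> U \<and> openin (valuation_spectrum v) U"
    then show "\<exists>y. y \<in> val_class v ` {\<nu> \<in> extensions v. P \<nu>} \<and> y \<in> U"
      using * by simp
  qed (rule x)
qed

section \<open>Approximation by points of the algebraic closure\<close>

context unital_ring_hom
begin

lemma map_poly_hom: "unital_ring_hom (map_poly \<phi>)"
proof
  show "map_poly \<phi> (p + q) = map_poly \<phi> p + map_poly \<phi> q" for p q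
    by (rule poly_eqI) (simp add: coeff_map_poly hom_zero hom_add)
  show "map_poly \<phi> (p * q) = map_poly \<phi> p * map_poly \<phi> q" for p q
    by (rule poly_eqI) (simp add: coeff_map_poly hom_zero coeff_mult hom_sum hom_mult)
qed (simp add: hom_one)

lemma poly_map_poly: "poly (map_poly \<phi> p) (\<phi> a) = \<phi> (poly p a)"
  by (induction p) (simp_all add: hom_zero hom_add hom_mult map_poly_pCons)

lemma map_poly_pcompose:
  "map_poly \<phi> (pcompose p q) = pcompose (map_poly \<phi> p) (map_poly \<phi> q)"
proof -
  interpret P: unital_ring_hom "map_poly \<phi>" by (rule map_poly_hom)
  show ?thesis
    by (induction p)
      (simp_all add: hom_zero P.hom_add P.hom_mult map_poly_pCons pcompose_pCons P.hom_zero)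
qed

end

lemma unital_ring_hom_comp:
  "unital_ring_hom \<phi> \<Longrightarrow> unital_ring_hom \<psi> \<Longrightarrow> unital_ring_hom (\<lambda>a. \<phi> (\<psi> a))"
  by (simp add: unital_ring_hom_def)

lemma unital_ring_hom_poly: "unital_ring_hom (\<lambda>p. poly p a)"
  by unfold_locales simp_all

lemma unital_ring_hom_pcompose: "unital_ring_hom (\<lambda>p. pcompose p q)"
  by unfold_locales (simp_all add: pcompose_add pcompose_mult pcompose_1)

lemma unital_ring_hom_to_ac: "unital_ring_hom (to_ac :: 'k::field \<Rightarrow> 'k alg_closure)"
  by unfold_locales simp_all

lemma unital_ring_hom_to_fract: "unital_ring_hom (to_fract :: 'a::idom \<Rightarrow> 'a fract)"
  by unfold_locales simp_all

lemma unital_ring_hom_const: "unital_ring_hom (\<lambda>a::'a::comm_ring_1. [:a:])"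
  by unfold_locales (simp_all add: one_pCons mult.commute)

lemma field_hom_eq_0_iff:
  fixes \<phi> :: "'a::field \<Rightarrow> 'b::field"
  assumes "unital_ring_hom \<phi>"
  shows "\<phi> a = 0 \<longleftrightarrow> a = 0"
proof -
  interpret unital_ring_hom \<phi> by fact
  show ?thesis using hom_mult[of a "inverse a"] hom_one hom_zero by (cases "a = 0") auto
qed

text \<open>In an algebraic relation for \<open>r\<close>, two terms must have the same value.\<close>

lemma (in valuation_subring) algebraic_torsion:
  fixes \<phi> :: "'k::field \<Rightarrow> 'a"
  assumes \<phi>: "unital_ring_hom \<phi>" and p: "p \<noteq> 0" "poly (map_poly \<phi> p) r = 0" and r: "r \<noteq> 0"
  shows "\<exists>n>0. \<exists>d. d \<noteq> 0 \<and> vle B (r ^ n) (\<phi> d) \<and> vle B (\<phi> d) (r ^ n)"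
proof -
  interpret unital_ring_hom \<phi> by fact
  have inj: "\<phi> a = 0 \<longleftrightarrow> a = 0" for a
    by (rule field_hom_eq_0_iff[OF \<phi>])
  define f where "f i = \<phi> (poly.coeff p i) * r ^ i" for i
  \<comment> \<open>Only nonzero coefficients are kept, so that the tie to be found is one between
    finite values.\<close>
  define S where "S = {i. i \<le> Polynomial.degree p \<and> poly.coeff p i \<noteq> 0}"
  have S: "finite S" "S \<noteq> {}" using p(1) by (auto simp: S_def intro!: exI[of _ "Polynomial.degree p"])
  have deg: "Polynomial.degree (map_poly \<phi> p) = Polynomial.degree p"
    by (rule degree_map_poly) (simp add: inj)
  have "sum f S = (\<Sum>i\<le>Polynomial.degree p. f i)"
    unfolding S_def by (intro sum.mono_neutral_left) (auto simp: f_def hom_zero)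
  also have "\<dots> = 0" using p(2) by (simp add: poly_altdef deg f_def coeff_map_poly hom_zero)
  finally have sum: "sum f S = 0" .
  obtain k where k: "k \<in> S" "\<forall>j\<in>S. vle B (f k) (f j)"
    using finite_min_exists[OF S] by blast
  have nz: "f i \<noteq> 0" if "i \<in> S" for i using that r inj by (simp add: f_def S_def)
  \<comment> \<open>The sum is 0, of value \<infinity>, and therefore cannot have the finite value
    of a strictly least term.\<close>
  have "\<exists>j\<in>S. j \<noteq> k \<and> vle B (f j) (f k)"
  proof (rule ccontr)
    assume "\<not> ?thesis"
    then have "vle B (sum f S) (f k) \<and> vle B (f k) (sum f S)"
      using S k nz by (intro sum_dominated) auto
    then show False using nz[OF k(1)] by (simp add: sum)
  qed
  then obtain j where j: "j \<in> S" "j \<noteq> k" "vle B (f j) (f k)" by blast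
  have main: "\<exists>n>0. \<exists>d. d \<noteq> 0 \<and> vle B (r ^ n) (\<phi> d) \<and> vle B (\<phi> d) (r ^ n)"
    if ij: "i \<in> S" "j \<in> S" "i < j" "vle B (f i) (f j) \<and> vle B (f j) (f i)" for i j
  proof -
    define a b where "a = poly.coeff p i" and "b = poly.coeff p j"
    have ab: "a \<noteq> 0" "b \<noteq> 0" using ij by (auto simp: a_def b_def S_def)
    have fj: "f j = r ^ (j - i) * \<phi> b * r ^ i"
      using ij(3) by (simp add: f_def b_def mult_ac flip: power_add)
    have fi: "f i = \<phi> a * r ^ i" by (simp add: f_def a_def)
    have "\<not> vle B 0 (r ^ i)" using r by simp
    from le_mult_cancel[OF _ this, of "r ^ (j - i) * \<phi> b" "\<phi> a"]
      le_mult_cancel[OF _ this, of "\<phi> a" "r ^ (j - i) * \<phi> b"] ij(4)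
    have "vle B (r ^ (j - i) * \<phi> b) (\<phi> a) \<and> vle B (\<phi> a) (r ^ (j - i) * \<phi> b)"
      unfolding fi fj by blast
    then have *: "vle B (r ^ (j - i)) (\<phi> a / \<phi> b) \<and> vle B (\<phi> a / \<phi> b) (r ^ (j - i))"
      using ab inj by (intro eqv_divideI) auto
    have "\<phi> (a / b) * \<phi> b = \<phi> a" using ab by (simp flip: hom_mult)
    then have "\<phi> a / \<phi> b = \<phi> (a / b)" using ab inj by (simp add: field_simps)
    with * ab ij(3) show ?thesis by (intro exI[of _ "j - i"] conjI exI[of _ "a / b"]) auto
  qed
  show ?thesis
  proof (cases "j < k")
    case True
    show ?thesis by (rule main[OF j(1) k(1) True]) (use j k in simp)
  next
    case False
    then have kj: "k < j" using j(2) by simp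
    show ?thesis by (rule main[OF k(1) j(1) kj]) (use j k in simp)
  qed
qed

text \<open>To be used with \<open>M\<close> the algebraic closure of \<open>K\<close>, the field
  \<open>L = M(y)\<close> and \<open>z = y\<close>. The assumption \<open>z_new\<close> keeps all
  differences \<open>z - \<kappa> r\<close> nonzero, hence of finite value.\<close>

locale approximation = C: valuation_subring C + \<kappa>: unital_ring_hom \<kappa>
  for C :: "'l::field set" and \<kappa> :: "'m::alg_closed_field \<Rightarrow> 'l" +
  fixes z :: 'l
  assumes z_new: "\<And>a. z \<noteq> \<kappa> a"
begin

notation C.lt (infix "\<triangleleft>" 50)

abbreviation le (infix "\<trianglelefteq>" 50) where "a \<trianglelefteq> b \<equiv> vle C a b"
abbreviation eqv (infix "\<bumpeq>" 50) where "a \<bumpeq> b \<equiv> a \<trianglelefteq> b \<and> b \<trianglelefteq> a"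

abbreviation at_z :: "'m poly \<Rightarrow> 'l" where "at_z p \<equiv> poly (map_poly \<kappa> p) z"

lemma \<kappa>_eq_0_iff [simp]: "\<kappa> a = 0 \<longleftrightarrow> a = 0"
  by (rule field_hom_eq_0_iff) (rule \<kappa>.unital_ring_hom_axioms)

lemma \<kappa>_divide: "\<kappa> (a / b) = \<kappa> a / \<kappa> b"
proof (cases "b = 0")
  case False
  have "\<kappa> (a / b) * \<kappa> b = \<kappa> a" using False by (simp flip: \<kappa>.hom_mult)
  with False show ?thesis by (simp add: field_simps)
qed (simp add: \<kappa>.hom_zero)

text \<open>If every \<open>z - r\<close> has a value in the value group of the algebraically closed field, let \<open>r\<^sub>0\<close>
  be a root closest to \<open>z\<close> and move away from it by an element of the value of \<open>z - r\<^sub>0\<close>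
  in a residue direction that contains no root.\<close>

lemma approximate_differences:
  assumes val: "\<And>r. \<exists>c. c \<noteq> 0 \<and> z - \<kappa> r \<bumpeq> \<kappa> c" and R: "finite R" "R \<noteq> {}"
  shows "\<exists>z'. \<forall>r\<in>R. z - \<kappa> r \<bumpeq> \<kappa> (z' - r)"
proof -
  obtain r0 where r0: "r0 \<in> R" "\<forall>r\<in>R. z - \<kappa> r \<trianglelefteq> z - \<kappa> r0"
    using C.finite_max_exists[OF R, of "\<lambda>r. z - \<kappa> r"] by blast
  obtain e where e: "e \<noteq> 0" "z - \<kappa> r0 \<bumpeq> \<kappa> e" using val by blast
  \<comment> \<open>The points of \<open>R\<close> that are as close to \<open>z\<close> as
    \<open>r0\<close>; only their directions \<open>\<eta> r\<close>, measured in units of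
    \<open>e\<close>, have to be avoided.\<close>
  define S where "S = {r \<in> R. z - \<kappa> r \<bumpeq> \<kappa> e}"
  have S: "finite S" "r0 \<in> S" using R r0 e by (auto simp: S_def)
  define \<eta> where "\<eta> r = (r - r0) / e" for r
  have \<eta>: "1 \<trianglelefteq> \<kappa> (\<eta> r)" if "r \<in> S" for r
  proof -
    have "\<kappa> (r - r0) = (z - \<kappa> r0) - (z - \<kappa> r)" by (simp add: \<kappa>.hom_diff)
    moreover have "\<kappa> e \<trianglelefteq> (z - \<kappa> r0) - (z - \<kappa> r)"
      by (rule C.le_diff) (use that e in \<open>auto simp: S_def\<close>)
    ultimately show ?thesis
      using C.vle_divide_iff2[of "\<kappa> e" 1 "\<kappa> (r - r0)"] e(1) by (simp add: \<eta>_def \<kappa>_divide del: C.vle_one)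
  qed
  define p where "p = (\<Prod>r\<in>S. [:- \<eta> r, 1:])"
  have "Polynomial.degree p = card S"
    unfolding p_def by (subst degree_prod_eq_sum_degree) auto
  then have deg: "Polynomial.degree p > 0" using S by (auto simp: card_gt_0_iff)
  \<comment> \<open>A root \<open>\<zeta>\<close> of \<open>p - 1\<close> makes the product of all
    \<open>\<zeta> - \<eta> r\<close> equal to 1. Once the factors are known to be integral, each is
    a unit, so the residue of \<open>\<zeta>\<close> differs from that of every
    \<open>\<eta> r\<close>.\<close>
  then have "Polynomial.degree (p + (- 1)) > 0"
    by (subst degree_add_eq_left) simp_all
  then obtain \<zeta> where "poly (p + (- 1)) \<zeta> = 0" using alg_closed_imp_poly_has_root by blast
  then have \<zeta>: "(\<Prod>r\<in>S. \<zeta> - \<eta> r) = 1" by (simp add: p_def poly_prod)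
  have prod: "(\<Prod>r\<in>S. \<kappa> (\<zeta> - \<eta> r)) = 1"
  proof -
    have "\<kappa> (prod f A) = (\<Prod>r\<in>A. \<kappa> (f r))" for f and A :: "'m set"
      by (induction A rule: infinite_finite_induct) (simp_all add: \<kappa>.hom_one \<kappa>.hom_mult)
    from this[of "\<lambda>r. \<zeta> - \<eta> r" S] show ?thesis by (simp add: \<zeta> \<kappa>.hom_one)
  qed
  \<comment> \<open>If \<open>\<zeta>\<close> had negative value, each factor would have the value
    of \<open>\<zeta>\<close>, and the product, taken over the nonempty \<open>S\<close>, could not
    be 1.\<close>
  have \<zeta>1: "1 \<trianglelefteq> \<kappa> \<zeta>"
  proof (rule ccontr)
    assume n: "\<not> 1 \<trianglelefteq> \<kappa> \<zeta>"
    have "\<kappa> (\<zeta> - \<eta> r) \<bumpeq> \<kappa> \<zeta>" if "r \<in> S" for r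
    proof -
      have "\<kappa> \<zeta> + - \<kappa> (\<eta> r) \<bumpeq> \<kappa> \<zeta>"
        using C.lt_le_trans[OF n \<eta>[OF that]] by (intro C.eqv_add_lt) simp
      then show ?thesis by (simp add: \<kappa>.hom_diff)
    qed
    then have "(\<Prod>r\<in>S. \<kappa> (\<zeta> - \<eta> r)) \<bumpeq> (\<Prod>r\<in>S. \<kappa> \<zeta>)" by (rule C.eqv_prod)
    then have "1 \<trianglelefteq> \<kappa> \<zeta> ^ card S" unfolding prod by simp
    moreover have "\<not> 1 ^ card S \<trianglelefteq> \<kappa> \<zeta> ^ card S"
      using n S by (intro C.lt_power) (auto simp: card_gt_0_iff)
    ultimately show False by simp
  qed
  have int: "1 \<trianglelefteq> \<kappa> (\<zeta> - \<eta> r)" if "r \<in> S" for r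
    unfolding \<kappa>.hom_diff by (rule C.le_diff[OF \<zeta>1 \<eta>[OF that]])
  have unit: "\<kappa> (\<zeta> - \<eta> r) \<trianglelefteq> 1" if "r \<in> S" for r
  proof (rule ccontr)
    assume n: "\<not> \<kappa> (\<zeta> - \<eta> r) \<trianglelefteq> 1"
    have "1 \<trianglelefteq> (\<Prod>r\<in>S - {r}. \<kappa> (\<zeta> - \<eta> r))"
    proof -
      have "1 \<trianglelefteq> prod f A" if "\<And>i. i \<in> A \<Longrightarrow> 1 \<trianglelefteq> f i" for f and A :: "'m set"
        using that by (induction A rule: infinite_finite_induct) (auto intro: C.mult_mem C.one_mem)
      from this[of "S - {r}" "\<lambda>r. \<kappa> (\<zeta> - \<eta> r)"] show ?thesis using int by blast
    qed
    from C.lt_mult_le[OF n this] have "\<not> (\<Prod>r\<in>S. \<kappa> (\<zeta> - \<eta> r)) \<trianglelefteq> 1"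
      using S(1) that by (simp add: prod.remove)
    then show False unfolding prod using C.le_refl by blast
  qed
  define z' where "z' = r0 + e * \<zeta>"
  have "z - \<kappa> r \<bumpeq> \<kappa> (z' - r)" if r: "r \<in> R" for r
  proof (cases "r \<in> S")
    case True
    have "z' - r = e * (\<zeta> - \<eta> r)" using e(1) by (simp add: z'_def \<eta>_def field_simps)
    moreover have "\<kappa> e * 1 \<bumpeq> \<kappa> e * \<kappa> (\<zeta> - \<eta> r)"
      using int[OF True] unit[OF True] by (intro C.eqv_mult) simp_all
    ultimately have "\<kappa> (z' - r) \<bumpeq> \<kappa> e" by (simp add: \<kappa>.hom_mult)
    moreover have "z - \<kappa> r \<bumpeq> \<kappa> e" using True by (simp add: S_def)
    ultimately show ?thesis
      using C.le_trans[of "z - \<kappa> r" "\<kappa> e"] C.le_trans[of _ "\<kappa> e" "z - \<kappa> r"] by simp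
  next
    case False
    \<comment> \<open>Outside \<open>S\<close> the point \<open>r\<close> is farther away than the
      shift: \<open>z' - z = e \<zeta> - (z - r0)\<close> has at least the value of
      \<open>e\<close>, which exceeds that of \<open>z - r\<close>.\<close>
    have le: "z - \<kappa> r \<trianglelefteq> \<kappa> e" using C.le_trans[of _ "z - \<kappa> r0" "\<kappa> e"] r0(2) r e(2) by simp
    then have lt: "\<not> \<kappa> e \<trianglelefteq> z - \<kappa> r" using False r unfolding S_def by blast
    have "\<kappa> e \<trianglelefteq> \<kappa> e * \<kappa> \<zeta>" using C.le_mult_left[OF \<zeta>1, of "\<kappa> e"] by simp
    then have "\<kappa> e \<trianglelefteq> \<kappa> e * \<kappa> \<zeta> - (z - \<kappa> r0)"
      using C.le_diff e(2) by blast
    then have "(z - \<kappa> r) + (\<kappa> e * \<kappa> \<zeta> - (z - \<kappa> r0)) \<bumpeq> z - \<kappa> r"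
      by (intro C.eqv_add_lt C.lt_le_trans[OF lt])
    then show ?thesis by (simp add: z'_def \<kappa>.hom_diff \<kappa>.hom_add \<kappa>.hom_mult algebra_simps)
  qed
  then show ?thesis by blast
qed

text \<open>Over an algebraically closed field the polynomials split, so it suffices to keep the
  values of the differences from their finitely many roots.\<close>

lemma approximate_values:
  assumes val: "\<And>r. \<exists>c. c \<noteq> 0 \<and> z - \<kappa> r \<bumpeq> \<kappa> c" and P: "finite P" "0 \<notin> P"
  shows "\<exists>z'. \<forall>p\<in>P. at_z p \<bumpeq> \<kappa> (poly p z')"
proof -
  \<comment> \<open>The extra point 0 makes \<open>R\<close> nonempty, as
    \<open>approximate_differences\<close> requires.\<close>
  define R where "R = insert 0 (\<Union>p\<in>P. {r. poly p r = 0})"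
  have "finite {r. poly p r = 0}" if "p \<in> P" for p
    by (rule poly_roots_finite) (use P that in auto)
  then have "finite R" using P by (simp add: R_def)
  then obtain z' where z': "\<forall>r\<in>R. z - \<kappa> r \<bumpeq> \<kappa> (z' - r)"
    using approximate_differences[OF val, of R] by (auto simp: R_def)
  interpret M: unital_ring_hom "map_poly \<kappa>" by (rule \<kappa>.map_poly_hom)
  have "at_z p \<bumpeq> \<kappa> (poly p z')" if p: "p \<in> P" for p
  proof -
    have p0: "p \<noteq> 0" using p P by auto
    obtain A where A: "p = smult (lead_coeff p) (\<Prod>x\<in>#A. [:-x, 1:])"
      using alg_closed_imp_factorization[OF p0] by blast
    have root: "poly p x = 0" if "x \<in># A" for x
      using that by (subst A) (auto simp: poly_prod_mset prod_mset_zero_iff)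
    have "at_z (\<Prod>x\<in>#A. [:-x, 1:]) \<bumpeq> \<kappa> (poly (\<Prod>x\<in>#A. [:-x, 1:]) z')"
      if "\<forall>x\<in>#A. x \<in> R" for A
      using that
    proof (induction A)
      case (add x A)
      have "at_z [:-x, 1:] = z - \<kappa> x" "poly [:-x, 1:] z' = z' - x"
        by (simp_all add: map_poly_pCons \<kappa>.hom_zero \<kappa>.hom_uminus \<kappa>.hom_one)
      then have "at_z [:-x, 1:] \<bumpeq> \<kappa> (poly [:-x, 1:] z')" using z' add.prems by simp
      moreover have "at_z (\<Prod>x\<in>#A. [:-x, 1:]) \<bumpeq> \<kappa> (poly (\<Prod>x\<in>#A. [:-x, 1:]) z')"
        using add by simp
      ultimately show ?case
        unfolding image_mset_add_mset prod_mset.add_mset M.hom_mult poly_mult \<kappa>.hom_mult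
        by (rule C.eqv_mult)
    qed (simp add: \<kappa>.hom_one)
    moreover have "\<forall>x\<in>#A. x \<in> R" using root p by (auto simp: R_def)
    ultimately have *: "at_z (\<Prod>x\<in>#A. [:-x, 1:]) \<bumpeq> \<kappa> (poly (\<Prod>x\<in>#A. [:-x, 1:]) z')" by blast
    define Q where "Q = (\<Prod>x\<in>#A. [:-x, 1:])"
    have "at_z (smult c q) = \<kappa> c * at_z q" for c q
      by (simp add: map_poly_smult \<kappa>.hom_zero \<kappa>.hom_mult)
    then have "at_z p = \<kappa> (lead_coeff p) * at_z Q"
      using A unfolding Q_def by metis
    moreover have "\<kappa> (poly p z') = \<kappa> (lead_coeff p) * \<kappa> (poly Q z')"
      using A unfolding Q_def by (metis poly_smult \<kappa>.hom_mult)
    ultimately show ?thesis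
      using C.le_mult_left * unfolding Q_def by simp
  qed
  then show ?thesis by blast
qed

text \<open>Otherwise some \<open>t = z - r\<close> has a value outside this (divisible) value group, and
  the terms of the expansion in powers of \<open>t\<close> have pairwise different values.\<close>

lemma power_not_eqv:
  assumes t: "\<And>c. c \<noteq> 0 \<Longrightarrow> \<not> t \<bumpeq> \<kappa> c" and "n > 0" "c \<noteq> 0"
  shows "\<not> t ^ n \<bumpeq> \<kappa> c"
proof
  assume eq: "t ^ n \<bumpeq> \<kappa> c"
  obtain d where d: "d ^ n = c" using nth_root_exists[OF \<open>n > 0\<close>] by blast
  then have "d \<noteq> 0" using assms by auto
  have "t ^ n \<bumpeq> \<kappa> d ^ n" using eq d by (auto simp flip: \<kappa>.hom_power)
  then have "t \<bumpeq> \<kappa> d" by (simp only: C.power_le_iff[OF \<open>n > 0\<close>])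
  with t[OF \<open>d \<noteq> 0\<close>] show False by blast
qed

lemma monomials_not_eqv:
  assumes t: "\<And>c. c \<noteq> 0 \<Longrightarrow> \<not> t \<bumpeq> \<kappa> c" "t \<noteq> 0" and "i \<noteq> j" "a \<noteq> 0" "b \<noteq> 0"
  shows "\<not> \<kappa> a * t ^ i \<bumpeq> \<kappa> b * t ^ j"
proof -
  have *: "\<not> \<kappa> a * t ^ i \<bumpeq> \<kappa> b * t ^ j" if "i < j" "a \<noteq> 0" "b \<noteq> 0" for i j a b
  proof
    assume eq: "\<kappa> a * t ^ i \<bumpeq> \<kappa> b * t ^ j"
    have tj: "\<kappa> b * t ^ j = t ^ (j - i) * \<kappa> b * t ^ i"
      using that by (simp add: mult_ac flip: power_add)
    have "\<not> 0 \<trianglelefteq> t ^ i" using t(2) by simp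
    from C.le_mult_cancel[OF _ this, of "t ^ (j - i) * \<kappa> b" "\<kappa> a"]
      C.le_mult_cancel[OF _ this, of "\<kappa> a" "t ^ (j - i) * \<kappa> b"] eq
    have "t ^ (j - i) * \<kappa> b \<bumpeq> \<kappa> a" unfolding tj by blast
    then have "t ^ (j - i) \<bumpeq> \<kappa> a / \<kappa> b" using that by (intro C.eqv_divideI) auto
    then show False using power_not_eqv[OF t(1), of "j - i" "a / b"] that by (simp add: \<kappa>_divide)
  qed
  show ?thesis using *[of i j a b] *[of j i b a] assms by (cases "i < j") auto
qed

text \<open>Nonzero terms never tie, and a term with zero coefficient has value \<infinity>; so the
  least value is attained strictly.\<close>

lemma dominant_monomial:
  assumes t: "\<And>c. c \<noteq> 0 \<Longrightarrow> \<not> t \<bumpeq> \<kappa> c" "t \<noteq> 0" and q: "q \<noteq> 0"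
  shows "\<exists>k. poly.coeff q k \<noteq> 0 \<and> (\<forall>i\<le>Polynomial.degree q. i \<noteq> k \<longrightarrow>
    \<not> \<kappa> (poly.coeff q i) * t ^ i \<trianglelefteq> \<kappa> (poly.coeff q k) * t ^ k)"
proof -
  define S where "S = {i. i \<le> Polynomial.degree q \<and> poly.coeff q i \<noteq> 0}"
  have S: "finite S" "S \<noteq> {}" using q by (auto simp: S_def intro!: exI[of _ "Polynomial.degree q"])
  obtain k where k: "k \<in> S" "\<forall>j\<in>S. \<kappa> (poly.coeff q k) * t ^ k \<trianglelefteq> \<kappa> (poly.coeff q j) * t ^ j"
    using C.finite_min_exists[OF S, of "\<lambda>i. \<kappa> (poly.coeff q i) * t ^ i"] by blast
  have "\<not> \<kappa> (poly.coeff q i) * t ^ i \<trianglelefteq> \<kappa> (poly.coeff q k) * t ^ k"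
    if i: "i \<le> Polynomial.degree q" "i \<noteq> k" for i
  proof (cases "poly.coeff q i = 0")
    case True
    then show ?thesis using k(1) t(2) by (simp add: S_def \<kappa>.hom_zero)
  next
    case False
    then show ?thesis
      using monomials_not_eqv[OF t i(2) False, of "poly.coeff q k"] k i by (auto simp: S_def)
  qed
  with k(1) show ?thesis by (auto simp: S_def)
qed

lemma poly_eqv_dominant:
  assumes "poly.coeff q k \<noteq> 0" "s \<noteq> 0" "\<And>i. i \<le> Polynomial.degree q \<Longrightarrow> i \<noteq> k \<Longrightarrow>
    \<not> \<kappa> (poly.coeff q i) * s ^ i \<trianglelefteq> \<kappa> (poly.coeff q k) * s ^ k"
  shows "poly (map_poly \<kappa> q) s \<bumpeq> \<kappa> (poly.coeff q k) * s ^ k"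
proof -
  have "Polynomial.degree (map_poly \<kappa> q) = Polynomial.degree q"
    by (rule degree_map_poly) simp
  then have "poly (map_poly \<kappa> q) s = (\<Sum>i\<le>Polynomial.degree q. \<kappa> (poly.coeff q i) * s ^ i)"
    by (simp add: poly_altdef coeff_map_poly \<kappa>.hom_zero)
  then show ?thesis
    using assms le_degree[OF assms(1)]
      C.sum_dominated[of "{..Polynomial.degree q}" k "\<lambda>i. \<kappa> (poly.coeff q i) * s ^ i"] by simp
qed

text \<open>After cancelling a power of \<open>s\<close> and extracting a root \<open>c\<close> in
  \<open>M\<close>, a strict inequality between two monomials in \<open>s\<close> says that the
  value of \<open>s\<close> lies above, or below, that of \<open>c\<close>. At most one bound
  arises; finite sets of lower bounds \<open>Lo\<close> and upper bounds \<open>Hi\<close> are used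
  so that several inequalities combine by unions.\<close>

lemma strict_monomial_bound:
  assumes t: "t \<noteq> 0" and lt: "\<not> \<kappa> b * t ^ j \<trianglelefteq> \<kappa> a * t ^ i"
  shows "\<exists>Lo Hi. finite Lo \<and> finite Hi \<and> 0 \<notin> Lo \<and> 0 \<notin> Hi \<and> (\<forall>c\<in>Lo. \<not> t \<trianglelefteq> \<kappa> c) \<and> (\<forall>c\<in>Hi. \<not> \<kappa> c \<trianglelefteq> t) \<and>
    (\<forall>s. s \<noteq> 0 \<longrightarrow> (\<forall>c\<in>Lo. \<not> s \<trianglelefteq> \<kappa> c) \<longrightarrow> (\<forall>c\<in>Hi. \<not> \<kappa> c \<trianglelefteq> s) \<longrightarrow> \<not> \<kappa> b * s ^ j \<trianglelefteq> \<kappa> a * s ^ i)"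
    (is "\<exists>Lo Hi. ?Q Lo Hi")
proof -
  have a: "a \<noteq> 0" using lt by (auto simp: \<kappa>.hom_zero C.le_zero)
  consider (b) "b = 0" | (eq) "b \<noteq> 0" "i = j" | (lt) "b \<noteq> 0" "i < j" | (gt) "b \<noteq> 0" "j < i" by linarith
  then show ?thesis
  proof cases
    case b
    then have "?Q {} {}" using a by (auto simp: \<kappa>.hom_zero)
    then show ?thesis by blast
  next
    case eq
    have "\<not> \<kappa> b * s ^ j \<trianglelefteq> \<kappa> a * s ^ i" if "s \<noteq> 0" for s
      using lt C.vle_mult_iff[of "s ^ j" "\<kappa> b" "\<kappa> a"] C.vle_mult_iff[of "t ^ j" "\<kappa> b" "\<kappa> a"] eq(2) t that
      by simp
    then have "?Q {} {}" by simp
    then show ?thesis by blast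
  next
    case lt
    obtain c where c: "c ^ (j - i) = a / b" using nth_root_exists[of "j - i"] lt by auto
    then have c0: "c \<noteq> 0" using a lt by (auto simp: power_0_left)
    have iff: "\<not> \<kappa> b * s ^ j \<trianglelefteq> \<kappa> a * s ^ i \<longleftrightarrow> \<not> s \<trianglelefteq> \<kappa> c" if s: "s \<noteq> 0" for s
    proof -
      have sj: "\<kappa> b * s ^ j = s ^ (j - i) * \<kappa> b * s ^ i"
        using lt by (simp add: mult_ac flip: power_add)
      have "\<kappa> b * s ^ j \<trianglelefteq> \<kappa> a * s ^ i \<longleftrightarrow> s ^ (j - i) * \<kappa> b \<trianglelefteq> \<kappa> a"
        unfolding sj by (rule C.vle_mult_iff) (use s in simp)
      also have "\<dots> \<longleftrightarrow> s ^ (j - i) \<trianglelefteq> \<kappa> a / \<kappa> b"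
        using C.vle_divide_iff2 lt by simp
      also have "\<kappa> a / \<kappa> b = \<kappa> c ^ (j - i)" by (simp add: c flip: \<kappa>_divide \<kappa>.hom_power)
      also have "s ^ (j - i) \<trianglelefteq> \<kappa> c ^ (j - i) \<longleftrightarrow> s \<trianglelefteq> \<kappa> c"
        by (rule C.power_le_iff) (use lt in simp)
      finally show ?thesis by simp
    qed
    have "?Q {c} {}" using iff t c0 \<open>\<not> \<kappa> b * t ^ j \<trianglelefteq> \<kappa> a * t ^ i\<close> by auto
    then show ?thesis by blast
  next
    case gt
    obtain c where c: "c ^ (i - j) = b / a" using nth_root_exists[of "i - j"] gt by auto
    then have c0: "c \<noteq> 0" using a gt by (auto simp: power_0_left)
    have iff: "\<not> \<kappa> b * s ^ j \<trianglelefteq> \<kappa> a * s ^ i \<longleftrightarrow> \<not> \<kappa> c \<trianglelefteq> s" if s: "s \<noteq> 0" for s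
    proof -
      have si: "\<kappa> a * s ^ i = s ^ (i - j) * \<kappa> a * s ^ j"
        using gt by (simp add: mult_ac flip: power_add)
      have "\<kappa> b * s ^ j \<trianglelefteq> \<kappa> a * s ^ i \<longleftrightarrow> \<kappa> b \<trianglelefteq> s ^ (i - j) * \<kappa> a"
        unfolding si by (rule C.vle_mult_iff) (use s in simp)
      also have "\<dots> \<longleftrightarrow> \<kappa> b / \<kappa> a \<trianglelefteq> s ^ (i - j)"
        using C.vle_divide_iff a by simp
      also have "\<kappa> b / \<kappa> a = \<kappa> c ^ (i - j)" by (simp add: c flip: \<kappa>_divide \<kappa>.hom_power)
      also have "\<kappa> c ^ (i - j) \<trianglelefteq> s ^ (i - j) \<longleftrightarrow> \<kappa> c \<trianglelefteq> s"
        by (rule C.power_le_iff) (use gt in simp)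
      finally show ?thesis by simp
    qed
    have "?Q {} {c}" using iff t c0 lt by auto
    then show ?thesis by blast
  qed
qed

text \<open>The inequalities confine the value of \<open>t\<close> to an open interval whose ends,
  if any, are values of \<open>M\<close>. Being divisible, the value group of \<open>M\<close> is
  dense and so meets the interval; where a bound is missing, \<open>\<pi>\<close> serves to move
  past the other one.\<close>

lemma approximate_monomials:
  assumes t: "t \<noteq> 0" and \<pi>: "\<pi> \<noteq> 0" "\<not> \<kappa> \<pi> \<trianglelefteq> 1"
    and W: "finite W" "\<And>a i b j. (a, i, b, j) \<in> W \<Longrightarrow> \<not> \<kappa> b * t ^ j \<trianglelefteq> \<kappa> a * t ^ i"
  shows "\<exists>e. e \<noteq> 0 \<and> (\<forall>(a, i, b, j)\<in>W. \<not> \<kappa> b * \<kappa> e ^ j \<trianglelefteq> \<kappa> a * \<kappa> e ^ i)"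
proof -
  define between where "between Lo Hi s \<longleftrightarrow> (\<forall>c\<in>Lo. \<not> s \<trianglelefteq> \<kappa> c) \<and> (\<forall>c\<in>Hi. \<not> \<kappa> c \<trianglelefteq> s)" for Lo Hi s
  define holds where "holds W s \<longleftrightarrow> (\<forall>(a, i, b, j)\<in>W. \<not> \<kappa> b * s ^ j \<trianglelefteq> \<kappa> a * s ^ i)" for W s
  define good where "good Lo Hi W \<longleftrightarrow> finite Lo \<and> finite Hi \<and> 0 \<notin> Lo \<and> 0 \<notin> Hi \<and>
    between Lo Hi t \<and> (\<forall>s. s \<noteq> 0 \<longrightarrow> between Lo Hi s \<longrightarrow> holds W s)" for Lo Hi W
  have between_Un: "between (Lo \<union> Lo') (Hi \<union> Hi') s \<longleftrightarrow> between Lo Hi s \<and> between Lo' Hi' s" for Lo Lo' Hi Hi' s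
    unfolding between_def by blast
  have holds_insert: "holds (insert w W) s \<longleftrightarrow> holds {w} s \<and> holds W s" for w W s
    unfolding holds_def by simp
  have "\<exists>Lo Hi. good Lo Hi W"
    using W
  proof (induction W rule: finite_induct)
    case empty
    have "good {} {} {}" by (simp add: good_def between_def holds_def)
    then show ?case by (intro exI)
  next
    case (insert w W)
    obtain a i b j where w: "w = (a, i, b, j)" by (cases w)
    have "\<exists>Lo Hi. good Lo Hi W"
      by (rule insert.IH) (rule insert.prems, simp)
    then obtain Lo Hi where 1: "good Lo Hi W" by (elim exE)
    have "\<not> \<kappa> b * t ^ j \<trianglelefteq> \<kappa> a * t ^ i" by (rule insert.prems) (simp add: w)
    from strict_monomial_bound[OF t this] obtain Lo' Hi' where
      "finite Lo' \<and> finite Hi' \<and> 0 \<notin> Lo' \<and> 0 \<notin> Hi' \<and> (\<forall>c\<in>Lo'. \<not> t \<trianglelefteq> \<kappa> c) \<and> (\<forall>c\<in>Hi'. \<not> \<kappa> c \<trianglelefteq> t) \<and>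
       (\<forall>s. s \<noteq> 0 \<longrightarrow> (\<forall>c\<in>Lo'. \<not> s \<trianglelefteq> \<kappa> c) \<longrightarrow> (\<forall>c\<in>Hi'. \<not> \<kappa> c \<trianglelefteq> s) \<longrightarrow>
         \<not> \<kappa> b * s ^ j \<trianglelefteq> \<kappa> a * s ^ i)"
      by (elim exE)
    then have 2: "good Lo' Hi' {w}"
      unfolding good_def between_def holds_def w by blast
    have "good (Lo \<union> Lo') (Hi \<union> Hi') (insert w W)"
      unfolding good_def
    proof (intro conjI allI impI)
      show "between (Lo \<union> Lo') (Hi \<union> Hi') t"
        using 1 2 unfolding between_Un good_def by blast
      show "holds (insert w W) s" if "s \<noteq> 0" "between (Lo \<union> Lo') (Hi \<union> Hi') s" for s
        using 1 2 that unfolding between_Un holds_insert[of w W] good_def by blast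
    qed (use 1 2 in \<open>simp_all add: good_def\<close>)
    then show ?case by (intro exI)
  qed
  then obtain Lo Hi where good: "good Lo Hi W" by (elim exE)
  then have fin: "finite Lo" "finite Hi" and nz: "0 \<notin> Lo" "0 \<notin> Hi"
    and bt: "between Lo Hi t" and sound: "\<And>s. s \<noteq> 0 \<Longrightarrow> between Lo Hi s \<Longrightarrow> holds W s"
    unfolding good_def by blast+
  have Lo: "\<forall>c\<in>Lo. \<not> t \<trianglelefteq> \<kappa> c" and Hi: "\<forall>c\<in>Hi. \<not> \<kappa> c \<trianglelefteq> t"
    using bt unfolding between_def by blast+
  have up: "\<not> \<kappa> (c * \<pi>) \<trianglelefteq> \<kappa> c" if "c \<noteq> 0" for c
  proof -
    have "\<not> \<kappa> c * \<kappa> \<pi> \<trianglelefteq> \<kappa> c * 1"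
      using that \<pi>(2) by (intro C.le_mult_lt) simp_all
    then show ?thesis by (simp add: \<kappa>.hom_mult)
  qed
  have "\<exists>e. e \<noteq> 0 \<and> (\<forall>c\<in>Lo. \<not> \<kappa> e \<trianglelefteq> \<kappa> c) \<and> (\<forall>c\<in>Hi. \<not> \<kappa> c \<trianglelefteq> \<kappa> e)"
  proof (cases "Lo = {}")
    case True
    show ?thesis
    proof (cases "Hi = {}")
      case False
      then obtain h where h: "h \<in> Hi" "\<forall>c\<in>Hi. \<kappa> h \<trianglelefteq> \<kappa> c" using C.finite_min_exists[OF fin(2)] by blast
      have h0: "h \<noteq> 0" using h nz by auto
      then have "\<not> \<kappa> h \<trianglelefteq> \<kappa> (h / \<pi>)" using up[of "h / \<pi>"] \<pi> by simp
      from C.lt_le_trans[OF this] show ?thesis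
        using True h(2) h0 \<pi>(1) by (intro exI[of _ "h / \<pi>"]) simp
    qed (use True in \<open>auto intro!: exI[of _ 1]\<close>)
  next
    case False
    then obtain l where l: "l \<in> Lo" "\<forall>c\<in>Lo. \<kappa> c \<trianglelefteq> \<kappa> l" using C.finite_max_exists[OF fin(1)] by blast
    have l0: "l \<noteq> 0" using l nz by auto
    show ?thesis
    proof (cases "Hi = {}")
      case True
      then show ?thesis
        using C.le_lt_trans[OF _ up[OF l0]] l(2) l0 \<pi>(1) by (intro exI[of _ "l * \<pi>"]) simp
    next
      case False
      then obtain h where h: "h \<in> Hi" "\<forall>c\<in>Hi. \<kappa> h \<trianglelefteq> \<kappa> c" using C.finite_min_exists[OF fin(2)] by blast
      have h0: "h \<noteq> 0" using h nz by auto
      have "\<not> t \<trianglelefteq> \<kappa> l" "\<not> \<kappa> h \<trianglelefteq> t" using Lo Hi l(1) h(1) by simp_all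
      then have lh: "\<not> \<kappa> h \<trianglelefteq> \<kappa> l" by (rule C.lt_le_trans[OF _ C.lt_imp_le])
      \<comment> \<open>The value of \<open>e\<close> is the midpoint between the largest lower
        bound \<open>l\<close> and the least upper bound \<open>h\<close>.\<close>
      obtain e where e: "e ^ 2 = l * h" using nth_root_exists[of 2] by auto
      have e0: "e \<noteq> 0" using e l0 h0 by auto
      have e': "\<kappa> e * \<kappa> e = \<kappa> l * \<kappa> h" using e by (simp add: power2_eq_square flip: \<kappa>.hom_mult)
      have el: "\<not> \<kappa> e \<trianglelefteq> \<kappa> l"
      proof
        assume "\<kappa> e \<trianglelefteq> \<kappa> l"
        then have "\<kappa> l * \<kappa> h \<trianglelefteq> \<kappa> l * \<kappa> l" using C.le_mult[of "\<kappa> e" "\<kappa> l" "\<kappa> e" "\<kappa> l"] e' by simp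
        moreover have "\<not> \<kappa> l * \<kappa> h \<trianglelefteq> \<kappa> l * \<kappa> l" using lh l0 by (intro C.le_mult_lt) simp_all
        ultimately show False by blast
      qed
      have eh: "\<not> \<kappa> h \<trianglelefteq> \<kappa> e"
      proof
        assume "\<kappa> h \<trianglelefteq> \<kappa> e"
        then have "\<kappa> h * \<kappa> h \<trianglelefteq> \<kappa> l * \<kappa> h" using C.le_mult[of "\<kappa> h" "\<kappa> e" "\<kappa> h" "\<kappa> e"] e' by simp
        moreover have "\<not> \<kappa> h * \<kappa> h \<trianglelefteq> \<kappa> l * \<kappa> h" using lh h0 by (intro C.lt_mult_le) simp_all
        ultimately show False by blast
      qed
      show ?thesis
        using C.le_lt_trans[OF _ el] C.lt_le_trans[OF eh] e0 l(2) h(2) by (intro exI[of _ e]) simp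
    qed
  qed
  then obtain e where e: "e \<noteq> 0" "\<forall>c\<in>Lo. \<not> \<kappa> e \<trianglelefteq> \<kappa> c" "\<forall>c\<in>Hi. \<not> \<kappa> c \<trianglelefteq> \<kappa> e" by blast
  have "holds W (\<kappa> e)"
    by (rule sound) (use e in \<open>simp_all add: between_def\<close>)
  with e(1) show ?thesis unfolding holds_def by blast
qed

end

section \<open>Valuations close to a point of the algebraic closure\<close>

definition ac_eval :: "'k::field poly \<Rightarrow> 'k alg_closure \<Rightarrow> 'k alg_closure" where
  "ac_eval f z = poly (map_poly to_ac f) z"

definition lies_over :: "('k::field, 'g) pre_valuation \<Rightarrow> 'k alg_closure set \<Rightarrow> bool" where
  "lies_over v B \<longleftrightarrow> valuation_subring B \<and> (\<forall>a b. vle B (to_ac a) (to_ac b) \<longleftrightarrow> nle v a b)"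

lemma lies_overD:
  assumes "lies_over v B"
  shows "valuation_subring B" "vle B (to_ac a) (to_ac b) \<longleftrightarrow> nle v a b"
  using assms by (simp_all add: lies_over_def)

lemma val_equiv_restrict_iff:
  assumes "valuation v" "valuation \<nu>"
  shows "val_equiv (val_restrict \<nu>) v \<longleftrightarrow> (\<forall>a b. nle \<nu> [:a:] [:b:] \<longleftrightarrow> nle v a b)"
proof -
  have "val_equiv (val_restrict \<nu>) v \<longleftrightarrow>
    (\<forall>a b. val_less (grp \<nu>) (val \<nu> [:b:]) (val \<nu> [:a:]) \<longleftrightarrow> val_less (grp v) (val v b) (val v a))"
    by (simp add: val_equiv_def val_restrict_def)
  then show ?thesis
    unfolding val_less_iff[OF assms(1)] val_less_iff[OF assms(2)] by blast
qed

text \<open>The common source of members of \<open>extensions v\<close> below: pull a valuation ring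
  back along a homomorphism from K[x] into its field. Only the behaviour on constants has to be
  checked.\<close>

lemma extension_realize:
  fixes \<phi> :: "'k::field poly \<Rightarrow> 'a::field"
  assumes v: "valuation v" and C: "valuation_subring C" "unital_ring_hom \<phi>"
    and over: "\<And>a b. vle C (\<phi> [:a:]) (\<phi> [:b:]) \<longleftrightarrow> nle v a b"
  shows "\<exists>\<nu>\<in>extensions v. \<forall>f g. nle \<nu> f g \<longleftrightarrow> vle C (\<phi> f) (\<phi> g)"
proof -
  obtain \<nu> :: "'k poly_valuation" where \<nu>: "valuation \<nu>" "\<forall>f g. nle \<nu> f g \<longleftrightarrow> vle C (\<phi> f) (\<phi> g)"
    using valuation_realize[OF C] by metis
  then have "val_equiv (val_restrict \<nu>) v"
    using val_equiv_restrict_iff[OF v \<nu>(1)] over by simp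
  with \<nu> show ?thesis by (intro bexI[of _ \<nu>]) (simp_all add: extensions_def)
qed

lemma unital_ring_hom_map_to_ac: "unital_ring_hom (map_poly (to_ac :: 'k::field \<Rightarrow> _))"
  by (rule unital_ring_hom.map_poly_hom[OF unital_ring_hom_to_ac])

lemma degree_map_to_ac [simp]: "Polynomial.degree (map_poly to_ac p) = Polynomial.degree p"
  by (rule degree_map_poly) simp

lemma map_to_ac_eq_0_iff [simp]: "map_poly to_ac p = 0 \<longleftrightarrow> p = 0"
  by (rule map_poly_eq_0_iff) simp_all

lemma unital_ring_hom_ac_eval: "unital_ring_hom (\<lambda>f. ac_eval f z)"
  unfolding ac_eval_def
  by (rule unital_ring_hom_comp[OF unital_ring_hom_poly unital_ring_hom_map_to_ac])

lemma ac_eval_const [simp]: "ac_eval [:a:] z = to_ac a"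
  by (simp add: ac_eval_def map_poly_pCons)

lemma ex_ac_root: "\<exists>Q. Q \<noteq> 0 \<and> ac_eval Q z = 0"
  unfolding ac_eval_def by (rule alg_closure_algebraic[of z]) blast

subsection \<open>Value-transcendental valuations\<close>

text \<open>The composite of the \<open>s\<close>-adic valuation of \<open>M((s))\<close> with the valuation of \<open>M\<close>.\<close>

definition fls_composite :: "'a::field set \<Rightarrow> 'a fls set" where
  "fls_composite B = {fps_to_fls h | h. fps_nth h 0 \<in> B}"

lemma fls_composite_iff: "fps_to_fls h \<in> fls_composite B \<longleftrightarrow> fps_nth h 0 \<in> B"
  by (auto simp: fls_composite_def)

lemma valuation_subring_fls_composite:
  assumes "valuation_subring B"
  shows "valuation_subring (fls_composite B)"
proof -
  interpret valuation_subring B by fact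
  show ?thesis
  proof
    show "1 \<in> fls_composite B"
      using fls_composite_iff[of 1 B] one_mem by simp
    fix x y assume "x \<in> fls_composite B" "y \<in> fls_composite B"
    then obtain g h where gh: "x = fps_to_fls g" "y = fps_to_fls h" "fps_nth g 0 \<in> B" "fps_nth h 0 \<in> B"
      unfolding fls_composite_def by blast
    show "x + y \<in> fls_composite B"
      using fls_composite_iff[of "g + h" B] gh add_mem by simp
    show "x * y \<in> fls_composite B"
      using fls_composite_iff[of "g * h" B] gh mult_mem by (simp add: fls_times_fps_to_fls)
  next
    fix x assume "x \<in> fls_composite B"
    then obtain g where g: "x = fps_to_fls g" "fps_nth g 0 \<in> B"
      unfolding fls_composite_def by blast
    have "fps_to_fls (- g) = - fps_to_fls g"
      using fps_to_fls_plus[of g "- g"] by (simp add: eq_neg_iff_add_eq_0 add.commute)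
    then show "- x \<in> fls_composite B"
      using fls_composite_iff[of "- g" B] g uminus_mem by simp
  next
    fix x :: "'a fls"
    show "x \<in> fls_composite B \<or> inverse x \<in> fls_composite B"
    proof (cases "x = 0")
      case True
      then show ?thesis using fls_composite_iff[of 0 B] le_zero[of 1] by simp
    next
      case False
      have reg: "\<exists>g. y = fps_to_fls g \<and> fps_nth g 0 = fls_nth y 0" if "fls_subdegree y \<ge> 0" for y :: "'a fls"
        using that by (intro exI[of _ "fls_regpart y"]) simp
      \<comment> \<open>A series of positive order has constant term 0, which lies in
        \<open>B\<close>; negative order is reduced to this by inversion. For order 0 the constant
        terms of \<open>x\<close> and \<open>inverse x\<close> are inverse to each other, and
        totality of \<open>B\<close> decides.\<close>
      consider "fls_subdegree x > 0" | "fls_subdegree x < 0" | "fls_subdegree x = 0" by linarith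
      then show ?thesis
      proof cases
        case 1
        then obtain g where "x = fps_to_fls g" "fps_nth g 0 = 0" using reg[of x] by auto
        then show ?thesis using fls_composite_iff[of g B] le_zero[of 1] by simp
      next
        case 2
        then have "fls_subdegree (inverse x) > 0" by simp
        then obtain g where "inverse x = fps_to_fls g" "fps_nth g 0 = 0" using reg[of "inverse x"] by auto
        then show ?thesis using fls_composite_iff[of g B] le_zero[of 1] by simp
      next
        case 3
        then obtain g h where gh: "x = fps_to_fls g" "inverse x = fps_to_fls h"
          using reg[of x] reg[of "inverse x"] by auto
        have "fps_to_fls (g * h) = fps_to_fls 1"
          using False by (simp add: fls_times_fps_to_fls flip: gh)
        then have "g * h = 1" by (simp only: fps_to_fls_eq_iff)
        then have "fps_nth g 0 * fps_nth h 0 = 1" by (metis fps_mult_nth_0 fps_one_nth)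
        then have "fps_nth h 0 = inverse (fps_nth g 0)" by (metis inverse_unique)
        then show ?thesis using total[of "fps_nth g 0"] fls_composite_iff[of _ B] gh by metis
      qed
    qed
  qed
qed

text \<open>Here \<open>\<phi> f\<close> is \<open>f(z + s)\<close>, a power series in
  \<open>s\<close> with constant term \<open>f(z)\<close>. A comparison with
  \<open>g(z) \<noteq> 0\<close> depends only on the constant terms and is thus inherited from the
  point.\<close>

lemma value_transcendental_near_point:
  fixes v :: "('k::field, 'g) pre_valuation"
  assumes v: "valuation v" and B: "lies_over v B"
    and sat: "satisfies T (\<lambda>f g. vle B (ac_eval f z) (ac_eval g z))"
  shows "\<exists>\<nu>\<in>extensions v. value_transcendental \<nu> \<and> satisfies T (nle \<nu>)"
proof -
  interpret valuation_subring B by (rule lies_overD(1)[OF B])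
  define \<psi> where "\<psi> f = fps_of_poly (pcompose (map_poly to_ac f) [:z, 1:])" for f :: "'k poly"
  define \<phi> where "\<phi> f = fps_to_fls (\<psi> f)" for f
  have hom: "unital_ring_hom \<phi>"
  proof -
    have *: "unital_ring_hom (\<lambda>p :: 'k alg_closure poly. fps_to_fls (fps_of_poly p))"
      by unfold_locales (simp_all add: fps_of_poly_add fps_of_poly_mult fls_times_fps_to_fls)
    show ?thesis
      unfolding \<phi>_def \<psi>_def
      by (rule unital_ring_hom_comp[OF * unital_ring_hom_comp[OF unital_ring_hom_pcompose unital_ring_hom_map_to_ac]])
  qed
  interpret unital_ring_hom \<phi> by (rule hom)
  have \<psi>0: "fps_nth (\<psi> f) 0 = ac_eval f z" for f
    by (simp add: \<psi>_def pcompose_coeff_0 ac_eval_def)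
  have \<phi>_eq_0: "\<phi> f = 0 \<longleftrightarrow> f = 0" for f
  proof
    assume "\<phi> f = 0"
    then have "\<psi> f = 0" by (simp add: \<phi>_def)
    then have "pcompose (map_poly to_ac f) [:z, 1:] = 0"
      unfolding \<psi>_def using fps_of_poly_eq_iff[of _ 0] by simp
    then have "map_poly to_ac f = 0" by (rule pcompose_eq_0) simp
    then show "f = 0" by simp
  qed (simp add: hom_zero)
  let ?C = "fls_composite B"
  have C: "valuation_subring ?C" by (rule valuation_subring_fls_composite[OF lies_overD(1)[OF B]])
  interpret C: valuation_subring ?C by (rule C)
  have const: "\<phi> [:a:] = fps_to_fls (fps_const (to_ac a))" for a
    by (simp add: \<phi>_def \<psi>_def map_poly_pCons fps_of_poly_const)
  have over: "vle ?C (\<phi> [:a:]) (\<phi> [:b:]) \<longleftrightarrow> nle v a b" for a b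
  proof (cases "a = 0")
    case True
    then show ?thesis
      using lies_overD(2)[OF B, of a b] by (simp add: vle_def \<phi>_eq_0)
  next
    case False
    have "\<phi> [:b:] / \<phi> [:a:] = \<phi> [:b / a:]"
    proof -
      have "\<phi> [:b / a:] * \<phi> [:a:] = \<phi> [:b:]" using False by (simp flip: hom_mult add: mult.commute)
      then show ?thesis using False \<phi>_eq_0[of "[:a:]"] by (simp add: field_simps)
    qed
    then have "vle ?C (\<phi> [:a:]) (\<phi> [:b:]) \<longleftrightarrow> to_ac (b / a) \<in> B \<or> b = 0"
      unfolding vle_def using False fls_composite_iff[of "fps_const (to_ac (b / a))" B]
      by (auto simp: const \<phi>_eq_0 simp del: to_ac_divide)
    also have "\<dots> \<longleftrightarrow> vle B (to_ac a) (to_ac b)" using False by (auto simp: vle_def)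
    finally show ?thesis by (simp add: lies_overD(2)[OF B])
  qed
  obtain \<nu> where \<nu>: "\<nu> \<in> extensions v" and nle: "\<And>f g. nle \<nu> f g \<longleftrightarrow> vle ?C (\<phi> f) (\<phi> g)"
    using extension_realize[OF v C hom over] by metis
  \<comment> \<open>As \<open>Q\<close> vanishes at \<open>z\<close>, the series
    \<open>\<phi> Q\<close> has positive order in \<open>s\<close>; no positive power of it has the
    value of a nonzero constant, whose order is 0.\<close>
  obtain Q where Q: "Q \<noteq> 0" "ac_eval Q z = 0" using ex_ac_root by blast
  have "value_transcendental \<nu>"
  proof (rule value_transcendentalI[OF extensionsD(1)[OF \<nu>] _ Q(1)])
    show "f = 0" if "nle \<nu> 0 f" for f
      using that by (simp add: nle hom_zero \<phi>_eq_0)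
    fix n :: nat and c
    assume n: "n > 0" and le: "nle \<nu> (Q ^ n) [:c:]" "nle \<nu> [:c:] (Q ^ n)"
    have Qn: "\<phi> (Q ^ n) \<noteq> 0" using Q(1) by (simp add: \<phi>_eq_0)
    then have "c \<noteq> 0" using le(2) by (auto simp: nle hom_zero)
    have "\<phi> [:c:] / \<phi> (Q ^ n) \<in> ?C" using le(1) Qn \<open>c \<noteq> 0\<close> by (simp add: nle vle_def \<phi>_eq_0)
    then obtain h where h: "\<phi> [:c:] / \<phi> (Q ^ n) = fps_to_fls h" unfolding fls_composite_def by blast
    have "\<phi> [:c:] = fps_to_fls h * \<phi> (Q ^ n)" using Qn by (simp flip: h)
    then have "\<psi> [:c:] = h * \<psi> (Q ^ n)"
      unfolding \<phi>_def fls_times_fps_to_fls[symmetric] by (simp only: fps_to_fls_eq_iff)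
    then have "to_ac c = fps_nth h 0 * ac_eval (Q ^ n) z"
      using \<psi>0 by (metis fps_mult_nth_0 ac_eval_const)
    also have "ac_eval (Q ^ n) z = ac_eval Q z ^ n"
      by (rule unital_ring_hom.hom_power[OF unital_ring_hom_ac_eval])
    finally show False using n Q(2) \<open>c \<noteq> 0\<close> by (simp add: power_0_left)
  qed
  moreover have "satisfies T (nle \<nu>)"
    unfolding satisfies_def
  proof (intro ballI, clarify)
    fix f g assume fg: "(f, g) \<in> T"
    have g0: "ac_eval g z \<noteq> 0" and le: "vle B (ac_eval g z) (ac_eval f z)"
      using sat fg unfolding satisfies_def
      by (auto simp: unital_ring_hom.hom_zero[OF unital_ring_hom_ac_eval])
    have "g \<noteq> 0" using g0 by (auto simp: ac_eval_def)
    \<comment> \<open>With nonzero constant term \<open>g(z)\<close>, the series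
      \<open>\<psi> g\<close> is invertible as a power series, and the quotient has constant term
      \<open>f(z) / g(z)\<close>, which lies in \<open>B\<close>.\<close>
    have "\<psi> g * inverse (\<psi> g) = 1" using g0 \<psi>0[of g] by (intro inverse_mult_eq_1') simp
    then have "\<phi> g * fps_to_fls (inverse (\<psi> g)) = 1"
      by (simp add: \<phi>_def flip: fls_times_fps_to_fls)
    then have "\<phi> f / \<phi> g = fps_to_fls (\<psi> f * inverse (\<psi> g))"
      using \<phi>_eq_0[of g] \<open>g \<noteq> 0\<close> by (simp add: fls_times_fps_to_fls \<phi>_def[of f] field_simps)
    moreover have "fps_nth (\<psi> f * inverse (\<psi> g)) 0 \<in> B"
      using le g0 zero_mem by (auto simp: \<psi>0 vle_def field_simps)
    ultimately have "\<phi> f / \<phi> g \<in> ?C" by (simp add: fls_composite_iff)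
    then show "nle \<nu> g f \<and> \<not> nle \<nu> 0 g"
      using \<open>g \<noteq> 0\<close> by (simp add: nle vle_def \<phi>_eq_0 hom_zero)
  qed
  ultimately show ?thesis using \<nu> by blast
qed

subsection \<open>Residue-transcendental valuations\<close>

text \<open>The valuation ring \<open>UNIV\<close> gives the trivial valuation of K(x), whose
  residue field is K(x) itself; the residue of x is the transcendental element.\<close>

lemma residue_transcendental_trivial:
  fixes v :: "('k::field, 'g) pre_valuation"
  assumes v: "valuation v" and triv: "\<And>a b. nle v a b \<longleftrightarrow> b = 0 \<or> a \<noteq> 0"
    and T: "\<And>f g. (f, g) \<in> T \<Longrightarrow> g \<noteq> 0"
  shows "\<exists>\<nu>\<in>extensions v. residue_transcendental \<nu> \<and> satisfies T (nle \<nu>)"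
proof -
  have C: "valuation_subring (UNIV :: 'k poly fract set)" by unfold_locales simp_all
  have vle: "vle UNIV a b \<longleftrightarrow> b = 0 \<or> a \<noteq> 0" for a b :: "'k poly fract"
    by (simp add: vle_def)
  obtain \<nu> where \<nu>: "\<nu> \<in> extensions v" and nle: "\<And>f g. nle \<nu> f g \<longleftrightarrow> vle UNIV (to_fract f) (to_fract g)"
    using extension_realize[OF v C unital_ring_hom_to_fract] by (auto simp: vle triv)
  have nle: "nle \<nu> f g \<longleftrightarrow> g = 0 \<or> f \<noteq> 0" for f g by (simp add: nle vle)
  have "residue_transcendental \<nu>"
  proof (rule residue_transcendentalI[OF extensionsD(1)[OF \<nu>], of "[:0, 1:]"])
  qed (simp_all add: nle)
  moreover have "satisfies T (nle \<nu>)"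
    using T by (auto simp: satisfies_def nle)
  ultimately show ?thesis using \<nu> by blast
qed

section \<open>Gauss's lemma and the Gauss extension\<close>

context valuation_subring
begin

definition int_poly :: "'a poly \<Rightarrow> bool" where
  "int_poly p \<longleftrightarrow> (\<forall>i. poly.coeff p i \<in> B)"

definition max_poly :: "'a poly \<Rightarrow> bool" where
  "max_poly p \<longleftrightarrow> (\<forall>i. in_max (poly.coeff p i))"

lemma in_max_mult: "in_max a \<Longrightarrow> b \<in> B \<Longrightarrow> in_max (a * b)"
  using lt_mult_le[of a 1 1 b] by simp

lemma in_max_mult': "a \<in> B \<Longrightarrow> in_max b \<Longrightarrow> in_max (a * b)"
  using in_max_mult[of b a] by (simp add: mult.commute)

lemma in_max_sum: "(\<And>i. i \<in> S \<Longrightarrow> in_max (f i)) \<Longrightarrow> in_max (sum f S)"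
  by (rule lt_sum) simp_all

lemma in_max_imp_mem: "in_max a \<Longrightarrow> a \<in> B"
  using max_ideal_subset by blast

lemma sum_mem: "(\<And>i. i \<in> S \<Longrightarrow> f i \<in> B) \<Longrightarrow> sum f S \<in> B"
  using le_sum[of S 1 f] by simp

lemma max_poly_imp_int_poly: "max_poly p \<Longrightarrow> int_poly p"
  using in_max_imp_mem by (simp add: max_poly_def int_poly_def)

lemma int_poly_mult: "int_poly p \<Longrightarrow> int_poly q \<Longrightarrow> int_poly (p * q)"
  by (simp add: int_poly_def coeff_mult sum_mem mult_mem)

lemma max_poly_mult: "int_poly p \<Longrightarrow> max_poly q \<Longrightarrow> max_poly (p * q)"
  unfolding int_poly_def max_poly_def coeff_mult by (intro allI in_max_sum in_max_mult') simp_all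

lemma int_poly_add: "int_poly p \<Longrightarrow> int_poly q \<Longrightarrow> int_poly (p + q)"
  by (simp add: int_poly_def add_mem)

lemma max_poly_add: "max_poly p \<Longrightarrow> max_poly q \<Longrightarrow> max_poly (p + q)"
  unfolding max_poly_def coeff_add using lt_add by blast

lemma int_poly_const: "a \<in> B \<Longrightarrow> int_poly [:a:]"
  by (simp add: int_poly_def coeff_pCons zero_mem split: nat.split)

lemma max_poly_const: "in_max a \<Longrightarrow> max_poly [:a:]"
  by (simp add: max_poly_def coeff_pCons split: nat.split)

lemma int_poly_one: "int_poly 1"
  using int_poly_const[OF one_mem] by (simp add: one_pCons)

lemma not_max_poly_one: "\<not> max_poly 1"
  using le_refl[of 1] by (auto simp: max_poly_def intro!: exI[of _ 0])

lemma gauss_lemma: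
  assumes p: "int_poly p" and q: "int_poly q" and pq: "max_poly (p * q)"
  shows "max_poly p \<or> max_poly q"
proof (rule ccontr)
  assume "\<not> (max_poly p \<or> max_poly q)"
  then have ex: "\<exists>i. \<not> in_max (poly.coeff p i)" "\<exists>j. \<not> in_max (poly.coeff q j)"
    by (simp_all add: max_poly_def)
  \<comment> \<open>The lowest coefficients that are units. In coefficient \<open>i + j\<close> of
    the product every summand except the one at \<open>i\<close> contains a lower coefficient of
    \<open>p\<close> or of \<open>q\<close> and lies in the maximal ideal.\<close>
  define i j where "i = (LEAST i. \<not> in_max (poly.coeff p i))" and "j = (LEAST j. \<not> in_max (poly.coeff q j))"
  have i: "\<not> in_max (poly.coeff p i)" and j: "\<not> in_max (poly.coeff q j)"
    unfolding i_def j_def by (rule LeastI_ex[OF ex(1)], rule LeastI_ex[OF ex(2)])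
  have min: "in_max (poly.coeff p k)" if "k < i" for k using not_less_Least that unfolding i_def by blast
  have min': "in_max (poly.coeff q k)" if "k < j" for k using not_less_Least that unfolding j_def by blast
  have "in_max (\<Sum>k\<in>{..i + j} - {i}. poly.coeff p k * poly.coeff q (i + j - k))"
  proof (rule in_max_sum)
    fix k assume k: "k \<in> {..i + j} - {i}"
    show "in_max (poly.coeff p k * poly.coeff q (i + j - k))"
    proof (cases "k < i")
      case True
      then show ?thesis using min q by (intro in_max_mult) (simp_all add: int_poly_def)
    next
      case False
      with k have "i + j - k < j" by auto
      then show ?thesis using min' p by (intro in_max_mult') (simp_all add: int_poly_def)
    qed
  qed
  moreover have "in_max (poly.coeff (p * q) (i + j))" using pq by (simp add: max_poly_def)
  moreover have "poly.coeff (p * q) (i + j) = poly.coeff p i * poly.coeff q j +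
      (\<Sum>k\<in>{..i + j} - {i}. poly.coeff p k * poly.coeff q (i + j - k))"
    unfolding coeff_mult by (subst sum.remove[of _ i]) auto
  ultimately have "in_max (poly.coeff p i * poly.coeff q j)"
    using lt_diff[of "poly.coeff (p * q) (i + j)" 1
      "\<Sum>k\<in>{..i + j} - {i}. poly.coeff p k * poly.coeff q (i + j - k)"] by simp
  moreover have "poly.coeff p i * poly.coeff q j \<in> B" "vle B (poly.coeff p i * poly.coeff q j) (1 * 1)"
    using i j p q le_mult[of "poly.coeff p i" 1 "poly.coeff q j" 1] by (simp_all add: int_poly_def mult_mem)
  ultimately show False by simp
qed

lemma int_poly_pConsD:
  assumes "int_poly (pCons c P)"
  shows "c \<in> B" "int_poly P"
proof -
  have *: "poly.coeff (pCons c P) i \<in> B" for i using assms by (simp add: int_poly_def)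
  show "c \<in> B" using *[of 0] by simp
  show "int_poly P" unfolding int_poly_def
  proof
    fix i show "poly.coeff P i \<in> B" using *[of "Suc i"] by simp
  qed
qed

lemma int_poly_pcompose:
  assumes "int_poly P" "int_poly U"
  shows "int_poly (pcompose P U)"
  using assms(1)
proof (induction P)
  case (pCons c P)
  show ?case
    unfolding pcompose_pCons
    using int_poly_pConsD[OF pCons.prems] pCons.IH assms(2)
    by (intro int_poly_add int_poly_mult int_poly_const) simp_all
qed (simp add: int_poly_def zero_mem)

text \<open>The residue of \<open>U\<close> is a nonconstant polynomial, hence transcendental over the residue field.\<close>

lemma max_poly_pcompose_cancel:
  assumes U: "int_poly U" "\<not> max_poly U" "poly.coeff U 0 = 0"
    and P: "int_poly P" "max_poly (pcompose P U)"
  shows "max_poly P"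
  using P
proof (induction P)
  case (pCons c P)
  have P: "int_poly P" using pCons.prems(1) by (rule int_poly_pConsD)
  have comp: "int_poly (pcompose P U)" by (rule int_poly_pcompose[OF P U(1)])
  have eq: "pcompose (pCons c P) U = [:c:] + U * pcompose P U" by (rule pcompose_pCons)
  \<comment> \<open>As \<open>U\<close> has no constant term, the constant coefficient of the
    composition is \<open>c\<close>. Removing it leaves a multiple of \<open>U\<close>, and Gauss's
    lemma cancels \<open>U\<close>.\<close>
  have "in_max (poly.coeff (pcompose (pCons c P) U) 0)"
    using pCons.prems(2) unfolding max_poly_def by blast
  then have c: "in_max c" unfolding eq by (simp add: coeff_mult U(3))
  have "U * pcompose P U = pcompose (pCons c P) U + [:- c:]" unfolding eq by simp
  then have "max_poly (U * pcompose P U)"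
    using max_poly_add[OF pCons.prems(2) max_poly_const[of "- c"]] c by simp
  then have "max_poly P" using gauss_lemma[OF U(1) comp] U(2) pCons.IH[OF P] by blast
  with c show ?case by (simp add: max_poly_def coeff_pCons split: nat.split)
qed (simp add: max_poly_def)

text \<open>Any valuation ring dominating \<open>B[y]\<close> localized at \<open>\<mm>[y]\<close> has this property, so the
  Gauss norm itself is not needed.\<close>

theorem gauss_extension:
  obtains C :: "'a poly fract set" where "valuation_subring C"
    and "\<And>a b. vle C (to_fract [:a:]) (to_fract [:b:]) \<longleftrightarrow> vle B a b"
    and "\<And>p. int_poly p \<Longrightarrow> to_fract p \<in> C"
    and "\<And>p. int_poly p \<Longrightarrow> vle C (to_fract p) 1 \<longleftrightarrow> \<not> max_poly p"
proof -
  define A where "A = {to_fract p / to_fract q | p q. int_poly p \<and> int_poly q \<and> \<not> max_poly q}"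
  define I where "I = {to_fract p / to_fract q | p q. max_poly p \<and> int_poly q \<and> \<not> max_poly q}"
  have A: "to_fract p / to_fract q \<in> A" if "int_poly p" "int_poly q" "\<not> max_poly q" for p q
    using that unfolding A_def by blast
  have I: "to_fract p / to_fract q \<in> I" if "max_poly p" "int_poly q" "\<not> max_poly q" for p q
    using that unfolding I_def by blast
  have nz: "q \<noteq> 0" if "\<not> max_poly q" for q using that by (auto simp: max_poly_def)
  have prim: "int_poly (q * q') \<and> \<not> max_poly (q * q')"
    if "int_poly q" "\<not> max_poly q" "int_poly q'" "\<not> max_poly q'" for q q'
    using that int_poly_mult gauss_lemma by blast
  have plus: "to_fract p / to_fract q + to_fract p' / to_fract q' = to_fract (q' * p + q * p') / to_fract (q * q')"
    if "\<not> max_poly q" "\<not> max_poly q'" for p q p' q'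
    using nz[OF that(1)] nz[OF that(2)] by (simp add: field_simps)
  have AI: "subring_ideal A I"
    unfolding subring_ideal_def
  proof (intro conjI ballI)
    show "1 \<in> A" using A[OF int_poly_one int_poly_one not_max_poly_one] by simp
    have "max_poly 0" by (simp add: max_poly_def)
    from I[OF this int_poly_one not_max_poly_one] show "0 \<in> I" by simp
    show "I \<subseteq> A"
    proof
      fix x assume "x \<in> I"
      then obtain p q where "x = to_fract p / to_fract q" "max_poly p" "int_poly q" "\<not> max_poly q"
        unfolding I_def by blast
      then show "x \<in> A" using A[OF max_poly_imp_int_poly] by simp
    qed
    fix x y assume "x \<in> A" "y \<in> A"
    then obtain p q p' q' where *: "x = to_fract p / to_fract q" "y = to_fract p' / to_fract q'"
      "int_poly p" "int_poly q" "\<not> max_poly q" "int_poly p'" "int_poly q'" "\<not> max_poly q'"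
      unfolding A_def by blast
    have pr: "int_poly (q * q')" "\<not> max_poly (q * q')" using prim[OF *(4,5,7,8)] by blast+
    show "x + y \<in> A"
      unfolding *(1,2) plus[OF *(5,8)]
      by (intro A pr int_poly_add int_poly_mult *(3,4,6,7))
    show "x * y \<in> A"
      using A[OF int_poly_mult[OF *(3,6)] pr] *(1,2) by simp
  next
    fix x assume "x \<in> A"
    then obtain p q where *: "x = to_fract p / to_fract q" "int_poly p" "int_poly q" "\<not> max_poly q"
      unfolding A_def by blast
    have "int_poly (- p)" using *(2) by (simp add: int_poly_def uminus_mem)
    from A[OF this *(3,4)] show "- x \<in> A" by (simp add: *(1))
  next
    fix x y assume "x \<in> I" "y \<in> I"
    then obtain p q p' q' where *: "x = to_fract p / to_fract q" "y = to_fract p' / to_fract q'"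
      "max_poly p" "int_poly q" "\<not> max_poly q" "max_poly p'" "int_poly q'" "\<not> max_poly q'"
      unfolding I_def by blast
    have pr: "int_poly (q * q')" "\<not> max_poly (q * q')" using prim[OF *(4,5,7,8)] by blast+
    show "x + y \<in> I"
      unfolding *(1,2) plus[OF *(5,8)]
      by (intro I pr max_poly_add max_poly_mult *(3,4,6,7))
  next
    fix x y assume "x \<in> A" "y \<in> I"
    then obtain p q p' q' where *: "x = to_fract p / to_fract q" "y = to_fract p' / to_fract q'"
      "int_poly p" "int_poly q" "\<not> max_poly q" "max_poly p'" "int_poly q'" "\<not> max_poly q'"
      unfolding A_def I_def by blast
    have pr: "int_poly (q * q')" "\<not> max_poly (q * q')" using prim[OF *(4,5,7,8)] by blast+
    show "x * y \<in> I"
      using I[OF max_poly_mult[OF *(3,6)] pr] *(1,2) by simp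
  qed
  have "1 \<notin> I"
  proof
    assume "1 \<in> I"
    then obtain p q where *: "1 = to_fract p / to_fract q" "max_poly p" "\<not> max_poly q"
      unfolding I_def by blast
    have "to_fract p = to_fract q" using *(1) nz[OF *(3)] by (simp add: field_simps)
    then show False using * by simp
  qed
  then obtain C where C: "valuation_subring C" "A \<subseteq> C" "\<forall>a\<in>I. \<not> vle C a 1"
    using exists_dominating_valuation_subring[OF AI] by blast
  interpret C: valuation_subring C by (rule C(1))
  have int: "to_fract p \<in> C" if "int_poly p" for p
    using A[OF that int_poly_one not_max_poly_one] C(2) by auto
  have unit: "vle C (to_fract p) 1 \<longleftrightarrow> \<not> max_poly p" if "int_poly p" for p
  proof
    assume "\<not> max_poly p"
    then have "1 / to_fract p \<in> C" using A[OF int_poly_one that] C(2) by auto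
    then show "vle C (to_fract p) 1" using nz[OF \<open>\<not> max_poly p\<close>] by (simp add: vle_def)
  next
    assume le: "vle C (to_fract p) 1"
    show "\<not> max_poly p"
    proof
      assume "max_poly p"
      then have "\<not> vle C (to_fract p / to_fract 1) 1"
        using C(3) I[OF _ int_poly_one not_max_poly_one] by blast
      with le show False by simp
    qed
  qed
  have over: "vle C (to_fract [:a:]) (to_fract [:b:]) \<longleftrightarrow> vle B a b" for a b
  proof (cases "a = 0 \<or> b = 0")
    case True
    then show ?thesis by (auto simp: vle_def)
  next
    case False
    have div: "to_fract [:c:] / to_fract [:d:] = to_fract [:c / d:]" if "d \<noteq> 0" for c d :: 'a
    proof -
      have "[:c / d:] * [:d:] = [:c:]" using that by simp
      then have "to_fract [:c / d:] * to_fract [:d:] = to_fract [:c:]" by (simp flip: to_fract_mult)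
      then show ?thesis using that by (simp add: field_simps)
    qed
    show ?thesis
    proof
      assume "vle B a b"
      then have "int_poly [:b / a:]" using False by (intro int_poly_const) (simp add: vle_def)
      then show "vle C (to_fract [:a:]) (to_fract [:b:])"
        using int False div[of a b] by (simp add: vle_def)
    next
      assume le: "vle C (to_fract [:a:]) (to_fract [:b:])"
      show "vle B a b"
      proof (rule ccontr)
        assume "\<not> vle B a b"
        then have "in_max (a / b)" using vle_divide_iff[of b a 1] False by simp
        then have m: "max_poly [:a / b:]" by (rule max_poly_const)
        then have "\<not> vle C (to_fract [:a / b:]) 1" using unit max_poly_imp_int_poly by blast
        then have "\<not> vle C (to_fract [:a:] / to_fract [:b:]) 1" using div[of b a] False by simp
        then show False using le C.vle_divide_iff[of "to_fract [:b:]" "to_fract [:a:]" 1] False by simp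
      qed
    qed
  qed
  show thesis by (rule that[OF C(1) over int unit])
qed

end

section \<open>Residue-transcendental perturbation of a point\<close>

lemma lies_over_torsion:
  assumes "lies_over v B" "c \<noteq> 0"
  shows "\<exists>n>0. \<exists>d. d \<noteq> 0 \<and> vle B (c ^ n) (to_ac d) \<and> vle B (to_ac d) (c ^ n)"
proof -
  obtain p where "p \<noteq> 0" "poly (map_poly to_ac p) c = 0" by (rule alg_closure_algebraic)
  from valuation_subring.algebraic_torsion[OF lies_overD(1)[OF assms(1)] unital_ring_hom_to_ac this assms(2)]
  show ?thesis .
qed

text \<open>The values of \<open>K\<close> are cofinal in those of \<open>M\<close>. If
  \<open>d\<close> has positive value, some power \<open>d ^ n\<close> has the value of a constant,
  and this is at least the value of \<open>d\<close>; a factor \<open>\<pi>\<close> makes the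
  inequality strict. Several \<open>d\<close> are treated by multiplying the constants found, all of
  them integral.\<close>

lemma small_constant:
  fixes v :: "('k::field, 'g) pre_valuation"
  assumes B: "lies_over v B" and \<pi>: "\<pi> \<noteq> 0" "\<not> vle B (to_ac \<pi>) 1" and D: "finite D" "0 \<notin> D"
  shows "\<exists>e. e \<noteq> 0 \<and> to_ac e \<in> B \<and> (\<forall>d\<in>D. \<not> vle B (to_ac e) d)"
proof -
  interpret valuation_subring B by (rule lies_overD(1)[OF B])
  have \<pi>B: "to_ac \<pi> \<in> B" by (rule in_max_imp_mem[OF \<pi>(2)])
  have single: "\<exists>e. e \<noteq> 0 \<and> to_ac e \<in> B \<and> \<not> vle B (to_ac e) d" if "d \<noteq> 0" for d
  proof (cases "vle B d 1")
    case True
    then show ?thesis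
      using \<pi> \<pi>B le_lt_trans[OF True \<pi>(2)] by (intro exI[of _ \<pi>]) simp
  next
    case False
    then have dB: "d \<in> B" by (rule in_max_imp_mem)
    from lies_over_torsion[OF B that]
    obtain n c where n: "n > 0" and c: "c \<noteq> 0" "vle B (d ^ n) (to_ac c)" by blast
    obtain m where m: "n = Suc m" using n by (cases n) auto
    have "d ^ m \<in> B" using le_power[of 1 d m] dB by simp
    then have "vle B (d * 1) (d ^ n)" unfolding m power_Suc by (intro le_mult_left) simp
    then have dc: "vle B d (to_ac c)" using le_trans[OF _ c(2)] by simp
    have "\<not> vle B (to_ac c * to_ac \<pi>) (to_ac c * 1)" using c(1) \<pi>(2) by (intro le_mult_lt) simp_all
    then have "\<not> vle B (to_ac (c * \<pi>)) d" using le_lt_trans[OF dc] by simp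
    moreover have "to_ac (c * \<pi>) \<in> B"
      using mult_mem[OF _ \<pi>B, of "to_ac c"] le_trans[of 1 d "to_ac c"] dc dB by simp
    ultimately show ?thesis using c(1) \<pi>(1) by (intro exI[of _ "c * \<pi>"]) simp
  qed
  show ?thesis
    using D
  proof (induction D rule: finite_induct)
    case empty
    show ?case using one_mem by (intro exI[of _ 1]) simp
  next
    case (insert d D)
    then obtain e where e: "e \<noteq> 0" "to_ac e \<in> B" "\<forall>d\<in>D. \<not> vle B (to_ac e) d" by auto
    obtain e' where e': "e' \<noteq> 0" "to_ac e' \<in> B" "\<not> vle B (to_ac e') d"
      using single[of d] insert.prems by auto
    have l: "vle B (to_ac e) (to_ac (e * e'))" "vle B (to_ac e') (to_ac (e * e'))"
      using le_mult_left[of 1 "to_ac e'" "to_ac e"] le_mult_right[of 1 "to_ac e" "to_ac e'"] e(2) e'(2)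
      by simp_all
    have "\<not> vle B (to_ac (e * e')) d" by (rule lt_le_trans[OF e'(3) l(2)])
    moreover have "\<not> vle B (to_ac (e * e')) d'" if "d' \<in> D" for d'
      using lt_le_trans[OF _ l(1)] e(3) that by blast
    moreover have "to_ac (e * e') \<in> B" using mult_mem[OF e(2) e'(2)] by simp
    ultimately show ?case using e(1) e'(1) by (intro exI[of _ "e * e'"]) simp
  qed
qed

text \<open>Here \<open>\<tau> f\<close> is \<open>f(z + e y)\<close>, valued by the Gauss
  extension, and \<open>e\<close> is so small that the constant term of \<open>g(z + e y)\<close>
  dominates the other terms of both polynomials.\<close>

lemma residue_transcendental_near_point:
  fixes v :: "('k::field, 'g) pre_valuation"
  assumes v: "valuation v" and B: "lies_over v B" and \<pi>: "\<pi> \<noteq> 0" "\<not> nle v \<pi> 1"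
    and T: "finite T" and sat: "satisfies T (\<lambda>f g. vle B (ac_eval f z) (ac_eval g z))"
  shows "\<exists>\<nu>\<in>extensions v. residue_transcendental \<nu> \<and> satisfies T (nle \<nu>)"
proof -
  interpret valuation_subring B by (rule lies_overD(1)[OF B])
  have \<pi>': "\<not> vle B (to_ac \<pi>) 1" using \<pi>(2) lies_overD(2)[OF B, of \<pi> 1] by simp
  define h where "h f = pcompose (map_poly to_ac f) [:z, 1:]" for f :: "'k poly"
  have h_hom: "unital_ring_hom h"
    unfolding h_def by (rule unital_ring_hom_comp[OF unital_ring_hom_pcompose unital_ring_hom_map_to_ac])
  have h0: "poly.coeff (h f) 0 = ac_eval f z" for f
    by (simp add: h_def pcompose_coeff_0 ac_eval_def)
  have h_eq_0: "h f = 0 \<longleftrightarrow> f = 0" for f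
    unfolding h_def by (subst pcompose_eq_0_iff) simp_all
  \<comment> \<open>If the value of \<open>e\<close> exceeds that of \<open>g(z) / a\<close> for
    every nonzero coefficient \<open>a\<close>, then the terms \<open>e ^ i * a\<close> with
    \<open>i > 0\<close> have larger value than \<open>g(z)\<close>. The sum of the degrees is a
    common bound for the indices; zero coefficients yield the quotient 0, which is removed.\<close>
  define D where "D = (\<Union>(f, g)\<in>T. (\<lambda>(p, i). ac_eval g z / poly.coeff p i) `
    ({h f, h g} \<times> {..Polynomial.degree (h f) + Polynomial.degree (h g)})) - {0}"
  have "finite D" unfolding D_def using T by auto
  then obtain e where e: "e \<noteq> 0" "to_ac e \<in> B" "\<forall>d\<in>D. \<not> vle B (to_ac e) d"
    using small_constant[OF B \<pi>(1) \<pi>', of D] by (auto simp: D_def)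
  define \<tau> where "\<tau> f = pcompose (h f) [:0, to_ac e:]" for f
  define \<phi> where "\<phi> f = to_fract (\<tau> f)" for f
  have \<tau>_hom: "unital_ring_hom \<tau>"
    unfolding \<tau>_def by (rule unital_ring_hom_comp[OF unital_ring_hom_pcompose h_hom])
  have \<phi>_hom: "unital_ring_hom \<phi>"
    unfolding \<phi>_def by (rule unital_ring_hom_comp[OF unital_ring_hom_to_fract \<tau>_hom])
  interpret \<tau>: unital_ring_hom \<tau> by (rule \<tau>_hom)
  interpret \<phi>: unital_ring_hom \<phi> by (rule \<phi>_hom)
  have coeff_\<tau>: "poly.coeff (\<tau> f) i = to_ac e ^ i * poly.coeff (h f) i" for f i
    by (simp add: \<tau>_def coeff_pcompose_linear)
  have \<tau>_const: "\<tau> [:a:] = [:to_ac a:]" for a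
    by (simp add: \<tau>_def h_def map_poly_pCons)
  have \<tau>_eq_0: "\<tau> f = 0 \<longleftrightarrow> f = 0" for f
    unfolding \<tau>_def using e(1) by (subst pcompose_eq_0_iff) (simp_all add: h_eq_0)
  obtain C :: "'k alg_closure poly fract set" where C: "valuation_subring C"
    and over: "\<And>a b. vle C (to_fract [:a:]) (to_fract [:b:]) \<longleftrightarrow> vle B a b"
    and int: "\<And>p. int_poly p \<Longrightarrow> to_fract p \<in> C"
    and unit: "\<And>p. int_poly p \<Longrightarrow> vle C (to_fract p) 1 \<longleftrightarrow> \<not> max_poly p"
    using gauss_extension by metis
  interpret C: valuation_subring C by (rule C)
  have "vle C (\<phi> [:a:]) (\<phi> [:b:]) \<longleftrightarrow> nle v a b" for a b
    by (simp add: \<phi>_def \<tau>_const over lies_overD(2)[OF B])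
  then obtain \<nu> where \<nu>: "\<nu> \<in> extensions v" and nle: "\<And>f g. nle \<nu> f g \<longleftrightarrow> vle C (\<phi> f) (\<phi> g)"
    using extension_realize[OF v C \<phi>_hom] by metis
  have nle_const: "nle \<nu> [:a:] [:b:] \<longleftrightarrow> vle B (to_ac a) (to_ac b)" for a b
    by (simp add: nle \<phi>_def \<tau>_const over)
  have supp: "f = 0" if "nle \<nu> 0 f" for f
    using that by (simp add: nle \<phi>_def \<tau>_eq_0 \<tau>.hom_zero)
  have "satisfies T (nle \<nu>)"
    unfolding satisfies_def
  proof (intro ballI, clarify)
    fix f g assume fg: "(f, g) \<in> T"
    define c where "c = ac_eval g z"
    have c: "c \<noteq> 0" and le: "vle B c (ac_eval f z)"
      using sat fg unfolding satisfies_def c_def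
      by (auto simp: unital_ring_hom.hom_zero[OF unital_ring_hom_ac_eval])
    have small: "in_max (to_ac e ^ i * poly.coeff p i / c)" if p: "p \<in> {h f, h g}" and i: "i > 0" for p i
    proof (cases "poly.coeff p i = 0")
      case False
      define d where "d = poly.coeff p i"
      have d: "d \<noteq> 0" using False by (simp add: d_def)
      have "i \<le> Polynomial.degree (h f) + Polynomial.degree (h g)"
        using le_degree[OF False] p by auto
      then have "(p, i) \<in> {h f, h g} \<times> {..Polynomial.degree (h f) + Polynomial.degree (h g)}"
        using p by simp
      then have "c / d \<in> (\<lambda>(p, i). ac_eval g z / poly.coeff p i) `
          ({h f, h g} \<times> {..Polynomial.degree (h f) + Polynomial.degree (h g)})"
        by (rule rev_image_eqI) (simp add: c_def d_def)
      then have "c / d \<in> (\<Union>(f, g)\<in>T. (\<lambda>(p, i). ac_eval g z / poly.coeff p i) `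
          ({h f, h g} \<times> {..Polynomial.degree (h f) + Polynomial.degree (h g)}))"
        by (intro UN_I[OF fg]) simp
      then have "c / d \<in> D" unfolding D_def using c d by simp
      then have "\<not> vle B (to_ac e) (c / d)" using e(3) by blast
      then have "\<not> vle B (to_ac e * d) c" using vle_divide_iff2[OF d] by simp
      then have ed: "in_max (to_ac e * d / c)" using vle_divide_iff[OF c, of "to_ac e * d" 1] by simp
      obtain j where j: "i = Suc j" using i by (cases i) auto
      have "to_ac e ^ j \<in> B" using le_power[of 1 "to_ac e" j] e(2) by simp
      from in_max_mult'[OF this ed] show ?thesis by (simp add: j d_def mult_ac)
    qed simp
    have coeffs: "int_poly (smult (1 / c) (\<tau> k))" if "k = f \<or> k = g" for k
      unfolding int_poly_def
    proof
      fix i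
      show "poly.coeff (smult (1 / c) (\<tau> k)) i \<in> B"
      proof (cases "i = 0")
        case True
        have "vle B c (ac_eval k z)" using that le by (auto simp: c_def)
        then show ?thesis
          using True c vle_divide_iff2[OF c, of 1 "ac_eval k z"] by (simp add: coeff_\<tau> h0)
      next
        case False
        then show ?thesis
          using small[of "h k" i] that in_max_imp_mem by (auto simp: coeff_\<tau>)
      qed
    qed
    \<comment> \<open>Divided by \<open>g(z)\<close>, both polynomials are integral, and that of
      \<open>g\<close> has constant coefficient 1, hence value 0. So \<open>g\<close> keeps the
      value of \<open>g(z)\<close>, and \<open>f\<close> has at least this value.\<close>
    have "poly.coeff (smult (1 / c) (\<tau> g)) 0 = 1" using c by (simp add: coeff_\<tau> h0 c_def)
    then have nmax: "\<not> max_poly (smult (1 / c) (\<tau> g))"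
      unfolding max_poly_def using le_refl[of 1] by metis
    have scale: "\<phi> k = to_fract [:c:] * to_fract (smult (1 / c) (\<tau> k))" for k
    proof -
      have "\<tau> k = [:c:] * smult (1 / c) (\<tau> k)" using c by simp
      then show ?thesis unfolding \<phi>_def by (metis to_fract_mult)
    qed
    have "vle C (to_fract (smult (1 / c) (\<tau> g))) 1" using unit coeffs nmax by simp
    moreover have "vle C 1 (to_fract (smult (1 / c) (\<tau> f)))" using int coeffs by simp
    ultimately have "vle C (to_fract (smult (1 / c) (\<tau> g))) (to_fract (smult (1 / c) (\<tau> f)))"
      by (rule C.le_trans)
    then have "nle \<nu> g f" unfolding nle scale by (rule C.le_mult_left)
    moreover have "g \<noteq> 0" using c by (auto simp: c_def ac_eval_def)
    ultimately show "nle \<nu> g f \<and> \<not> nle \<nu> 0 g" using supp by blast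
  qed
  moreover have "residue_transcendental \<nu>"
  proof -
    \<comment> \<open>As \<open>Q\<close> vanishes at \<open>z\<close>, its image
      \<open>\<tau> Q\<close> has no constant term. Divided by a coefficient \<open>c\<close> of
      least value it becomes integral with nonconstant residue, as
      \<open>max_poly_pcompose_cancel\<close> demands.\<close>
    obtain Q where Q: "Q \<noteq> 0" "ac_eval Q z = 0" using ex_ac_root by blast
    define p where "p = \<tau> Q"
    have p: "p \<noteq> 0" "poly.coeff p 0 = 0" using Q by (simp_all add: p_def \<tau>_eq_0 coeff_\<tau> h0)
    obtain k where k: "k \<le> Polynomial.degree p" "\<forall>i\<le>Polynomial.degree p. vle B (poly.coeff p k) (poly.coeff p i)"
      using finite_min_exists[of "{..Polynomial.degree p}" "poly.coeff p"] by auto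
    define c where "c = poly.coeff p k"
    have c: "c \<noteq> 0"
      using k(2) p(1) leading_coeff_0_iff[of p] by (auto simp: c_def dest!: spec[of _ "Polynomial.degree p"])
    define q where "q = smult (1 / c) p"
    have q: "int_poly q" "\<not> max_poly q" "poly.coeff q 0 = 0"
    proof -
      have "vle B c (poly.coeff p i)" for i
        using k(2) le_zero[of c] coeff_eq_0[of p i] by (cases "i \<le> Polynomial.degree p") (auto simp: c_def)
      then show "int_poly q"
        using vle_divide_iff2[OF c, of 1] by (simp add: q_def int_poly_def)
      have "poly.coeff q k = 1" using c by (simp add: q_def c_def)
      then show "\<not> max_poly q" unfolding max_poly_def using le_refl[of 1] by metis
    qed (simp add: q_def p)
    \<comment> \<open>The factor \<open>c\<close> lies in \<open>M\<close>, whereas the criterion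
      asks for some \<open>u\<close> in K[x]. A power of \<open>c\<close> has the value of a
      constant \<open>d\<close> of \<open>K\<close>, so \<open>Q ^ m\<close> may be divided by
      \<open>d\<close> instead, at the cost of the unit \<open>\<eta>\<close>.\<close>
    obtain m d where m: "m > 0" and d: "d \<noteq> 0" "vle B (c ^ m) (to_ac d)" "vle B (to_ac d) (c ^ m)"
      using lies_over_torsion[OF B c] by blast
    define \<eta> where "\<eta> = c ^ m / to_ac d"
    have \<eta>: "\<eta> \<in> B" "vle B \<eta> 1"
      using d vle_divide_iff2[of "to_ac d" 1 "c ^ m"] vle_divide_iff[of "to_ac d" "c ^ m" 1]
      by (simp_all add: \<eta>_def)
    define u where "u = smult (1 / d) (Q ^ m)"
    have \<tau>u: "\<tau> u = [:\<eta>:] * q ^ m"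
    proof -
      have "u = [:1 / d:] * Q ^ m" by (simp add: u_def)
      then have "\<tau> u = [:to_ac (1 / d):] * p ^ m"
        by (simp only: \<tau>.hom_mult \<tau>.hom_power \<tau>_const p_def)
      moreover have "p = smult c q" using c by (simp add: q_def)
      ultimately show ?thesis by (simp add: smult_power \<eta>_def)
    qed
    have qm: "int_poly (q ^ n) \<and> \<not> max_poly (q ^ n)" for n
      using q(1,2) int_poly_one not_max_poly_one int_poly_mult gauss_lemma by (induction n) auto
    have U: "int_poly (\<tau> u)" "\<not> max_poly (\<tau> u)" "poly.coeff (\<tau> u) 0 = 0"
    proof -
      have \<eta>p: "int_poly [:\<eta>:]" using \<eta>(1) by (rule int_poly_const)
      have "\<not> max_poly [:\<eta>:]"
      proof
        assume "max_poly [:\<eta>:]"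
        then have "in_max (poly.coeff [:\<eta>:] 0)" unfolding max_poly_def by blast
        with \<eta>(2) show False by simp
      qed
      then show "int_poly (\<tau> u)" "\<not> max_poly (\<tau> u)"
        unfolding \<tau>u using int_poly_mult[OF \<eta>p] gauss_lemma[OF \<eta>p] qm[of m] by blast+
      have "poly.coeff (q ^ m) 0 = 0" using q(3) m by (simp add: coeff_0_power)
      then show "poly.coeff (\<tau> u) 0 = 0" unfolding \<tau>u by simp
    qed
    show ?thesis
    proof (rule residue_transcendentalI[OF extensionsD(1)[OF \<nu>] supp, of u])
      have "\<phi> 1 = 1" by (rule \<phi>.hom_one)
      then show "nle \<nu> 1 u" using int[OF U(1)] by (simp add: nle \<phi>_def)
      fix P :: "'k poly"
      assume P: "\<And>i. nle \<nu> 1 [:poly.coeff P i:]" and lt: "\<not> nle \<nu> (pcompose P u) 1"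
      define P' where "P' = map_poly to_ac P"
      have P': "int_poly P'"
        unfolding int_poly_def P'_def using P nle_const[of 1] by (simp add: coeff_map_poly flip: one_pCons)
      have \<tau>P: "\<tau> (pcompose P u) = pcompose P' (\<tau> u)"
        unfolding \<tau>_def h_def P'_def
        by (simp add: unital_ring_hom.map_poly_pcompose[OF unital_ring_hom_to_ac] pcompose_assoc)
      have "int_poly (pcompose P' (\<tau> u))" by (rule int_poly_pcompose[OF P' U(1)])
      moreover have "\<not> vle C (to_fract (pcompose P' (\<tau> u))) 1"
        using lt \<phi>.hom_one by (simp add: nle \<phi>_def \<tau>P)
      ultimately have "max_poly (pcompose P' (\<tau> u))" using unit by blast
      then have "max_poly P'" by (rule max_poly_pcompose_cancel[OF U P'])
      then show "\<forall>i. \<not> nle \<nu> [:poly.coeff P i:] 1"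
        using nle_const[of _ 1] by (simp add: max_poly_def P'_def coeff_map_poly flip: one_pCons)
    qed
  qed
  ultimately show ?thesis using \<nu> by blast
qed

section \<open>Reduction to points of the algebraic closure\<close>

text \<open>\<open>B\<close> is chosen together with \<open>z\<close>: \<open>v\<close> may have
  several extensions to the algebraic closure, and which one fits depends on the valuation to be
  approximated.\<close>

definition near_point :: "('k::field, 'g) pre_valuation \<Rightarrow> ('k poly \<times> 'k poly) set \<Rightarrow> bool" where
  "near_point v T \<longleftrightarrow> (\<exists>B z. lies_over v B \<and> satisfies T (\<lambda>f g. vle B (ac_eval f z) (ac_eval g z)))"

lemma extension_nle_const:
  assumes "valuation v" "\<nu> \<in> extensions v"
  shows "nle \<nu> [:a:] [:b:] \<longleftrightarrow> nle v a b"
  using assms val_equiv_restrict_iff[OF assms(1) extensionsD(1)[OF assms(2)]]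
  by (simp add: extensions_def)

text \<open>Nothing is approximated here. The support is generated by some \<open>Q\<close> of least
  degree, so \<open>\<nu>\<close> is a valuation of the field K(z) for a root \<open>z\<close> of
  \<open>Q\<close>, and Chevalley's theorem extends it to the algebraic closure.\<close>

lemma near_point_of_support:
  fixes v :: "('k::field, 'g) pre_valuation"
  assumes v: "valuation v" and \<nu>: "\<nu> \<in> extensions v" and sat: "satisfies T (nle \<nu>)"
    and supp: "Q0 \<noteq> 0" "nle \<nu> 0 Q0"
  shows "near_point v T"
proof -
  interpret val_preorder "nle \<nu>" by (rule extensionsD(2)[OF \<nu>])
  have "\<exists>Q. (Q \<noteq> 0 \<and> nle \<nu> 0 Q) \<and> (\<forall>R. R \<noteq> 0 \<and> nle \<nu> 0 R \<longrightarrow> Polynomial.degree Q \<le> Polynomial.degree R)"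
    using supp by (intro ex_has_least_nat[of _ Q0]) simp
  then obtain Q where Q: "Q \<noteq> 0" "nle \<nu> 0 Q"
    and min: "\<And>R. R \<noteq> 0 \<Longrightarrow> nle \<nu> 0 R \<Longrightarrow> Polynomial.degree Q \<le> Polynomial.degree R" by blast
  have deg: "Polynomial.degree Q > 0"
  proof (rule ccontr)
    assume "\<not> Polynomial.degree Q > 0"
    then obtain c where c: "Q = [:c:]" by (auto elim: degree_eq_zeroE)
    then have "[:inverse c:] * Q = 1" using Q(1) by (simp add: one_pCons)
    then show False using zero_le_mult_iff[of "[:inverse c:]" Q] Q(2) not_zero_le_one by simp
  qed
  then have "Polynomial.degree (map_poly to_ac Q) > 0" by simp
  then obtain z where z: "ac_eval Q z = 0"
    using alg_closed_imp_poly_has_root unfolding ac_eval_def by blast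
  interpret ev: unital_ring_hom "\<lambda>f. ac_eval f z" by (rule unital_ring_hom_ac_eval)
  have "\<exists>R. (R \<noteq> 0 \<and> ac_eval R z = 0) \<and> (\<forall>S. S \<noteq> 0 \<and> ac_eval S z = 0 \<longrightarrow> Polynomial.degree R \<le> Polynomial.degree S)"
    using Q(1) z by (intro ex_has_least_nat[of _ Q]) simp
  then obtain R where R: "R \<noteq> 0" "ac_eval R z = 0"
    and minR: "\<And>S. S \<noteq> 0 \<Longrightarrow> ac_eval S z = 0 \<Longrightarrow> Polynomial.degree R \<le> Polynomial.degree S" by blast
  have R_dvd: "R dvd f" if "ac_eval f z = 0" for f
  proof -
    have "ac_eval (f mod R) z = 0"
      using that R(2) by (simp add: ev.hom_diff ev.hom_mult flip: minus_div_mult_eq_mod)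
    then have "f mod R = 0"
      using minR[of "f mod R"] degree_mod_less[OF R(1), of f] by fastforce
    then show ?thesis by auto
  qed
  have Q_dvd: "Q dvd f" if "nle \<nu> 0 f" for f
  proof -
    have "nle \<nu> 0 (f div Q * Q)" using Q(2) by (simp add: zero_le_mult_iff)
    then have "nle \<nu> 0 (f mod Q)" using le_diff[OF that] by (simp flip: minus_div_mult_eq_mod)
    then have "f mod Q = 0"
      using min[of "f mod Q"] degree_mod_less[OF Q(1), of f] by fastforce
    then show ?thesis by auto
  qed
  \<comment> \<open>The support is prime and contains \<open>Q = R * S\<close>, but not
    \<open>S\<close>, whose degree is too small. With \<open>R\<close> in the support, evaluation at
    \<open>z\<close> and \<open>\<nu>\<close> have the same kernel.\<close>
  have RS: "nle \<nu> 0 R"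
  proof -
    obtain S where S: "Q = R * S" using R_dvd[OF z] by blast
    have S0: "S \<noteq> 0" using S Q(1) by auto
    have "Polynomial.degree R > 0"
    proof (rule ccontr)
      assume "\<not> Polynomial.degree R > 0"
      then obtain c where "R = [:c:]" by (auto elim: degree_eq_zeroE)
      then show False using R by simp
    qed
    then have "Polynomial.degree S < Polynomial.degree Q"
      using S S0 R(1) by (simp add: degree_mult_eq)
    then have "\<not> nle \<nu> 0 S" using min[OF S0] by linarith
    then show ?thesis using Q(2) unfolding S zero_le_mult_iff by blast
  qed
  have ker: "ac_eval f z = 0 \<longleftrightarrow> nle \<nu> 0 f" for f
  proof
    assume "ac_eval f z = 0"
    then obtain S where "f = R * S" using R_dvd by blast
    then show "nle \<nu> 0 f" using RS by (simp add: zero_le_mult_iff)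
  next
    assume "nle \<nu> 0 f"
    then obtain S where "f = Q * S" using Q_dvd by blast
    then show "ac_eval f z = 0" using z by (simp add: ev.hom_mult)
  qed
  obtain B where B: "valuation_subring B" and nle: "\<And>f g. nle \<nu> f g \<longleftrightarrow> vle B (ac_eval f z) (ac_eval g z)"
    using val_preorder_extend[OF extensionsD(2)[OF \<nu>] unital_ring_hom_ac_eval ker] by blast
  have "vle B (to_ac a) (to_ac b) \<longleftrightarrow> nle v a b" for a b
    using nle[of "[:a:]" "[:b:]"] extension_nle_const[OF v \<nu>, of a b] by simp
  then have "lies_over v B" using B by (simp add: lies_over_def)
  moreover have "satisfies T (\<lambda>f g. vle B (ac_eval f z) (ac_eval g z))"
    using sat nle by (simp add: satisfies_def case_prod_beta ev.hom_zero)
  ultimately show ?thesis unfolding near_point_def by blast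
qed

abbreviation vle_in :: "'a::field \<Rightarrow> 'a set \<Rightarrow> 'a \<Rightarrow> bool" ("(_ \<trianglelefteq>\<^bsub>_\<^esub> _)" [51, 0, 51] 50) where
  "a \<trianglelefteq>\<^bsub>C\<^esub> b \<equiv> vle C a b"

abbreviation veq_in :: "'a::field \<Rightarrow> 'a set \<Rightarrow> 'a \<Rightarrow> bool" ("(_ \<bumpeq>\<^bsub>_\<^esub> _)" [51, 0, 51] 50) where
  "a \<bumpeq>\<^bsub>C\<^esub> b \<equiv> vle C a b \<and> vle C b a"

text \<open>The second alternative covers the case in which some \<open>z - r\<close> has a value
  outside the value group of \<open>M\<close> while \<open>v\<close> is trivial, which is what
  \<open>nle v a 1\<close> for all nonzero \<open>a\<close> expresses; then there is no
  \<open>\<pi>\<close> for \<open>approximate_monomials\<close>.\<close>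

lemma near_point_or_value_transcendental:
  fixes v :: "('k::field, 'g) pre_valuation"
  assumes v: "valuation v" and \<nu>: "\<nu> \<in> extensions v" and T: "finite T" and sat: "satisfies T (nle \<nu>)"
  shows "near_point v T \<or> value_transcendental \<nu> \<and> (\<forall>a. a \<noteq> 0 \<longrightarrow> nle v a 1)"
proof (cases "\<exists>Q. Q \<noteq> 0 \<and> nle \<nu> 0 Q")
  case True
  then show ?thesis using near_point_of_support[OF v \<nu> sat] by blast
next
  case False
  then have supp: "f = 0" if "nle \<nu> 0 f" for f using that by blast
  \<comment> \<open>The field \<open>L\<close> is M(y) with \<open>z = y\<close>. The valuation
    \<open>\<nu>\<close>, carried over by sending x to y and extended to M(y), restricts on
    \<open>M\<close> to an extension of \<open>v\<close>.\<close>
  define \<kappa> :: "'k alg_closure \<Rightarrow> 'k alg_closure poly fract" where "\<kappa> c = to_fract [:c:]" for c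
  define z :: "'k alg_closure poly fract" where "z = to_fract [:0, 1:]"
  define \<phi> :: "'k poly \<Rightarrow> 'k alg_closure poly fract" where "\<phi> f = to_fract (map_poly to_ac f)" for f
  have \<phi>_hom: "unital_ring_hom \<phi>"
    unfolding \<phi>_def by (rule unital_ring_hom_comp[OF unital_ring_hom_to_fract unital_ring_hom_map_to_ac])
  have \<kappa>_hom: "unital_ring_hom \<kappa>"
    unfolding \<kappa>_def by (rule unital_ring_hom_comp[OF unital_ring_hom_to_fract unital_ring_hom_const])
  have ker: "\<phi> f = 0 \<longleftrightarrow> nle \<nu> 0 f" for f
    using supp[of f] val_preorder.le_zero[OF extensionsD(2)[OF \<nu>], of 0] by (auto simp: \<phi>_def)
  obtain C where C: "valuation_subring C" and nle: "\<And>f g. nle \<nu> f g \<longleftrightarrow> vle C (\<phi> f) (\<phi> g)"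
    using val_preorder_extend[OF extensionsD(2)[OF \<nu>] \<phi>_hom ker] by blast
  interpret \<phi>: unital_ring_hom \<phi> by (rule \<phi>_hom)
  have "approximation C \<kappa> z"
  proof (intro approximation.intro approximation_axioms.intro C \<kappa>_hom)
    show "z \<noteq> \<kappa> a" for a by (simp add: z_def \<kappa>_def)
  qed
  then interpret approximation C \<kappa> z .
  have at_z: "at_z p = to_fract p" for p
  proof (induction p)
    case (pCons a p)
    have "pCons a p = [:a:] + [:0, 1:] * p" by simp
    then have "to_fract (pCons a p) = \<kappa> a + z * to_fract p"
      unfolding \<kappa>_def z_def by (simp only: to_fract_add to_fract_mult)
    with pCons show ?case by (simp add: map_poly_pCons \<kappa>.hom_zero)
  qed simp
  define B where "B = {c. \<kappa> c \<in> C}"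
  have vleB: "vle B a b \<longleftrightarrow> vle C (\<kappa> a) (\<kappa> b)" for a b
    by (simp add: vle_def B_def \<kappa>_divide)
  have "valuation_subring B"
  proof
    show "a \<in> B \<or> inverse a \<in> B" for a
      using C.total[of "\<kappa> a"] \<kappa>_divide[of 1 a] by (simp add: B_def \<kappa>.hom_one inverse_eq_divide)
  qed (simp_all add: B_def \<kappa>.hom_one \<kappa>.hom_add \<kappa>.hom_mult \<kappa>.hom_uminus C.one_mem C.add_mem C.mult_mem C.uminus_mem)
  moreover have "vle B (to_ac a) (to_ac b) \<longleftrightarrow> nle v a b" for a b
    using nle[of "[:a:]" "[:b:]"] extension_nle_const[OF v \<nu>, of a b]
    by (simp add: vleB \<phi>_def \<kappa>_def map_poly_pCons)
  ultimately have B: "lies_over v B" by (simp add: lies_over_def)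
  have \<phi>_at_z: "\<phi> f = at_z (map_poly to_ac f)" for f by (simp add: \<phi>_def at_z)
  have \<phi>_eq_0: "\<phi> f = 0 \<longleftrightarrow> f = 0" for f by (simp add: \<phi>_def)
  \<comment> \<open>A zero \<open>f\<close> is set apart: its condition holds at any point where
    \<open>g\<close> does not vanish, while the approximation results concern nonzero
    polynomials.\<close>
  have near: "near_point v T"
    if z': "\<And>f g. (f, g) \<in> T \<Longrightarrow> ac_eval g z' \<noteq> 0 \<and> (f \<noteq> 0 \<longrightarrow> \<kappa> (ac_eval g z') \<trianglelefteq>\<^bsub>C\<^esub> \<kappa> (ac_eval f z'))" for z'
    unfolding near_point_def satisfies_def
  proof (intro exI conjI ballI, rule B, clarify)
    fix f g assume fg: "(f, g) \<in> T"
    show "vle B (ac_eval g z') (ac_eval f z') \<and> \<not> vle B (ac_eval 0 z') (ac_eval g z')"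
      using z'[OF fg] unfolding vleB
      by (cases "f = 0") (simp_all add: unital_ring_hom.hom_zero[OF unital_ring_hom_ac_eval] C.le_zero \<kappa>.hom_zero)
  qed
  have Tg: "g \<noteq> 0 \<and> \<phi> g \<trianglelefteq>\<^bsub>C\<^esub> \<phi> f" if "(f, g) \<in> T" for f g
    using sat that unfolding satisfies_def nle by (auto simp: \<phi>_eq_0 \<phi>.hom_zero)
  define P where "P = {p. p \<noteq> 0 \<and> (\<exists>(f, g)\<in>T. p = map_poly to_ac f \<or> p = map_poly to_ac g)}"
  have "P \<subseteq> map_poly to_ac ` (fst ` T \<union> snd ` T)" by (force simp: P_def)
  then have P: "finite P" "0 \<notin> P" using T finite_surj[of "fst ` T \<union> snd ` T" P] by (auto simp: P_def)
  have PT: "map_poly to_ac g \<in> P" "f \<noteq> 0 \<Longrightarrow> map_poly to_ac f \<in> P" if "(f, g) \<in> T" for f g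
    using that Tg[OF that] unfolding P_def by auto
  show ?thesis
  proof (cases "\<forall>r. \<exists>c. c \<noteq> 0 \<and> z - \<kappa> r \<bumpeq>\<^bsub>C\<^esub> \<kappa> c")
    case True
    then obtain z' where z': "\<forall>p\<in>P. at_z p \<bumpeq>\<^bsub>C\<^esub> \<kappa> (poly p z')"
      using approximate_values[OF _ P] by blast
    have ev: "\<phi> f \<bumpeq>\<^bsub>C\<^esub> \<kappa> (ac_eval f z')" if "map_poly to_ac f \<in> P" for f
      using z' that by (simp add: \<phi>_at_z ac_eval_def)
    have "near_point v T"
    proof (rule near)
      fix f g assume fg: "(f, g) \<in> T"
      have g: "\<phi> g \<bumpeq>\<^bsub>C\<^esub> \<kappa> (ac_eval g z')" by (rule ev[OF PT(1)[OF fg]])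
      have "\<phi> g \<noteq> 0" using Tg[OF fg] \<phi>_eq_0 by blast
      from C.eqv_nonzero[OF g this] have "ac_eval g z' \<noteq> 0" by simp
      moreover have "\<kappa> (ac_eval g z') \<trianglelefteq>\<^bsub>C\<^esub> \<kappa> (ac_eval f z')" if "f \<noteq> 0"
        using C.le_cong[OF g ev[OF PT(2)[OF fg that]]] Tg[OF fg] by blast
      ultimately show "ac_eval g z' \<noteq> 0 \<and> (f \<noteq> 0 \<longrightarrow> \<kappa> (ac_eval g z') \<trianglelefteq>\<^bsub>C\<^esub> \<kappa> (ac_eval f z'))" by blast
    qed
    then show ?thesis ..
  next
    case False
    then obtain r where r: "\<And>c. c \<noteq> 0 \<Longrightarrow> \<not> z - \<kappa> r \<bumpeq>\<^bsub>C\<^esub> \<kappa> c" by blast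
    define t where "t = z - \<kappa> r"
    have t: "\<And>c. c \<noteq> 0 \<Longrightarrow> \<not> t \<bumpeq>\<^bsub>C\<^esub> \<kappa> c" "t \<noteq> 0" using r z_new[of r] by (simp_all add: t_def)
    define q where "q p = pcompose p [:r, 1:]" for p
    have q0: "q p \<noteq> 0" if "p \<noteq> 0" for p
      unfolding q_def using that pcompose_eq_0[of p "[:r, 1:]"] by auto
    have shift: "poly (map_poly \<kappa> (q p)) s = poly (map_poly \<kappa> p) (\<kappa> r + s)" for p s
      by (simp add: q_def \<kappa>.map_poly_pcompose poly_pcompose map_poly_pCons \<kappa>.hom_zero \<kappa>.hom_one)
    define dom where "dom p k \<longleftrightarrow> poly.coeff (q p) k \<noteq> 0 \<and> (\<forall>i\<le>Polynomial.degree (q p). i \<noteq> k \<longrightarrow>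
      \<not> \<kappa> (poly.coeff (q p) i) * t ^ i \<trianglelefteq>\<^bsub>C\<^esub> \<kappa> (poly.coeff (q p) k) * t ^ k)" for p k
    have "\<exists>k. dom p k" if "p \<noteq> 0" for p
      using dominant_monomial[OF t q0[OF that]] unfolding dom_def .
    then obtain k where k: "\<And>p. p \<noteq> 0 \<Longrightarrow> dom p (k p)" by metis
    define a where "a p = poly.coeff (q p) (k p)" for p
    have a: "a p \<noteq> 0" if "p \<noteq> 0" for p using k[OF that] by (simp add: a_def dom_def)
    have at: "at_z p \<bumpeq>\<^bsub>C\<^esub> \<kappa> (a p) * t ^ k p" if "p \<noteq> 0" for p
    proof -
      have "poly (map_poly \<kappa> (q p)) t = at_z p" by (simp add: shift t_def)
      moreover have "poly (map_poly \<kappa> (q p)) t \<bumpeq>\<^bsub>C\<^esub> \<kappa> (a p) * t ^ k p"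
        unfolding a_def by (rule poly_eqv_dominant[OF _ t(2)]) (use k[OF that] in \<open>simp_all add: dom_def\<close>)
      ultimately show ?thesis by simp
    qed
    have vt: "value_transcendental \<nu>"
    proof -
      \<comment> \<open>As \<open>Q\<close> vanishes at \<open>r\<close>, its expansion in powers of
        \<open>t\<close> has no constant term, so its dominant exponent is positive. The dominant
        term of a positive power then cannot tie with a constant, a monomial of exponent 0.\<close>
      obtain Q where Q: "Q \<noteq> 0" "ac_eval Q r = 0" using ex_ac_root by blast
      define p where "p = map_poly to_ac Q"
      have p: "p \<noteq> 0" "poly p r = 0" using Q by (simp_all add: p_def ac_eval_def)
      have "poly.coeff (q p) 0 = 0" using p(2) by (simp add: q_def pcompose_coeff_0)
      then have kp: "k p > 0" using a[OF p(1)] by (cases "k p") (auto simp: a_def)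
      show ?thesis
      proof (rule value_transcendentalI[OF extensionsD(1)[OF \<nu>] supp Q(1)])
        fix n :: nat and c
        assume n: "n > 0" and "nle \<nu> (Q ^ n) [:c:]" "nle \<nu> [:c:] (Q ^ n)"
        then have eq: "\<phi> Q ^ n \<bumpeq>\<^bsub>C\<^esub> \<kappa> (to_ac c)"
          by (simp add: nle \<phi>.hom_power) (simp add: \<phi>_def \<kappa>_def map_poly_pCons)
        have "\<phi> Q ^ n \<noteq> 0" using Q(1) by (simp add: \<phi>_eq_0)
        from C.eqv_nonzero[OF eq this] have "c \<noteq> 0" by simp
        have "\<phi> Q ^ n \<bumpeq>\<^bsub>C\<^esub> (\<kappa> (a p) * t ^ k p) ^ n"
          unfolding \<phi>_at_z p_def[symmetric] by (rule C.eqv_power[OF at[OF p(1)]])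
        moreover have "(\<kappa> (a p) * t ^ k p) ^ n = \<kappa> (a p ^ n) * t ^ (k p * n)"
          by (simp add: power_mult_distrib \<kappa>.hom_power power_mult)
        ultimately have "\<phi> Q ^ n \<bumpeq>\<^bsub>C\<^esub> \<kappa> (a p ^ n) * t ^ (k p * n)" by (simp only:)
        from C.eqv_trans_left[OF this eq]
        have "\<kappa> (a p ^ n) * t ^ (k p * n) \<bumpeq>\<^bsub>C\<^esub> \<kappa> (to_ac c) * t ^ 0" by simp
        moreover have "\<not> \<kappa> (a p ^ n) * t ^ (k p * n) \<bumpeq>\<^bsub>C\<^esub> \<kappa> (to_ac c) * t ^ 0"
          using n kp a[OF p(1)] \<open>c \<noteq> 0\<close> by (intro monomials_not_eqv[OF t]) simp_all
        ultimately show False by blast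
      qed
    qed
    show ?thesis
    proof (cases "\<forall>a. a \<noteq> 0 \<longrightarrow> nle v a 1")
      case True
      with vt show ?thesis by blast
    next
      case False
      then obtain \<pi> where \<pi>: "\<pi> \<noteq> 0" "\<not> nle v \<pi> 1" by blast
      have \<pi>': "to_ac \<pi> \<noteq> 0" "\<not> \<kappa> (to_ac \<pi>) \<trianglelefteq>\<^bsub>C\<^esub> 1"
        using \<pi> lies_overD(2)[OF B, of \<pi> 1] by (simp_all add: vleB \<kappa>.hom_one)
      \<comment> \<open>These inequalities express which term of each polynomial dominates at
        \<open>t\<close>; once \<open>e\<close> satisfies them too, the value at \<open>z'\<close>
        is that of the same monomial in \<open>e\<close>.\<close>
      define W1 where "W1 = (\<Union>p\<in>P. (\<lambda>i. (a p, k p, poly.coeff (q p) i, i)) ` {i. i \<le> Polynomial.degree (q p) \<and> i \<noteq> k p})"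
      define mon where "mon f g = (a (map_poly to_ac g), k (map_poly to_ac g), a (map_poly to_ac f), k (map_poly to_ac f))"
        for f g :: "'k poly"
      define strict where "strict w \<longleftrightarrow> (case w of (a, i, b, j) \<Rightarrow> \<not> \<kappa> b * t ^ j \<trianglelefteq>\<^bsub>C\<^esub> \<kappa> a * t ^ i)" for w
      \<comment> \<open>Of the conditions in \<open>T\<close> only the strict comparisons between
        dominant terms are imposed on \<open>e\<close>. A tie forces equal exponents and becomes a
        comparison of coefficients, which does not involve \<open>e\<close>.\<close>
      define W where "W = W1 \<union> {w \<in> (\<lambda>(f, g). mon f g) ` T. strict w}"
      have "finite W" unfolding W_def W1_def using T P by auto
      moreover have "\<not> \<kappa> b * t ^ j \<trianglelefteq>\<^bsub>C\<^esub> \<kappa> a' * t ^ i" if "(a', i, b, j) \<in> W" for a' i b j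
        using that
      proof (unfold W_def, elim UnE)
        assume "(a', i, b, j) \<in> W1"
        then obtain p where p: "p \<in> P" "a' = a p" "i = k p" "b = poly.coeff (q p) j"
          "j \<le> Polynomial.degree (q p)" "j \<noteq> k p" by (auto simp: W1_def)
        then have "p \<noteq> 0" using P(2) by auto
        from k[OF this] p show ?thesis unfolding dom_def a_def by simp
      qed (simp add: strict_def)
      ultimately obtain e where e: "e \<noteq> 0" and eW: "\<forall>(a, i, b, j)\<in>W. \<not> \<kappa> b * \<kappa> e ^ j \<trianglelefteq>\<^bsub>C\<^esub> \<kappa> a * \<kappa> e ^ i"
        using approximate_monomials[OF t(2) \<pi>', of W] by blast
      define z' where "z' = r + e"
      have val: "\<kappa> (poly p z') \<bumpeq>\<^bsub>C\<^esub> \<kappa> (a p) * \<kappa> e ^ k p" if p: "p \<in> P" for p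
      proof -
        have "p \<noteq> 0" using p P(2) by auto
        have "poly (map_poly \<kappa> (q p)) (\<kappa> e) = \<kappa> (poly p z')"
          by (simp add: z'_def q_def \<kappa>.poly_map_poly poly_pcompose)
        moreover have "poly (map_poly \<kappa> (q p)) (\<kappa> e) \<bumpeq>\<^bsub>C\<^esub> \<kappa> (a p) * \<kappa> e ^ k p"
          unfolding a_def
        proof (rule poly_eqv_dominant)
          fix i assume "i \<le> Polynomial.degree (q p)" "i \<noteq> k p"
          then have "(a p, k p, poly.coeff (q p) i, i) \<in> W" using p by (auto simp: W_def W1_def)
          from bspec[OF eW this]
          show "\<not> \<kappa> (poly.coeff (q p) i) * \<kappa> e ^ i \<trianglelefteq>\<^bsub>C\<^esub> \<kappa> (poly.coeff (q p) (k p)) * \<kappa> e ^ k p"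
            by (simp add: a_def)
        qed (use a[OF \<open>p \<noteq> 0\<close>] e in \<open>simp_all add: a_def\<close>)
        ultimately show ?thesis by simp
      qed
      have "near_point v T"
      proof (rule near)
        fix f g assume fg: "(f, g) \<in> T"
        define pf pg where "pf = map_poly to_ac f" and "pg = map_poly to_ac g"
        have pg: "pg \<in> P" "pg \<noteq> 0" using PT(1)[OF fg] Tg[OF fg] by (simp_all add: pg_def)
        have vg: "\<kappa> (ac_eval g z') \<bumpeq>\<^bsub>C\<^esub> \<kappa> (a pg) * \<kappa> e ^ k pg"
          using val[OF pg(1)] by (simp add: ac_eval_def pg_def)
        have "\<kappa> (a pg) * \<kappa> e ^ k pg \<noteq> 0" using a[OF pg(2)] e by simp
        then have "ac_eval g z' \<noteq> 0" using C.eqv_nonzero[OF conjI[OF conjunct2[OF vg] conjunct1[OF vg]]] by simp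
        moreover have "\<kappa> (ac_eval g z') \<trianglelefteq>\<^bsub>C\<^esub> \<kappa> (ac_eval f z')" if f: "f \<noteq> 0"
        proof -
          have pf: "pf \<in> P" "pf \<noteq> 0" using PT(2)[OF fg f] f by (simp_all add: pf_def)
          have vf: "\<kappa> (ac_eval f z') \<bumpeq>\<^bsub>C\<^esub> \<kappa> (a pf) * \<kappa> e ^ k pf"
            using val[OF pf(1)] by (simp add: ac_eval_def pf_def)
          have "at_z pg \<trianglelefteq>\<^bsub>C\<^esub> at_z pf" using Tg[OF fg] by (simp add: \<phi>_at_z pf_def pg_def)
          then have le: "\<kappa> (a pg) * t ^ k pg \<trianglelefteq>\<^bsub>C\<^esub> \<kappa> (a pf) * t ^ k pf"
            by (rule C.le_cong[OF at[OF pg(2)] at[OF pf(2)]])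
          have "\<kappa> (a pg) * \<kappa> e ^ k pg \<trianglelefteq>\<^bsub>C\<^esub> \<kappa> (a pf) * \<kappa> e ^ k pf"
          proof (cases "strict (mon f g)")
            case True
            then have "mon f g \<in> W" unfolding W_def using fg by (auto intro!: image_eqI[of _ _ "(f, g)"])
            from bspec[OF eW this] show ?thesis
              unfolding mon_def pf_def[symmetric] pg_def[symmetric] by (simp add: C.lt_imp_le)
          next
            case False
            then have eqv: "\<kappa> (a pg) * t ^ k pg \<bumpeq>\<^bsub>C\<^esub> \<kappa> (a pf) * t ^ k pf"
              using le unfolding strict_def mon_def pf_def[symmetric] pg_def[symmetric] by simp
            then have kk: "k pg = k pf"
              using monomials_not_eqv[OF t _ a[OF pg(2)] a[OF pf(2)], of "k pg" "k pf"] by blast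
            then have "\<kappa> (a pg) \<trianglelefteq>\<^bsub>C\<^esub> \<kappa> (a pf)"
              using le C.vle_mult_iff[of "t ^ k pf"] t(2) by simp
            then show ?thesis unfolding kk by (rule C.le_mult_right)
          qed
          then show ?thesis
            using C.le_cong[OF conjI[OF conjunct2[OF vg] conjunct1[OF vg]] conjI[OF conjunct2[OF vf] conjunct1[OF vf]]]
            by blast
        qed
        ultimately show "ac_eval g z' \<noteq> 0 \<and> (f \<noteq> 0 \<longrightarrow> \<kappa> (ac_eval g z') \<trianglelefteq>\<^bsub>C\<^esub> \<kappa> (ac_eval f z'))" by blast
      qed
      then show ?thesis ..
    qed
  qed
qed

text \<open>In the second alternative of \<open>near_point_or_value_transcendental\<close>,
  \<open>\<nu>\<close> itself is the witness.\<close>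

lemma value_transcendental_near:
  assumes v: "valuation v" and \<nu>: "\<nu> \<in> extensions v" and T: "finite T" and sat: "satisfies T (nle \<nu>)"
  shows "\<exists>\<nu>'\<in>extensions v. value_transcendental \<nu>' \<and> satisfies T (nle \<nu>')"
  using near_point_or_value_transcendental[OF assms]
proof
  assume "near_point v T"
  then show ?thesis
    unfolding near_point_def using value_transcendental_near_point[OF v] by blast
qed (use \<nu> sat in blast)

lemma residue_transcendental_near:
  fixes v :: "('k::field, 'g) pre_valuation"
  assumes v: "valuation v" and \<nu>: "\<nu> \<in> extensions v" and T: "finite T" and sat: "satisfies T (nle \<nu>)"
  shows "\<exists>\<nu>'\<in>extensions v. residue_transcendental \<nu>' \<and> satisfies T (nle \<nu>')"
proof (cases "\<forall>a. a \<noteq> 0 \<longrightarrow> nle v a 1")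
  case True
  interpret val_preorder "nle v" by (rule val_preorder_nle[OF v])
  \<comment> \<open>No nonzero element has positive value, and quotients of nonzero elements are
    nonzero too, so all nonzero elements have the same value.\<close>
  have triv: "nle v a b \<longleftrightarrow> b = 0 \<or> a \<noteq> 0" for a b
  proof
    assume ab: "nle v a b"
    show "b = 0 \<or> a \<noteq> 0"
    proof (rule ccontr)
      assume "\<not> (b = 0 \<or> a \<noteq> 0)"
      then have "nle v (0 * inverse b) (b * inverse b)" using le_mult_right[OF ab, of "inverse b"] by simp
      then show False using \<open>\<not> (b = 0 \<or> a \<noteq> 0)\<close> not_zero_le_one by simp
    qed
  next
    assume ab: "b = 0 \<or> a \<noteq> 0"
    show "nle v a b"
    proof (cases "b = 0")
      case False
      then have "nle v (a / b) 1" using True ab by simp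
      then have "nle v (a / b * b) (1 * b)" by (rule le_mult_right)
      then show ?thesis using False by simp
    qed (simp add: le_zero)
  qed
  have "g \<noteq> 0" if "(f, g) \<in> T" for f g
    using sat that val_preorder.le_refl[OF extensionsD(2)[OF \<nu>], of 0] by (auto simp: satisfies_def)
  then show ?thesis using residue_transcendental_trivial[OF v triv] by blast
next
  case False
  then obtain \<pi> where \<pi>: "\<pi> \<noteq> 0" "\<not> nle v \<pi> 1" by blast
  \<comment> \<open>The element \<open>\<pi>\<close> of positive value excludes the second
    alternative, in which \<open>v\<close> is trivial.\<close>
  then have "near_point v T" using near_point_or_value_transcendental[OF assms] by blast
  then show ?thesis
    unfolding near_point_def using residue_transcendental_near_point[OF v _ \<pi> T] by blast
qed

theorem proposition3p3:
  fixes v :: "('k::field, 'g) pre_valuation"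
  assumes "valuation v"
  shows "valuation_spectrum v closure_of VV_vt v = VV v \<and>
    valuation_spectrum v closure_of VV_rt v = VV v"
  unfolding VV_vt_def VV_rt_def
  by (intro conjI valuation_spectrum_dense value_transcendental_near[OF assms] residue_transcendental_near[OF assms])

end
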